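(* Consider a heterogeneous network of $N$ agents $$x_i(k+1)=A_ix_i(k)+B_iu_i(k),\qquad y_i(k)=C_ix_i(k),\qquad i=1,\dots,N,$$ with $x_i\in\mathbb{R}^{n_i}$, $u_i\in\mathbb{R}^{m_i}$, $y_i\in\mathbb{R}^p$, each with local measurement $z_i(k)=C_i^mx_i(k)\in\mathbb{R}^{q_i}$, and an exosystem $x_r(k+1)=A_rx_r(k)$, $y_r(k)=C_rx_r(k)\in\mathbb{R}^p$. Assume that for every $i$: $(C_i,A_i,B_i)$ is stabilizable and detectable, $(C_i,A_i,B_i)$ is right-invertible, and $(C_i^m,A_i)$ is detectable; and that $(C_r,A_r)$ is observable and all eigenvalues of $A_r$ are on the unit circle. Then the scalable delayed regulated output synchronization problem (defined in the context) is solvable. In particular, let $(\check C_r,\check A_r,\check B_r)$ be a target model and let $(A_{i,h},B_{i,h},C_{i,h},D_{i,h},E_{i,h})$ be pre-compensators as described in the context, let $K$ and $H$ be such that $\check A_r-\check B_rK$ and $\check A_r-H\check C_r$ are Schur stable, and let each agent $i$ use the protocol $$\begin{aligned}p_i(k+1)&=A_{i,h}p_i(k)+B_{i,h}z_i(k)-E_{i,h}K\chi_i(k),\\ \hat x_i(k+1)&=\check A_r\hat x_i(k)-\check B_rK\hat\zeta_i(k)+H\big(\bar\zeta_i(k)-\check C_r\hat x_i(k)\big),\\ \chi_i(k+1)&=(\check A_r-\check B_rK)\chi_i(k)+\check A_r\hat x_i(k)-\check A_r\hat\zeta_i(k),\\ u_i(k)&=C_{i,h}p_i(k)-D_{i,h}K\chi_i(k),\end{aligned}$$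 with exchanged variable $\xi_i=\chi_i$, i.e. $\hat\zeta_i(k)=\chi_i(k)-\sum_{j=1}^N\bar d_{ij}\chi_j(k-\hat\kappa_{ij})$. Then for any $N$, any graph $\mathcal{G}\in\mathbb{G}^N$, all communication delays $\kappa_{ij},\hat\kappa_{ij}$ and all initial conditions, delayed regulated output synchronization is achieved: $$\lim_{k\to\infty}\big[y_i(k)-y_r(k-\kappa_{ir})\big]=0\quad\text{for all } i\in\{1,\dots,N\}.$$
   Context: Schur stable: all eigenvalues of the square matrix lie in the open unit disc. Graphs: a weighted graph on nodes $\{1,\dots,N\}$ has weights $a_{ij}\ge 0$, $a_{ii}=0$, where $a_{ij}>0$ iff there is an edge from $j$ to $i$. Its Laplacian $L=[\ell_{ij}]$ has $\ell_{ii}=\sum_k a_{ik}$ and $\ell_{ij}=-a_{ij}$ for $i\ne j$. $\mathbb{G}^N$ is the set of weighted graphs on $N$ nodes that are themselves directed spanning trees (one root with no parent, every other node has exactly one parent, and the root has a directed path to every other node), with nodes numbered so that $L$ is lower triangular; thus node $1$ is the root, the first row of $L$ is zero, and $\ell_{ii}>0$ for $i\ge 2$. Expanded Laplacian: $\iota_1=1$, $\iota_i=0$ for $i\ge2$ (only the root agent receives exosystem information); $\bar L=[\bar\ell_{ij}]=L+\mathrm{diag}\{\iota_i\}$; $d_{in}(i)=\sum_j a_{ij}$, $D_{in}=\mathrm{diag}\{d_{in}(i)\}$; $\bar D=[\bar d_{ij}]=I-(2I+D_{in})^{-1}\bar L$. Delays: for $j\neq i$, $\kappa_{ij}\in\mathbb{N}^+$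 and $\hat\kappa_{ij}\in\mathbb{N}^+$ are unknown constant communication delays from agent $j$ to agent $i$ (relevant only when $a_{ij}>0$), for the output exchange and for the protocol-variable exchange respectively; $\kappa_{ii}=\hat\kappa_{ii}=0$. $\kappa_{1r}$ is the unknown constant nonnegative integer delay from the exosystem to agent $1$. For $i\ge2$, $\kappa_{ir}$ is the sum of the delays ($\kappa_{1r}$ and the $\kappa$'s of the edges) along the unique path from the exosystem via agent 1 to agent $i$, so $\kappa_{ij}=\kappa_{ir}-\kappa_{jr}$ for each edge from $j$ to $i$. Network information available to agent $i$: $$\bar\zeta_i(k)=\frac{1}{2+d_{in}(i)}\sum_{j=1}^N\bar\ell_{ij}\big(y_j(k-\kappa_{ij})-y_r(k-\kappa_{ir})\big)=y_i(k)-y_r(k-\kappa_{ir})-\sum_{j=1}^N\bar d_{ij}\big(y_j(k-\kappa_{ij})-y_r(k-\kappa_{ir})\big),$$ $$\hat\zeta_i(k)=\frac{1}{2+d_{in}(i)}\sum_{j=1}^N\bar\ell_{ij}\xi_j(k-\hat\kappa_{ij})=\xi_i(k)-\sum_{j=1}^N\bar d_{ij}\xi_j(k-\hat\kappa_{ij}),$$ where $\xi_j$ is a variable produced by the protocol of agent $j$. Initial conditions include arbitrary initial data at the finitely many negative times needed by the delays. Scalable delayed regulated output synchronization problem: find, for each agent $i$, using only knowledge of the agent models (in particular not of the graph, the size of the network, or the delays), a linear dynamic protocol $$\begin{aligned}x_{i,c}(k+1)&=A_{i,c}x_{i,c}(k)+B_{i,c}\bar\zeta_i(k)+C_{i,c}\hat\zeta_i(k)+D_{i,c}z_i(k),\\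 u_i(k)&=E_{i,c}x_{i,c}(k)+F_{i,c}\bar\zeta_i(k)+G_{i,c}\hat\zeta_i(k)+H_{i,c}z_i(k),\end{aligned}$$ with $\xi_i=H_cx_{i,c}$, such that for any $N$, any $\mathcal{G}\in\mathbb{G}^N$, any delays $\kappa_{ij},\hat\kappa_{ij}$ and any initial conditions, $\lim_{k\to\infty}[y_i(k)-y_r(k-\kappa_{ir})]=0$ for all $i\in\{1,\dots,N\}$. Target model (known lemma of Yang, Saberi, Stoorvogel and Grip): let $n_q$ be an integer greater than or equal to the maximal order of the infinite zeros of the $(C_i,A_i,B_i)$ and all observability indices of $(C_r,A_r)$. There exist matrices $\check A_r,\check C_r$ such that for every $x_{r0}$ there is $\check x_{r0}$ for which $\check x_r(k+1)=\check A_r\check x_r(k)$, $\check x_r(0)=\check x_{r0}$, $y_r(k)=\check C_r\check x_r(k)$ generates exactly the same output $y_r$ as the original exosystem with $x_r(0)=x_{r0}$, and a matrix $\check B_r$ such that $(\check C_r,\check A_r,\check B_r)$ is invertible, of uniform rank $n_q$ (all infinite zeros have order $n_q$), and has no invariant zeros. The eigenvalues of $\check A_r$ are those of $A_r$ together with additional zero eigenvalues. Any such triple is called a target model. Pre-compensators (known from the same work, which provides their existence for each agent): for each $i$, a system $$p_i(k+1)=A_{i,h}p_i(k)+B_{i,h}z_i(k)+E_{i,h}v_i(k),\qquad u_i(k)=C_{i,h}p_i(k)+D_{i,h}v_i(k),$$ such that the interconnection with agent $i$, with new input $v_i$ and output $y_i$, is described by $$x_i^h(k+1)=\check A_rx_i^h(k)+\check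 B_r\big(v_i(k)+\rho_i(k)\big),\qquad y_i(k)=\check C_rx_i^h(k),$$ where $\rho_i$ is generated by $\omega_i(k+1)=A_{i,s}\omega_i(k)$, $\rho_i(k)=C_{i,s}\omega_i(k)$ with $A_{i,s}$ Schur stable; that is, for all initial conditions of agent and pre-compensator there are initial conditions $x_i^h(0),\omega_i(0)$ such that this representation of $y_i$ holds for every input $v_i$. In the protocol $v_i=-K\chi_i$. *)

theory Defs
  imports Complex_Main
    "HOL-Computational_Algebra.Fraction_Field"
    "Jordan_Normal_Form.Char_Poly"
    "Jordan_Normal_Form.DL_Rank"
begin

section \<open>Linear discrete-time systems\<close>

definition schur_stable :: "real mat \<Rightarrow> bool" where
  "schur_stable A \<longleftrightarrow> square_mat A \<and>
     (\<forall>l. eigenvalue (map_mat complex_of_real A) l \<longrightarrow> cmod l < 1)"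

definition stabilizable :: "real mat \<Rightarrow> real mat \<Rightarrow> bool" where
  "stabilizable A B \<longleftrightarrow> (\<exists>F \<in> carrier_mat (dim_col B) (dim_row A). schur_stable (A + B * F))"

definition detectable :: "real mat \<Rightarrow> real mat \<Rightarrow> bool" where
  "detectable C A \<longleftrightarrow> (\<exists>L \<in> carrier_mat (dim_row A) (dim_row C). schur_stable (A + L * C))"

definition observable :: "real mat \<Rightarrow> real mat \<Rightarrow> bool" where
  "observable C A \<longleftrightarrow>
     (\<forall>x \<in> carrier_vec (dim_row A).
        (\<forall>k. C *\<^sub>v ((A ^\<^sub>m k) *\<^sub>v x) = 0\<^sub>v (dim_row C)) \<longrightarrow> x = 0\<^sub>v (dim_row A))"

text \<open>The first \<open>r\<close> rows in the list
  \<open>c\<^sub>1, \<dots>, c\<^sub>p, c\<^sub>1 A, \<dots>, c\<^sub>p A, c\<^sub>1 A\<^sup>2, \<dots>\<close>, where \<open>c\<^sub>1, \<dots>, c\<^sub>p\<close> are the rows of \<open>C\<close>.\<close>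

definition obs_rows :: "real mat \<Rightarrow> real mat \<Rightarrow> nat \<Rightarrow> real mat" where
  "obs_rows C A r =
     mat r (dim_row A) (\<lambda>(i, t). (C * A ^\<^sub>m (i div dim_row C)) $$ (i mod dim_row C, t))"

text \<open>The \<open>j\<close>-th observability index (\<open>j\<close> counted from \<open>0\<close>) is the number of those \<open>k\<close> for which
  \<open>c\<^sub>j A\<^sup>k\<close> is not a linear combination of its predecessors in the above list.\<close>

definition observability_index :: "real mat \<Rightarrow> real mat \<Rightarrow> nat \<Rightarrow> nat" where
  "observability_index C A j =
     card {k. vec_space.rank (k * dim_row C + j + 1) (obs_rows C A (k * dim_row C + j + 1))
            \<noteq> vec_space.rank (k * dim_row C + j) (obs_rows C A (k * dim_row C + j))}"

subsection \<open>Transfer functions, invertibility, zeros\<close>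

text \<open>Rational functions in \<open>z\<close> are elements of \<^typ>\<open>real poly fract\<close>. The transfer function
  \<open>C (z I - A)\<^sup>-\<^sup>1 B\<close> is written with the adjugate of \<open>z I - A\<close>.\<close>

abbreviation fract_mat :: "real poly mat \<Rightarrow> real poly fract mat" where
  "fract_mat \<equiv> map_mat (\<lambda>q. Fract q 1)"

abbreviation const_mat :: "real mat \<Rightarrow> real poly mat" where
  "const_mat \<equiv> map_mat (\<lambda>c. [:c:])"

definition transfer_function :: "real mat \<Rightarrow> real mat \<Rightarrow> real mat \<Rightarrow> real poly fract mat" where
  "transfer_function C A B =
     Fract 1 (char_poly A) \<cdot>\<^sub>m
       fract_mat (const_mat C * adj_mat (char_poly_matrix A) * const_mat B)"

definition right_invertible :: "real mat \<Rightarrow> real mat \<Rightarrow> real mat \<Rightarrow> bool" where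
  "right_invertible C A B \<longleftrightarrow>
     (\<exists>R \<in> carrier_mat (dim_col B) (dim_row C). transfer_function C A B * R = 1\<^sub>m (dim_row C))"

definition left_invertible :: "real mat \<Rightarrow> real mat \<Rightarrow> real mat \<Rightarrow> bool" where
  "left_invertible C A B \<longleftrightarrow>
     (\<exists>R \<in> carrier_mat (dim_col B) (dim_row C). R * transfer_function C A B = 1\<^sub>m (dim_col B))"

definition invertible_sys :: "real mat \<Rightarrow> real mat \<Rightarrow> real mat \<Rightarrow> bool" where
  "invertible_sys C A B \<longleftrightarrow> right_invertible C A B \<and> left_invertible C A B"

definition proper_fract :: "real poly fract \<Rightarrow> bool" where
  "proper_fract f \<longleftrightarrow> (\<exists>a b. b \<noteq> 0 \<and> degree a \<le> degree b \<and> f = Fract a b)"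

definition proper_mat :: "real poly fract mat \<Rightarrow> bool" where
  "proper_mat P \<longleftrightarrow> (\<forall>i < dim_row P. \<forall>j < dim_col P. proper_fract (P $$ (i, j)))"

definition biproper :: "nat \<Rightarrow> real poly fract mat \<Rightarrow> bool" where
  "biproper n P \<longleftrightarrow> P \<in> carrier_mat n n \<and> proper_mat P \<and>
     (\<exists>P' \<in> carrier_mat n n. proper_mat P' \<and> P * P' = 1\<^sub>m n \<and> P' * P = 1\<^sub>m n)"

text \<open>\<open>ds\<close> lists the orders of the infinite zeros: the Smith-McMillan form at infinity of the
  transfer function is \<open>diag(z\<^sup>-\<^sup>d, \<dots>)\<close> with \<open>d\<close> ranging over \<open>ds\<close>, padded with zeros.\<close>

definition infinite_zero_orders ::
  "real mat \<Rightarrow> real mat \<Rightarrow> real mat \<Rightarrow> nat list \<Rightarrow> bool" where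
  "infinite_zero_orders C A B ds \<longleftrightarrow>
     length ds \<le> dim_row C \<and> length ds \<le> dim_col B \<and>
     (\<exists>P Q. biproper (dim_row C) P \<and> biproper (dim_col B) Q \<and>
        P * transfer_function C A B * Q =
          mat (dim_row C) (dim_col B)
            (\<lambda>(i, j). if i = j \<and> i < length ds then Fract 1 (monom 1 (ds ! i)) else 0))"

definition uniform_rank :: "nat \<Rightarrow> real mat \<Rightarrow> real mat \<Rightarrow> real mat \<Rightarrow> bool" where
  "uniform_rank n C A B \<longleftrightarrow> infinite_zero_orders C A B (replicate (dim_row C) n)"

definition rosenbrock :: "real mat \<Rightarrow> real mat \<Rightarrow> real mat \<Rightarrow> real poly mat" where
  "rosenbrock C A B =
     four_block_mat (char_poly_matrix A) (const_mat (- B))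
                    (const_mat C) (0\<^sub>m (dim_row C) (dim_col B))"

text \<open>\<open>l\<close> is an invariant zero if the system matrix drops below its normal rank at \<open>z = l\<close>.\<close>

definition invariant_zero :: "real mat \<Rightarrow> real mat \<Rightarrow> real mat \<Rightarrow> complex \<Rightarrow> bool" where
  "invariant_zero C A B l \<longleftrightarrow>
     vec_space.rank (dim_row A + dim_row C)
       (map_mat (\<lambda>q. poly (map_poly complex_of_real q) l) (rosenbrock C A B))
     < vec_space.rank (dim_row A + dim_row C) (fract_mat (rosenbrock C A B))"

section \<open>Agents and exosystem\<close>

record agent =
  Aa :: "real mat"
  Ba :: "real mat"
  Ca :: "real mat"
  Cm :: "real mat"  \<comment> \<open>local measurement \<open>z = Cm x\<close>\<close>

definition agent_dims :: "nat \<Rightarrow> agent \<Rightarrow> bool" where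
  "agent_dims p ag \<longleftrightarrow> square_mat (Aa ag) \<and> dim_row (Ba ag) = dim_row (Aa ag) \<and>
     Ca ag \<in> carrier_mat p (dim_row (Aa ag)) \<and> dim_col (Cm ag) = dim_row (Aa ag)"

definition admissible_agent :: "nat \<Rightarrow> agent \<Rightarrow> bool" where
  "admissible_agent p ag \<longleftrightarrow> agent_dims p ag \<and>
     stabilizable (Aa ag) (Ba ag) \<and> detectable (Ca ag) (Aa ag) \<and>
     right_invertible (Ca ag) (Aa ag) (Ba ag) \<and>
     detectable (Cm ag) (Aa ag)"

definition admissible_exosystem :: "nat \<Rightarrow> real mat \<Rightarrow> real mat \<Rightarrow> bool" where
  "admissible_exosystem p Ar Cr \<longleftrightarrow> square_mat Ar \<and> Cr \<in> carrier_mat p (dim_row Ar) \<and>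
     observable Cr Ar \<and>
     (\<forall>l. eigenvalue (map_mat complex_of_real Ar) l \<longrightarrow> cmod l = 1)"

text \<open>Signals that are accessed with a delay are functions on \<^typ>\<open>int\<close>; their values at negative
  times are arbitrary initial data.\<close>

definition exo_run :: "nat \<Rightarrow> real mat \<Rightarrow> real mat \<Rightarrow> (int \<Rightarrow> real vec) \<Rightarrow> bool" where
  "exo_run p Ar Cr yr \<longleftrightarrow> (\<forall>k. yr k \<in> carrier_vec p) \<and>
     (\<exists>xr :: nat \<Rightarrow> real vec. xr 0 \<in> carrier_vec (dim_row Ar) \<and>
        (\<forall>k. xr (Suc k) = Ar *\<^sub>v xr k) \<and> (\<forall>k. yr (int k) = Cr *\<^sub>v xr k))"

definition agent_run ::
  "agent \<Rightarrow> (nat \<Rightarrow> real vec) \<Rightarrow> (nat \<Rightarrow> real vec) \<Rightarrow> (nat \<Rightarrow> real vec) \<Rightarrow> (int \<Rightarrow> real vec) \<Rightarrow> bool"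
where
  "agent_run ag x u z y \<longleftrightarrow> x 0 \<in> carrier_vec (dim_row (Aa ag)) \<and>
     (\<forall>k. x (Suc k) = Aa ag *\<^sub>v x k + Ba ag *\<^sub>v u k) \<and>
     (\<forall>k. z k = Cm ag *\<^sub>v x k) \<and>
     (\<forall>k. y (int k) = Ca ag *\<^sub>v x k) \<and> (\<forall>k. y k \<in> carrier_vec (dim_row (Ca ag)))"

section \<open>Communication network\<close>

text \<open>\<open>a i j\<close> is the weight of the edge from \<open>j\<close> to \<open>i\<close>; nodes are \<open>1, \<dots>, N\<close>.\<close>

definition laplacian :: "nat \<Rightarrow> (nat \<Rightarrow> nat \<Rightarrow> real) \<Rightarrow> nat \<Rightarrow> nat \<Rightarrow> real" where
  "laplacian N a i j = (if i = j then (\<Sum>k = 1..N. a i k) else - a i j)"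

definition edges :: "nat \<Rightarrow> (nat \<Rightarrow> nat \<Rightarrow> real) \<Rightarrow> (nat \<times> nat) set" where
  "edges N a = {(j, i). j \<in> {1..N} \<and> i \<in> {1..N} \<and> a i j > 0}"

definition weighted_graph :: "nat \<Rightarrow> (nat \<Rightarrow> nat \<Rightarrow> real) \<Rightarrow> bool" where
  "weighted_graph N a \<longleftrightarrow> (\<forall>i \<in> {1..N}. a i i = 0 \<and> (\<forall>j \<in> {1..N}. a i j \<ge> 0))"

definition directed_spanning_tree :: "nat \<Rightarrow> (nat \<Rightarrow> nat \<Rightarrow> real) \<Rightarrow> bool" where
  "directed_spanning_tree N a \<longleftrightarrow>
     (\<exists>r \<in> {1..N}. (\<forall>j. (j, r) \<notin> edges N a) \<and>
        (\<forall>i \<in> {1..N} - {r}. (\<exists>!j. (j, i) \<in> edges N a) \<and> (r, i) \<in> (edges N a)\<^sup>+))"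

definition tree_graphs :: "nat \<Rightarrow> (nat \<Rightarrow> nat \<Rightarrow> real) set" where
  "tree_graphs N = {a. weighted_graph N a \<and> directed_spanning_tree N a \<and>
     (\<forall>i \<in> {1..N}. \<forall>j \<in> {1..N}. i < j \<longrightarrow> laplacian N a i j = 0)}"

definition expanded_laplacian :: "nat \<Rightarrow> (nat \<Rightarrow> nat \<Rightarrow> real) \<Rightarrow> nat \<Rightarrow> nat \<Rightarrow> real" where
  "expanded_laplacian N a i j = laplacian N a i j + (if i = j \<and> i = 1 then 1 else 0)"

definition d_in :: "nat \<Rightarrow> (nat \<Rightarrow> nat \<Rightarrow> real) \<Rightarrow> nat \<Rightarrow> real" where
  "d_in N a i = (\<Sum>j = 1..N. a i j)"

definition d_bar :: "nat \<Rightarrow> (nat \<Rightarrow> nat \<Rightarrow> real) \<Rightarrow> nat \<Rightarrow> nat \<Rightarrow> real" where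
  "d_bar N a i j = (if i = j then 1 else 0) - expanded_laplacian N a i j / (2 + d_in N a i)"

definition comm_delays :: "nat \<Rightarrow> (nat \<Rightarrow> nat \<Rightarrow> nat) \<Rightarrow> bool" where
  "comm_delays N \<kappa> \<longleftrightarrow>
     (\<forall>i \<in> {1..N}. \<kappa> i i = 0 \<and> (\<forall>j \<in> {1..N}. j \<noteq> i \<longrightarrow> \<kappa> i j \<ge> 1))"

inductive path_delay ::
  "nat \<Rightarrow> (nat \<Rightarrow> nat \<Rightarrow> real) \<Rightarrow> (nat \<Rightarrow> nat \<Rightarrow> nat) \<Rightarrow> nat \<Rightarrow> nat \<Rightarrow> nat \<Rightarrow> bool"
  for N a \<kappa> \<kappa>1 where
  root: "path_delay N a \<kappa> \<kappa>1 1 \<kappa>1"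
| edge: "path_delay N a \<kappa> \<kappa>1 j d \<Longrightarrow> (j, i) \<in> edges N a \<Longrightarrow> path_delay N a \<kappa> \<kappa>1 i (d + \<kappa> i j)"

text \<open>The total delay from the exosystem to agent \<open>i\<close>, along the unique path through agent \<open>1\<close>.\<close>

definition exo_delay ::
  "nat \<Rightarrow> (nat \<Rightarrow> nat \<Rightarrow> real) \<Rightarrow> (nat \<Rightarrow> nat \<Rightarrow> nat) \<Rightarrow> nat \<Rightarrow> nat \<Rightarrow> nat" where
  "exo_delay N a \<kappa> \<kappa>1 i = (THE d. path_delay N a \<kappa> \<kappa>1 i d)"

definition zeta_bar ::
  "nat \<Rightarrow> nat \<Rightarrow> (nat \<Rightarrow> nat \<Rightarrow> real) \<Rightarrow> (nat \<Rightarrow> nat \<Rightarrow> nat) \<Rightarrow> nat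
   \<Rightarrow> (nat \<Rightarrow> int \<Rightarrow> real vec) \<Rightarrow> (int \<Rightarrow> real vec) \<Rightarrow> nat \<Rightarrow> nat \<Rightarrow> real vec" where
  "zeta_bar p N a \<kappa> \<kappa>1 y yr i k =
     vec p (\<lambda>t. 1 / (2 + d_in N a i) *
       (\<Sum>j = 1..N. expanded_laplacian N a i j *
          (y j (int k - int (\<kappa> i j)) $ t - yr (int k - int (exo_delay N a \<kappa> \<kappa>1 i)) $ t)))"

definition zeta_hat ::
  "nat \<Rightarrow> nat \<Rightarrow> (nat \<Rightarrow> nat \<Rightarrow> real) \<Rightarrow> (nat \<Rightarrow> nat \<Rightarrow> nat)
   \<Rightarrow> (nat \<Rightarrow> int \<Rightarrow> real vec) \<Rightarrow> nat \<Rightarrow> nat \<Rightarrow> real vec" where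
  "zeta_hat r N a \<kappa>h \<xi> i k =
     vec r (\<lambda>t. 1 / (2 + d_in N a i) *
       (\<Sum>j = 1..N. expanded_laplacian N a i j * \<xi> j (int k - int (\<kappa>h i j)) $ t))"

lemma expanded_laplacian_d_bar:
  assumes "i \<in> {1..N}" and "2 + d_in N a i \<noteq> 0"
  shows "1 / (2 + d_in N a i) * (\<Sum>j = 1..N. expanded_laplacian N a i j * f j)
       = f i - (\<Sum>j = 1..N. d_bar N a i j * f j)"
proof -
  have "(\<Sum>j = 1..N. d_bar N a i j * f j)
      = (\<Sum>j = 1..N. (if i = j then f j else 0)
           - 1 / (2 + d_in N a i) * (expanded_laplacian N a i j * f j))"
    by (rule sum.cong) (auto simp: d_bar_def algebra_simps)
  also have "\<dots> = f i - 1 / (2 + d_in N a i) * (\<Sum>j = 1..N. expanded_laplacian N a i j * f j)"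
    using assms by (simp add: sum_subtractf sum_distrib_left)
  finally show ?thesis by simp
qed

lemma d_in_nonneg: "weighted_graph N a \<Longrightarrow> i \<in> {1..N} \<Longrightarrow> 0 \<le> d_in N a i"
  unfolding d_in_def weighted_graph_def by (intro sum_nonneg) auto

lemma zeta_bar_d_bar:
  assumes "weighted_graph N a" "comm_delays N \<kappa>" "i \<in> {1..N}"
    and kir: "kir = exo_delay N a \<kappa> \<kappa>1 i"
  shows "zeta_bar p N a \<kappa> \<kappa>1 y yr i k =
    vec p (\<lambda>t. y i (int k) $ t - yr (int k - int kir) $ t
      - (\<Sum>j = 1..N. d_bar N a i j * (y j (int k - int (\<kappa> i j)) $ t - yr (int k - int kir) $ t)))"
proof -
  have "2 + d_in N a i \<noteq> 0" "\<kappa> i i = 0"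
    using d_in_nonneg[OF assms(1,3)] assms(2,3) by (auto simp: comm_delays_def)
  then show ?thesis
    unfolding zeta_bar_def kir by (subst expanded_laplacian_d_bar[OF assms(3)]) auto
qed

lemma zeta_hat_d_bar:
  assumes "weighted_graph N a" "comm_delays N \<kappa>h" "i \<in> {1..N}"
  shows "zeta_hat r N a \<kappa>h \<xi> i k =
    vec r (\<lambda>t. \<xi> i (int k) $ t
      - (\<Sum>j = 1..N. d_bar N a i j * \<xi> j (int k - int (\<kappa>h i j)) $ t))"
proof -
  have "2 + d_in N a i \<noteq> 0" "\<kappa>h i i = 0"
    using d_in_nonneg[OF assms(1,3)] assms(2,3) by (auto simp: comm_delays_def)
  then show ?thesis
    unfolding zeta_hat_def by (subst expanded_laplacian_d_bar[OF assms(3)]) auto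
qed

definition delayed_output_sync ::
  "nat \<Rightarrow> nat \<Rightarrow> (nat \<Rightarrow> nat \<Rightarrow> real) \<Rightarrow> (nat \<Rightarrow> nat \<Rightarrow> nat) \<Rightarrow> nat
   \<Rightarrow> (nat \<Rightarrow> int \<Rightarrow> real vec) \<Rightarrow> (int \<Rightarrow> real vec) \<Rightarrow> bool" where
  "delayed_output_sync p N a \<kappa> \<kappa>1 y yr \<longleftrightarrow>
     (\<forall>i \<in> {1..N}. \<forall>t < p.
        (\<lambda>k. y i (int k) $ t - yr (int k - int (exo_delay N a \<kappa> \<kappa>1 i)) $ t) \<longlonglongrightarrow> 0)"

section \<open>The synchronization problem\<close>

record protocol =
  Ac :: "real mat"
  Bc :: "real mat"
  Cc :: "real mat"
  Dc :: "real mat"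
  Ec :: "real mat"
  Fc :: "real mat"
  Gc :: "real mat"
  Hc :: "real mat"
  Xc :: "real mat"  \<comment> \<open>output map of the exchanged variable, \<open>\<xi> = Xc x\<^sub>c\<close>\<close>

definition protocol_dims :: "nat \<Rightarrow> nat \<Rightarrow> agent \<Rightarrow> protocol \<Rightarrow> bool" where
  "protocol_dims p r ag P \<longleftrightarrow>
     (let s = dim_row (Ac P); m = dim_col (Ba ag); q = dim_row (Cm ag) in
       Ac P \<in> carrier_mat s s \<and> Bc P \<in> carrier_mat s p \<and>
       Cc P \<in> carrier_mat s r \<and> Dc P \<in> carrier_mat s q \<and>
       Ec P \<in> carrier_mat m s \<and> Fc P \<in> carrier_mat m p \<and>
       Gc P \<in> carrier_mat m r \<and> Hc P \<in> carrier_mat m q \<and> Xc P \<in> carrier_mat r s)"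

definition protocol_run ::
  "protocol \<Rightarrow> (nat \<Rightarrow> real vec) \<Rightarrow> (nat \<Rightarrow> real vec) \<Rightarrow> (nat \<Rightarrow> real vec) \<Rightarrow> (nat \<Rightarrow> real vec)
   \<Rightarrow> (nat \<Rightarrow> real vec) \<Rightarrow> (int \<Rightarrow> real vec) \<Rightarrow> bool" where
  "protocol_run P xc zb zh z u \<xi> \<longleftrightarrow> xc 0 \<in> carrier_vec (dim_row (Ac P)) \<and>
     (\<forall>k. xc (Suc k) = Ac P *\<^sub>v xc k + Bc P *\<^sub>v zb k + Cc P *\<^sub>v zh k + Dc P *\<^sub>v z k) \<and>
     (\<forall>k. u k = Ec P *\<^sub>v xc k + Fc P *\<^sub>v zb k + Gc P *\<^sub>v zh k + Hc P *\<^sub>v z k) \<and>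
     (\<forall>k. \<xi> (int k) = Xc P *\<^sub>v xc k) \<and> (\<forall>k. \<xi> k \<in> carrier_vec (dim_row (Xc P)))"

text \<open>\<open>M\<close> is the set of available agents, with models \<open>ag\<close>. One protocol per agent is chosen
  before the network: the size \<open>N\<close>, the graph, the delays and the placement \<open>\<sigma>\<close> of agents at the
  nodes are all arbitrary. (The numbering of the nodes is tied to the graph by the lower triangular
  form of the Laplacian, hence the placement has to be free.)\<close>

definition scalable_sync_solvable ::
  "nat \<Rightarrow> real mat \<Rightarrow> real mat \<Rightarrow> 'm set \<Rightarrow> ('m \<Rightarrow> agent) \<Rightarrow> bool" where
  "scalable_sync_solvable p Ar Cr M ag \<longleftrightarrow>
     (\<exists>r. \<exists>P :: 'm \<Rightarrow> protocol. (\<forall>i \<in> M. protocol_dims p r (ag i) (P i)) \<and>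
       (\<forall>N a \<sigma> \<kappa> \<kappa>h \<kappa>1 x xc u z y \<xi> yr.
          a \<in> tree_graphs N \<longrightarrow> \<sigma> \<in> {1..N} \<rightarrow> M \<longrightarrow>
          comm_delays N \<kappa> \<longrightarrow> comm_delays N \<kappa>h \<longrightarrow>
          exo_run p Ar Cr yr \<longrightarrow>
          (\<forall>i \<in> {1..N}. agent_run (ag (\<sigma> i)) (x i) (u i) (z i) (y i) \<and>
             protocol_run (P (\<sigma> i)) (xc i) (zeta_bar p N a \<kappa> \<kappa>1 y yr i)
               (zeta_hat r N a \<kappa>h \<xi> i) (z i) (u i) (\<xi> i)) \<longrightarrow>
          delayed_output_sync p N a \<kappa> \<kappa>1 y yr))"

section \<open>Target model, pre-compensators and the proposed protocol\<close>

definition target_model ::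
  "nat \<Rightarrow> real mat \<Rightarrow> real mat \<Rightarrow> 'm set \<Rightarrow> ('m \<Rightarrow> agent)
   \<Rightarrow> nat \<Rightarrow> real mat \<Rightarrow> real mat \<Rightarrow> real mat \<Rightarrow> bool" where
  "target_model p Ar Cr M ag nq Ct At Bt \<longleftrightarrow>
     (\<forall>i \<in> M. \<forall>ds. infinite_zero_orders (Ca (ag i)) (Aa (ag i)) (Ba (ag i)) ds \<longrightarrow>
        (\<forall>d \<in> set ds. d \<le> nq)) \<and>
     (\<forall>j < p. observability_index Cr Ar j \<le> nq) \<and>
     square_mat At \<and> Bt \<in> carrier_mat (dim_row At) p \<and> Ct \<in> carrier_mat p (dim_row At) \<and>
     (\<forall>xr0 \<in> carrier_vec (dim_row Ar). \<exists>xt0 \<in> carrier_vec (dim_row At).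
        \<forall>k. Ct *\<^sub>v ((At ^\<^sub>m k) *\<^sub>v xt0) = Cr *\<^sub>v ((Ar ^\<^sub>m k) *\<^sub>v xr0)) \<and>
     invertible_sys Ct At Bt \<and> uniform_rank nq Ct At Bt \<and>
     (\<nexists>l. invariant_zero Ct At Bt l) \<and>
     {l. eigenvalue (map_mat complex_of_real Ar) l} \<subseteq> {l. eigenvalue (map_mat complex_of_real At) l} \<and>
     {l. eigenvalue (map_mat complex_of_real At) l} \<subseteq> {l. eigenvalue (map_mat complex_of_real Ar) l} \<union> {0}"

record precomp =
  Ah :: "real mat"
  Bh :: "real mat"
  Ch :: "real mat"
  Dh :: "real mat"
  Eh :: "real mat"

definition precomp_dims :: "nat \<Rightarrow> agent \<Rightarrow> precomp \<Rightarrow> bool" where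
  "precomp_dims p ag h \<longleftrightarrow>
     (let s = dim_row (Ah h); m = dim_col (Ba ag); q = dim_row (Cm ag) in
       Ah h \<in> carrier_mat s s \<and> Bh h \<in> carrier_mat s q \<and> Eh h \<in> carrier_mat s p \<and>
       Ch h \<in> carrier_mat m s \<and> Dh h \<in> carrier_mat m p)"

definition precomp_run ::
  "precomp \<Rightarrow> (nat \<Rightarrow> real vec) \<Rightarrow> (nat \<Rightarrow> real vec) \<Rightarrow> (nat \<Rightarrow> real vec) \<Rightarrow> (nat \<Rightarrow> real vec) \<Rightarrow> bool"
where
  "precomp_run h pc z v u \<longleftrightarrow> pc 0 \<in> carrier_vec (dim_row (Ah h)) \<and>
     (\<forall>k. pc (Suc k) = Ah h *\<^sub>v pc k + Bh h *\<^sub>v z k + Eh h *\<^sub>v v k) \<and>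
     (\<forall>k. u k = Ch h *\<^sub>v pc k + Dh h *\<^sub>v v k)"

definition precompensator ::
  "nat \<Rightarrow> real mat \<Rightarrow> real mat \<Rightarrow> real mat \<Rightarrow> agent \<Rightarrow> precomp \<Rightarrow> bool" where
  "precompensator p Ct At Bt ag h \<longleftrightarrow> precomp_dims p ag h \<and>
     (\<exists>As Cs. schur_stable As \<and> Cs \<in> carrier_mat p (dim_row As) \<and>
       (\<forall>x0 \<in> carrier_vec (dim_row (Aa ag)). \<forall>pc0 \<in> carrier_vec (dim_row (Ah h)).
        \<exists>xh0 \<in> carrier_vec (dim_row At). \<exists>\<omega>0 \<in> carrier_vec (dim_row As).
          \<forall>v x pc u z y. (\<forall>k. v k \<in> carrier_vec p) \<longrightarrow> x 0 = x0 \<longrightarrow> pc 0 = pc0 \<longrightarrow>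
            agent_run ag x u z y \<longrightarrow> precomp_run h pc z v u \<longrightarrow>
            (\<exists>xh \<omega> :: nat \<Rightarrow> real vec. xh 0 = xh0 \<and> \<omega> 0 = \<omega>0 \<and>
               (\<forall>k. \<omega> (Suc k) = As *\<^sub>v \<omega> k) \<and>
               (\<forall>k. xh (Suc k) = At *\<^sub>v xh k + Bt *\<^sub>v (v k + Cs *\<^sub>v \<omega> k)) \<and>
               (\<forall>k. y (int k) = Ct *\<^sub>v xh k))))"

definition design_run ::
  "real mat \<Rightarrow> real mat \<Rightarrow> real mat \<Rightarrow> real mat \<Rightarrow> real mat \<Rightarrow> precomp
   \<Rightarrow> (nat \<Rightarrow> real vec) \<Rightarrow> (nat \<Rightarrow> real vec) \<Rightarrow> (int \<Rightarrow> real vec)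
   \<Rightarrow> (nat \<Rightarrow> real vec) \<Rightarrow> (nat \<Rightarrow> real vec) \<Rightarrow> (nat \<Rightarrow> real vec) \<Rightarrow> (nat \<Rightarrow> real vec) \<Rightarrow> bool" where
  "design_run Ct At Bt K H h pc xe \<chi> zb zh z u \<longleftrightarrow>
     pc 0 \<in> carrier_vec (dim_row (Ah h)) \<and> xe 0 \<in> carrier_vec (dim_row At) \<and>
     (\<forall>k. \<chi> k \<in> carrier_vec (dim_row At)) \<and>
     (\<forall>k. pc (Suc k) = Ah h *\<^sub>v pc k + Bh h *\<^sub>v z k - Eh h *\<^sub>v (K *\<^sub>v \<chi> (int k))) \<and>
     (\<forall>k. xe (Suc k) = At *\<^sub>v xe k - Bt *\<^sub>v (K *\<^sub>v zh k) + H *\<^sub>v (zb k - Ct *\<^sub>v xe k)) \<and>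
     (\<forall>k. \<chi> (int (Suc k)) = (At - Bt * K) *\<^sub>v \<chi> (int k) + At *\<^sub>v xe k - At *\<^sub>v zh k) \<and>
     (\<forall>k. u k = Ch h *\<^sub>v pc k - Dh h *\<^sub>v (K *\<^sub>v \<chi> (int k)))"

end

theory Submission
  imports Defs "Jordan_Normal_Form.Schur_Decomposition" "HOL-Computational_Algebra.Polynomial_FPS"
begin

text \<open>Pre-compensated agents behave like the target model driven by \<open>v + \<rho>\<close> with \<open>\<rho> \<rightarrow> 0\<close>. In a
  tree the network data of a node are \<open>g e\<close> and \<open>g \<chi>\<close>, with \<open>e\<close> its own tracking error and an unknown
  \<open>0 < g < 1\<close>, up to a term coming from its parent. By induction along the tree this term tends to zero, and
  a single agent is a cascade of three stable recurrences.

  For the existence of a protocol no general theory of target models is needed. Let \<open>\<phi>\<close> be the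
  characteristic polynomial of an agent. Right-invertibility gives a polynomial matrix \<open>N\<close> and a scalar
  polynomial \<open>g\<close> with \<open>C adj(z I - A) B N = \<phi> g I\<close>, so a compensator can realize \<open>\<psi> y = v\<close> up to
  decaying terms for every monic \<open>\<psi>\<close> of sufficiently large degree. Taking
  \<open>\<psi> = z\<^sup>d det(z I - A\<^sub>r)\<close> for all agents, the target model is a block companion matrix, for which
  deadbeat gains are explicit.\<close>

section \<open>Vector sequences tending to zero\<close>

text \<open>The gain \<open>g\<close> depends on the graph and is unknown to the protocol, so no
  matrix can be tuned to it. It is \<open>1/2\<close> at node 1 and \<open>w / (2 + w)\<close>
  elsewhere, with \<open>w\<close> the weight of the single incoming edge; the 2 in the denominator
  keeps it below 1. The eigenvalues of the target matrix lie on the unit circle or at 0, and a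
  matrix with spectrum in the closed unit disc becomes Schur stable when multiplied by any
  \<open>1 - g\<close> with \<open>0 < g < 1\<close>. Delays do not enter the loop of an agent: it
  has no delay to itself, and since total delays add along the path, the parent contributes its own
  tracking error, only delayed. Exosystem values at negative times are arbitrary, so the error
  recurrences start at some time \<open>D\<close>.

  Both halves of the theorem share one convergence result, \<open>design_sync\<close>. For the
  constructed protocol the degree of \<psi> must exceed the bounds of all agents at once; the factor
  \<open>z^d\<close> raises it at the price of zero eigenvalues only.\<close>

lemma scalar_recurrence_null:
  fixes s w :: "nat \<Rightarrow> 'a :: real_normed_field"
  assumes l: "norm l < 1" and w: "w \<longlonglongrightarrow> 0"
    and rec: "\<And>k. k \<ge> D \<Longrightarrow> s (Suc k) = l * s k + w k"
  shows "s \<longlonglongrightarrow> 0"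
proof (rule LIMSEQ_I)
  fix e :: real assume e: "e > 0"
  define r where "r = norm l"
  have r: "0 \<le> r" "r < 1" using l by (auto simp: r_def)
  \<comment> \<open>With this margin \<open>e / 2\<close> is the fixed point of the map
    \<open>t \<mapsto> r * t + e * (1 - r) / 2\<close>, so the bound below reproduces
    itself.\<close>
  have "e * (1 - r) / 2 > 0" using e r by simp
  from LIMSEQ_D[OF w this] obtain k0 where k0: "\<And>k. k \<ge> k0 \<Longrightarrow> norm (w k) < e * (1 - r) / 2" by auto
  define k1 where "k1 = max k0 D"
  have bd: "norm (s (k1 + m)) \<le> r ^ m * norm (s k1) + e / 2" for m
  proof (induction m)
    case 0
    then show ?case using e by simp
  next
    case (Suc m)
    have "norm (s (k1 + Suc m)) \<le> r * norm (s (k1 + m)) + norm (w (k1 + m))"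
      using rec[of "k1 + m"] norm_triangle_ineq[of "l * s (k1 + m)" "w (k1 + m)"]
      by (simp add: k1_def norm_mult r_def)
    also have "\<dots> \<le> r * (r ^ m * norm (s k1) + e / 2) + e * (1 - r) / 2"
    proof (rule add_mono)
      have "k0 \<le> k1 + m" by (simp add: k1_def)
      then show "norm (w (k1 + m)) \<le> e * (1 - r) / 2" using k0 by fastforce
    qed (rule mult_left_mono[OF Suc.IH r(1)])
    also have "\<dots> = r ^ Suc m * norm (s k1) + e / 2" by (simp add: field_simps)
    finally show ?case .
  qed
  have "(\<lambda>m. r ^ m * norm (s k1)) \<longlonglongrightarrow> 0"
    using tendsto_mult_left_zero[OF LIMSEQ_power_zero[of r]] r by simp
  then have "\<exists>m0. \<forall>m\<ge>m0. norm (r ^ m * norm (s k1) - 0) < e / 2"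
    using e by (intro LIMSEQ_D) auto
  then obtain m0 where m0: "\<And>m. m \<ge> m0 \<Longrightarrow> r ^ m * norm (s k1) < e / 2" by force
  have "norm (s k) < e" if "k \<ge> k1 + m0" for k
  proof -
    have "m0 \<le> k - k1" "k1 + (k - k1) = k" using that by auto
    then show ?thesis using bd[of "k - k1"] m0[of "k - k1"] by auto
  qed
  then show "\<exists>no. \<forall>n\<ge>no. norm (s n - 0) < e" by auto
qed

text \<open>Membership in the carrier is included because entries of sums and products can be read
  off only when the dimensions match.\<close>

definition vec_null :: "nat \<Rightarrow> (nat \<Rightarrow> 'a :: real_normed_field vec) \<Rightarrow> bool" where
  "vec_null n x \<longleftrightarrow> (\<forall>k. x k \<in> carrier_vec n) \<and> (\<forall>i < n. (\<lambda>k. x k $ i) \<longlonglongrightarrow> 0)"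

lemma vec_nullD:
  assumes "vec_null n x"
  shows "x k \<in> carrier_vec n" "i < n \<Longrightarrow> (\<lambda>k. x k $ i) \<longlonglongrightarrow> 0"
  using assms by (auto simp: vec_null_def)

lemma vec_null_zero: "vec_null n (\<lambda>k. 0\<^sub>v n)"
  by (simp add: vec_null_def)

lemma vec_null_add:
  assumes "vec_null n x" "vec_null n y"
  shows "vec_null n (\<lambda>k. x k + y k)"
  unfolding vec_null_def
proof (intro conjI allI impI)
  fix i assume "i < n"
  then have "(\<lambda>k. x k $ i + y k $ i) \<longlonglongrightarrow> 0"
    using assms by (intro tendsto_add_zero) (auto simp: vec_null_def)
  moreover have "(x k + y k) $ i = x k $ i + y k $ i" for k
    using vec_nullD(1)[OF assms(2), of k] \<open>i < n\<close> by simp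
  ultimately show "(\<lambda>k. (x k + y k) $ i) \<longlonglongrightarrow> 0" by simp
qed (use assms in \<open>auto simp: vec_null_def\<close>)

lemma vec_null_smult:
  assumes "vec_null n x"
  shows "vec_null n (\<lambda>k. c \<cdot>\<^sub>v x k)"
  unfolding vec_null_def
proof (intro conjI allI impI)
  fix i assume "i < n"
  then have "(\<lambda>k. c * x k $ i) \<longlonglongrightarrow> 0"
    using assms by (intro tendsto_mult_right_zero) (auto simp: vec_null_def)
  moreover have "(c \<cdot>\<^sub>v x k) $ i = c * x k $ i" for k
    using vec_nullD(1)[OF assms, of k] \<open>i < n\<close> by simp
  ultimately show "(\<lambda>k. (c \<cdot>\<^sub>v x k) $ i) \<longlonglongrightarrow> 0" by simp
qed (use assms in \<open>auto simp: vec_null_def\<close>)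

lemma vec_null_minus:
  assumes "vec_null n x" "vec_null n y"
  shows "vec_null n (\<lambda>k. x k - y k)"
proof -
  have "x k - y k = x k + (- 1) \<cdot>\<^sub>v y k" for k
    using assms[THEN vec_nullD(1), of k] by (intro eq_vecI) auto
  then show ?thesis using vec_null_add[OF assms(1) vec_null_smult[OF assms(2), of "-1"]] by simp
qed

lemma zero_mat_mult_vec: "w \<in> carrier_vec n \<Longrightarrow> 0\<^sub>m m n *\<^sub>v w = 0\<^sub>v m"
  by (intro eq_vecI) (auto simp: scalar_prod_def)

lemma index_mult_mat_vec_sum:
  assumes "A \<in> carrier_mat m n" "x \<in> carrier_vec n" "i < m"
  shows "(A *\<^sub>v x) $ i = (\<Sum>j<n. A $$ (i, j) * x $ j)"
  using assms by (auto simp: scalar_prod_def lessThan_atLeast0 intro!: sum.cong)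

lemma index_mult_mat_sum:
  assumes "A \<in> carrier_mat m n" "B \<in> carrier_mat n l" "i < m" "j < l"
  shows "(A * B) $$ (i, j) = (\<Sum>r<n. A $$ (i, r) * B $$ (r, j))"
  using assms by (auto simp: scalar_prod_def lessThan_atLeast0 intro!: sum.cong)

lemma vec_null_mult_mat:
  assumes A: "A \<in> carrier_mat m n" and x: "vec_null n x"
  shows "vec_null m (\<lambda>k. A *\<^sub>v x k)"
  unfolding vec_null_def
proof (intro conjI allI impI)
  fix i assume i: "i < m"
  have "(\<lambda>k. \<Sum>j<n. A $$ (i, j) * x k $ j) \<longlonglongrightarrow> 0"
    using x by (intro tendsto_null_sum tendsto_mult_right_zero) (auto simp: vec_null_def)
  then show "(\<lambda>k. (A *\<^sub>v x k) $ i) \<longlonglongrightarrow> 0"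
    using index_mult_mat_vec_sum[OF A vec_nullD(1)[OF x] i] by simp
qed (use A vec_nullD(1)[OF x] in auto)

text \<open>Back substitution: row \<open>i\<close> involves only coordinates
  \<open>j \<ge> i\<close>, so once the later ones are known to vanish it is a scalar recurrence
  with vanishing input.\<close>

lemma triangular_recurrence_null:
  assumes B: "B \<in> carrier_mat n n" "upper_triangular B"
    and diag: "\<And>i. i < n \<Longrightarrow> norm (B $$ (i, i)) < 1"
    and z: "\<And>k. z k \<in> carrier_vec n" and w: "vec_null n w"
    and rec: "\<And>k. k \<ge> D \<Longrightarrow> z (Suc k) = B *\<^sub>v z k + w k"
  shows "vec_null n z"
proof -
  have "i < n \<Longrightarrow> (\<lambda>k. z k $ i) \<longlonglongrightarrow> 0" for i
  proof (induction "n - i" arbitrary: i rule: less_induct)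
    case less
    define w' where "w' k = (\<Sum>j\<in>{i<..<n}. B $$ (i, j) * z k $ j) + w k $ i" for k
    have "w' \<longlonglongrightarrow> 0" unfolding w'_def
      using less vec_nullD(2)[OF w less.prems]
      by (intro tendsto_add_zero tendsto_null_sum tendsto_mult_right_zero) auto
    moreover have "z (Suc k) $ i = B $$ (i, i) * z k $ i + w' k" if "k \<ge> D" for k
    proof -
      have "z (Suc k) $ i = (\<Sum>j<n. B $$ (i, j) * z k $ j) + w k $ i"
        using rec[OF that] index_mult_mat_vec_sum[OF B(1) z less.prems, of k] B(1)
          vec_nullD(1)[OF w, of k] less.prems by simp
      also have "(\<Sum>j<n. B $$ (i, j) * z k $ j) = (\<Sum>j\<in>insert i {i<..<n}. B $$ (i, j) * z k $ j)"
        using less.prems B by (intro sum.mono_neutral_right) (auto simp: not_less intro: upper_triangularD)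
      finally show ?thesis by (simp add: w'_def)
    qed
    ultimately show ?case
      using scalar_recurrence_null[of "B $$ (i, i)" w' D "\<lambda>k. z k $ i"] diag[OF less.prems] by blast
  qed
  then show ?thesis using z by (auto simp: vec_null_def)
qed

text \<open>In the Schur form \<open>A = P * B * Q\<close> the sequence \<open>Q x\<close> obeys a
  triangular recurrence whose diagonal entries are the eigenvalues of \<open>A\<close>. This
  replaces estimates of the powers of \<open>A\<close>.\<close>

lemma complex_recurrence_null:
  fixes A :: "complex mat"
  assumes A: "A \<in> carrier_mat n n" and ev: "\<And>l. eigenvalue A l \<Longrightarrow> cmod l < 1"
    and x: "\<And>k. x k \<in> carrier_vec n" and w: "vec_null n w"
    and rec: "\<And>k. k \<ge> D \<Longrightarrow> x (Suc k) = A *\<^sub>v x k + w k"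
  shows "vec_null n x"
proof -
  from char_poly_factorized[OF A] obtain as where as: "char_poly A = (\<Prod>a\<leftarrow>as. [:- a, 1:])" by auto
  obtain B P Q where sd: "schur_decomposition A as = (B, P, Q)" by (cases "schur_decomposition A as") auto
  from schur_decomposition[OF A as sd]
  have wit: "similar_mat_wit A B P Q" and tri: "upper_triangular B" and dg: "diag_mat B = as" by auto
  from similar_mat_witD2[OF A wit]
  have PQ: "P * Q = 1\<^sub>m n" "Q * P = 1\<^sub>m n" "A = P * B * Q"
    and c[simp]: "B \<in> carrier_mat n n" "P \<in> carrier_mat n n" "Q \<in> carrier_mat n n" by auto
  have QA: "Q * A = B * Q"
  proof -
    have "Q * A = Q * (P * (B * Q))" unfolding PQ(3) by (simp only: assoc_mult_mat[OF c(2,1,3)])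
    also have "\<dots> = (Q * P) * (B * Q)"
      using mult_carrier_mat[OF c(1,3)] by (intro assoc_mult_mat[symmetric, of _ n n _ n _ n]) auto
    also have "\<dots> = B * Q" unfolding PQ using mult_carrier_mat[OF c(1,3)] by (rule left_mult_one_mat)
    finally show ?thesis .
  qed
  have "norm (B $$ (i, i)) < 1" if "i < n" for i
  proof (rule ev)
    have "B $$ (i, i) \<in> set as" using that carrier_matD(1)[OF c(1)] unfolding dg[symmetric] diag_mat_def by auto
    then show "eigenvalue A (B $$ (i, i))"
      unfolding eigenvalue_root_char_poly[OF A] as poly_prod_list by (auto simp: prod_list_zero_iff o_def)
  qed
  moreover have "Q *\<^sub>v x (Suc k) = B *\<^sub>v (Q *\<^sub>v x k) + Q *\<^sub>v w k" if "k \<ge> D" for k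
  proof -
    have wk: "w k \<in> carrier_vec n" using vec_nullD(1)[OF w] .
    have "Q *\<^sub>v x (Suc k) = Q *\<^sub>v (A *\<^sub>v x k) + Q *\<^sub>v w k"
      unfolding rec[OF that] using A x wk by (intro mult_add_distrib_mat_vec[of _ n n]) auto
    also have "Q *\<^sub>v (A *\<^sub>v x k) = (Q * A) *\<^sub>v x k" by (rule assoc_mult_mat_vec[OF c(3) A x, symmetric])
    also have "\<dots> = B *\<^sub>v (Q *\<^sub>v x k)" unfolding QA by (rule assoc_mult_mat_vec[OF c(1,3) x])
    finally show ?thesis .
  qed
  ultimately have "vec_null n (\<lambda>k. Q *\<^sub>v x k)"
    using triangular_recurrence_null[OF c(1) tri, of "\<lambda>k. Q *\<^sub>v x k" "\<lambda>k. Q *\<^sub>v w k" D]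
      vec_null_mult_mat[OF c(3) w] x by (simp add: mult_mat_vec_carrier[OF c(3)])
  from vec_null_mult_mat[OF c(2) this]
  have "vec_null n (\<lambda>k. (P * Q) *\<^sub>v x k)" by (simp only: assoc_mult_mat_vec[OF c(2,3) x])
  then show ?thesis using x unfolding PQ by simp
qed

lemma real_recurrence_null:
  fixes A :: "real mat"
  assumes A: "A \<in> carrier_mat n n"
    and ev: "\<And>l. eigenvalue (map_mat complex_of_real A) l \<Longrightarrow> cmod l < 1"
    and x: "\<And>k. x k \<in> carrier_vec n" and w: "vec_null n w"
    and rec: "\<And>k. k \<ge> D \<Longrightarrow> x (Suc k) = A *\<^sub>v x k + w k"
  shows "vec_null n x"
proof -
  let ?c = "map_vec complex_of_real"
  have "vec_null n (\<lambda>k. ?c (x k))"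
  proof (rule complex_recurrence_null[OF _ ev, where D = D and w = "\<lambda>k. ?c (w k)"])
    show "vec_null n (\<lambda>k. ?c (w k))"
      unfolding vec_null_def
    proof (intro conjI allI impI)
      fix i assume "i < n"
      then have "?c (w k) $ i = complex_of_real (w k $ i)" for k using vec_nullD(1)[OF w, of k] by simp
      then show "(\<lambda>k. ?c (w k) $ i) \<longlonglongrightarrow> 0"
        using tendsto_of_real[OF vec_nullD(2)[OF w \<open>i < n\<close>]] by simp
    qed (use vec_nullD(1)[OF w] in simp)
    fix k assume "k \<ge> D"
    then have "?c (x (Suc k)) = ?c (A *\<^sub>v x k + w k)" using rec by simp
    also have "\<dots> = map_mat complex_of_real A *\<^sub>v ?c (x k) + ?c (w k)"
      using A x vec_nullD(1)[OF w, of k] of_real_hom.mult_mat_vec_hom[OF A x, of k]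
      by (intro eq_vecI) (simp_all add: of_real_hom.mult_mat_vec_hom[OF A x, symmetric])
    finally show "?c (x (Suc k)) = map_mat complex_of_real A *\<^sub>v ?c (x k) + ?c (w k)" .
  qed (use A x in auto)
  then have "(\<lambda>k. complex_of_real (x k $ i)) \<longlonglongrightarrow> of_real 0" if "i < n" for i
    using vec_nullD(2)[of n "\<lambda>k. ?c (x k)" i] that x[THEN carrier_vecD] by simp
  then show ?thesis unfolding vec_null_def using x tendsto_of_real_iff by blast
qed

lemma schur_recurrence_null:
  assumes "A \<in> carrier_mat n n" "schur_stable A"
    and "\<And>k. x k \<in> carrier_vec n" and "vec_null n w"
    and "\<And>k. k \<ge> D \<Longrightarrow> x (Suc k) = A *\<^sub>v x k + w k"
  shows "vec_null n x"
  using assms real_recurrence_null[of A n x w D] by (auto simp: schur_stable_def)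

text \<open>Scaling by \<open>c\<close> scales the spectrum, so \<open>A\<close> may have
  eigenvalues on the unit circle, however close \<open>c\<close> is to 1. With
  \<open>c = 1 - g\<close> this absorbs the unknown network gain.\<close>

lemma contracted_recurrence_null:
  assumes A: "A \<in> carrier_mat n n"
    and ev: "\<And>l. eigenvalue (map_mat complex_of_real A) l \<Longrightarrow> cmod l \<le> 1"
    and c: "0 < c" "c < 1"
    and x: "\<And>k. x k \<in> carrier_vec n" and w: "vec_null n w"
    and rec: "\<And>k. k \<ge> D \<Longrightarrow> x (Suc k) = c \<cdot>\<^sub>v (A *\<^sub>v x k) + w k"
  shows "vec_null n x"
proof (rule real_recurrence_null[where A = "c \<cdot>\<^sub>m A" and D = D])
  fix l assume l: "eigenvalue (map_mat complex_of_real (c \<cdot>\<^sub>m A)) l"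
  let ?A = "map_mat complex_of_real A"
  have cA: "map_mat complex_of_real (c \<cdot>\<^sub>m A) = complex_of_real c \<cdot>\<^sub>m ?A" by (intro eq_matI) auto
  from l obtain v where v: "v \<in> carrier_vec n" "v \<noteq> 0\<^sub>v n" "(complex_of_real c \<cdot>\<^sub>m ?A) *\<^sub>v v = l \<cdot>\<^sub>v v"
    unfolding eigenvalue_def eigenvector_def cA using A by auto
  have "?A *\<^sub>v v = (l / of_real c) \<cdot>\<^sub>v v"
  proof (rule eq_vecI)
    fix i assume i: "i < dim_vec ((l / of_real c) \<cdot>\<^sub>v v)"
    have "((complex_of_real c \<cdot>\<^sub>m ?A) *\<^sub>v v) $ i = (l \<cdot>\<^sub>v v) $ i" using v by simp
    then show "(?A *\<^sub>v v) $ i = ((l / of_real c) \<cdot>\<^sub>v v) $ i" using i v(1) A c by (simp add: field_simps)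
  qed (use A v in auto)
  then have "eigenvalue ?A (l / of_real c)" unfolding eigenvalue_def eigenvector_def using v A by auto
  from ev[OF this] show "cmod l < 1" using c by (simp add: norm_divide field_simps)
next
  fix k assume "k \<ge> D"
  then show "x (Suc k) = (c \<cdot>\<^sub>m A) *\<^sub>v x k + w k"
    using rec A x[THEN carrier_vecD] vec_nullD(1)[OF w, THEN carrier_vecD]
    by (auto intro!: eq_vecI)
qed (use assms in auto)

section \<open>The network\<close>

lemma int_delay_null:
  fixes f :: "int \<Rightarrow> 'a :: real_normed_vector"
  assumes "(\<lambda>k. f (int k)) \<longlonglongrightarrow> 0"
  shows "(\<lambda>k. f (int k - int d)) \<longlonglongrightarrow> 0"
proof (rule LIMSEQ_offset[of _ d])
  show "(\<lambda>k. f (int (k + d) - int d)) \<longlonglongrightarrow> 0" using assms by simp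
qed

text \<open>For \<open>k < d\<close> the truncated subtraction yields \<open>xt 0\<close>; these
  finitely many terms leave the limit unchanged. From \<open>k = d\<close> on it is the true delayed
  state error.\<close>

definition synced_state :: "nat \<Rightarrow> (nat \<Rightarrow> real vec) \<Rightarrow> (nat \<Rightarrow> real vec) \<Rightarrow> nat \<Rightarrow> bool" where
  "synced_state n xt xh d \<longleftrightarrow> vec_null n (\<lambda>k. xh k - xt (k - d))"

text \<open>With \<open>e\<close> the tracking error, \<open>g e - xe\<close> is driven by \<open>At - H Ct\<close>, the difference \<open>e - \<chi>\<close> by
  \<open>(1 - g) At\<close>, and \<open>e\<close> itself by \<open>At - Bt K\<close>; this triangular structure is why the unknown
  gain \<open>g\<close> is harmless.\<close>

lemma agent_sync:
  fixes At Bt Ct K H :: "real mat"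
  assumes c: "At \<in> carrier_mat n n" "Bt \<in> carrier_mat n p" "Ct \<in> carrier_mat p n"
      "K \<in> carrier_mat p n" "H \<in> carrier_mat n p"
    and AK: "schur_stable (At - Bt * K)" and AH: "schur_stable (At - H * Ct)"
    and ev: "\<And>l. eigenvalue (map_mat complex_of_real At) l \<Longrightarrow> cmod l \<le> 1"
    and g: "0 < g" "g < 1"
    and xt: "\<And>k. xt k \<in> carrier_vec n" "\<And>k. xt (Suc k) = At *\<^sub>v xt k"
    and xh: "\<And>k. xh k \<in> carrier_vec n"
      "\<And>k. xh (Suc k) = At *\<^sub>v xh k + Bt *\<^sub>v (\<rho> k - K *\<^sub>v \<chi> k)"
    and \<rho>: "vec_null p \<rho>"
    and xe: "\<And>k. xe k \<in> carrier_vec n"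
      "\<And>k. xe (Suc k) = At *\<^sub>v xe k - Bt *\<^sub>v (K *\<^sub>v zh k) + H *\<^sub>v (zb k - Ct *\<^sub>v xe k)"
    and \<chi>: "\<And>k. \<chi> k \<in> carrier_vec n"
      "\<And>k. \<chi> (Suc k) = (At - Bt * K) *\<^sub>v \<chi> k + At *\<^sub>v xe k - At *\<^sub>v zh k"
    and zb: "vec_null p nb" "\<And>k. k \<ge> d \<Longrightarrow> zb k = g \<cdot>\<^sub>v (Ct *\<^sub>v (xh k - xt (k - d))) + nb k"
    and zh: "vec_null n nh" "\<And>k. zh k = g \<cdot>\<^sub>v \<chi> k + nh k"
  shows "synced_state n xt xh d" "vec_null n \<chi>"
proof -
  have BK: "Bt * K \<in> carrier_mat n n" "At - Bt * K \<in> carrier_mat n n"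
    and HC: "H * Ct \<in> carrier_mat n n" "At - H * Ct \<in> carrier_mat n n"
    using c by auto
  note cs = c[THEN mult_mat_vec_carrier]
  \<comment> \<open>The vector identities below follow one pattern: \<open>lin\<close> multiplies
    out all matrix products, and \<open>alg\<close> is the remaining rearrangement, proved entrywise
    for arbitrary vectors of the right dimension.\<close>
  note lin = c[THEN mult_minus_distrib_mat_vec] c[THEN mult_add_distrib_mat_vec] c[THEN mult_mat_vec]
    minus_mult_distrib_mat_vec[OF c(1) BK(1)] minus_mult_distrib_mat_vec[OF c(1) HC(1)]
    assoc_mult_mat_vec[OF c(2,4)] assoc_mult_mat_vec[OF c(5,3)]
    add_carrier_vec minus_carrier_vec smult_carrier_vec cs
  define e where "e k = xh k - xt (k - d)" for k
  have e: "e k \<in> carrier_vec n" for k using xt xh by (simp add: e_def)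
  note \<rho>c = vec_nullD(1)[OF \<rho>] and nbc = vec_nullD(1)[OF zb(1)] and nhc = vec_nullD(1)[OF zh(1)]
  note carr = e xe(1) \<chi>(1) \<rho>c nbc nhc xt(1) xh(1)
  have e_Suc: "e (Suc k) = At *\<^sub>v e k + Bt *\<^sub>v \<rho> k - Bt *\<^sub>v (K *\<^sub>v \<chi> k)" if "k \<ge> d" for k
  proof -
    have alg: "a + (r - b) - x = a - x + r - b"
      if "a \<in> carrier_vec n" "r \<in> carrier_vec n" "b \<in> carrier_vec n" "x \<in> carrier_vec n"
      for a r b x :: "real vec" using that by (intro eq_vecI) auto
    \<comment> \<open>This fails for \<open>k < d\<close>; hence the error recurrences start at time
      \<open>d\<close>.\<close>
    have "Suc k - d = Suc (k - d)" using that by simp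
    then have "e (Suc k) = At *\<^sub>v xh k + Bt *\<^sub>v (\<rho> k - K *\<^sub>v \<chi> k) - At *\<^sub>v xt (k - d)"
      unfolding e_def using xt(2) xh(2) by simp
    also have "\<dots> = At *\<^sub>v e k + Bt *\<^sub>v \<rho> k - Bt *\<^sub>v (K *\<^sub>v \<chi> k)"
      unfolding e_def by (simp only: lin carr alg)
    finally show ?thesis .
  qed
  \<comment> \<open>The scaling by \<open>g\<close> makes the control cancel: \<open>g e\<close>
    receives \<open>- g Bt K \<chi>\<close>, and the estimate \<open>xe\<close> receives
    \<open>- Bt K zh\<close> with \<open>zh = g \<chi> + nh\<close>, so only \<open>nh\<close>
    survives.\<close>
  define \<delta> where "\<delta> k = g \<cdot>\<^sub>v e k - xe k" for k
  have \<delta>: "\<delta> k \<in> carrier_vec n" for k unfolding \<delta>_def by (simp only: lin carr)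
  have "vec_null n \<delta>"
  proof (rule schur_recurrence_null[OF HC(2) AH \<delta>, of
        "\<lambda>k. g \<cdot>\<^sub>v (Bt *\<^sub>v \<rho> k) + Bt *\<^sub>v (K *\<^sub>v nh k) - H *\<^sub>v nb k" d])
    show "vec_null n (\<lambda>k. g \<cdot>\<^sub>v (Bt *\<^sub>v \<rho> k) + Bt *\<^sub>v (K *\<^sub>v nh k) - H *\<^sub>v nb k)"
      by (intro vec_null_minus vec_null_add vec_null_smult c[THEN vec_null_mult_mat] \<rho> zb(1) zh(1))
    fix k assume k: "k \<ge> d"
    have alg: "g \<cdot>\<^sub>v (a + r - b) - (x - (g \<cdot>\<^sub>v b + m) + (g \<cdot>\<^sub>v h + q - s))
        = g \<cdot>\<^sub>v a - x - (g \<cdot>\<^sub>v h - s) + (g \<cdot>\<^sub>v r + m - q)"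
      if "a \<in> carrier_vec n" "r \<in> carrier_vec n" "b \<in> carrier_vec n" "x \<in> carrier_vec n"
        "m \<in> carrier_vec n" "h \<in> carrier_vec n" "q \<in> carrier_vec n" "s \<in> carrier_vec n"
      for a r b x m h q s :: "real vec" using that by (intro eq_vecI) (auto simp: ring_distribs)
    show "\<delta> (Suc k) = (At - H * Ct) *\<^sub>v \<delta> k
        + (g \<cdot>\<^sub>v (Bt *\<^sub>v \<rho> k) + Bt *\<^sub>v (K *\<^sub>v nh k) - H *\<^sub>v nb k)"
      unfolding \<delta>_def e_Suc[OF k] xe(2) zb(2)[OF k, folded e_def] zh(2)
      by (simp only: lin carr alg)
  qed
  \<comment> \<open>Since \<open>xe\<close> is close to \<open>g e\<close> and \<open>zh\<close> is
    \<open>g \<chi>\<close> up to \<open>nh\<close>, the term \<open>At zh - At xe\<close> equals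
    \<open>- g At \<epsilon>\<close> up to vanishing terms; this turns the factor 1 of
    \<open>At \<epsilon>\<close> into \<open>1 - g\<close>.\<close>
  define \<epsilon> where "\<epsilon> k = e k - \<chi> k" for k
  have \<epsilon>: "\<epsilon> k \<in> carrier_vec n" for k unfolding \<epsilon>_def by (simp only: lin carr)
  have "vec_null n \<epsilon>"
  proof (rule contracted_recurrence_null[OF c(1) ev, of "1 - g" \<epsilon>
        "\<lambda>k. Bt *\<^sub>v \<rho> k + At *\<^sub>v \<delta> k + At *\<^sub>v nh k" d])
    show "vec_null n (\<lambda>k. Bt *\<^sub>v \<rho> k + At *\<^sub>v \<delta> k + At *\<^sub>v nh k)"
      by (intro vec_null_add c[THEN vec_null_mult_mat] \<rho> zh(1) \<open>vec_null n \<delta>\<close>)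
    fix k assume k: "k \<ge> d"
    have alg: "a + r - b - (h - b + x - (g \<cdot>\<^sub>v h + m))
        = (1 - g) \<cdot>\<^sub>v (a - h) + (r + (g \<cdot>\<^sub>v a - x) + m)"
      if "a \<in> carrier_vec n" "r \<in> carrier_vec n" "b \<in> carrier_vec n" "x \<in> carrier_vec n"
        "m \<in> carrier_vec n" "h \<in> carrier_vec n"
      for a r b x m h :: "real vec" using that by (intro eq_vecI) (auto simp: ring_distribs)
    show "\<epsilon> (Suc k) = (1 - g) \<cdot>\<^sub>v (At *\<^sub>v \<epsilon> k) + (Bt *\<^sub>v \<rho> k + At *\<^sub>v \<delta> k + At *\<^sub>v nh k)"
      unfolding \<epsilon>_def \<delta>_def e_Suc[OF k] \<chi>(2) zh(2) by (simp only: lin carr alg)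
  qed (use g \<epsilon> in auto)
  have "vec_null n e"
  proof (rule schur_recurrence_null[OF BK(2) AK e, of "\<lambda>k. Bt *\<^sub>v \<rho> k + Bt *\<^sub>v (K *\<^sub>v \<epsilon> k)" d])
    show "vec_null n (\<lambda>k. Bt *\<^sub>v \<rho> k + Bt *\<^sub>v (K *\<^sub>v \<epsilon> k))"
      by (intro vec_null_add c[THEN vec_null_mult_mat] \<rho> \<open>vec_null n \<epsilon>\<close>)
    fix k assume k: "k \<ge> d"
    \<comment> \<open>Writing \<open>\<chi> = e - \<epsilon>\<close> closes the feedback loop with
      the true error; \<open>s\<close> is the term \<open>Bt K e\<close>, subtracted and added
      again.\<close>
    have alg: "a + r - b = a - s + (r + (s - b))"
      if "a \<in> carrier_vec n" "r \<in> carrier_vec n" "b \<in> carrier_vec n" "s \<in> carrier_vec n"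
      for a r b s :: "real vec" using that by (intro eq_vecI) auto
    show "e (Suc k) = (At - Bt * K) *\<^sub>v e k + (Bt *\<^sub>v \<rho> k + Bt *\<^sub>v (K *\<^sub>v \<epsilon> k))"
      unfolding e_Suc[OF k] \<epsilon>_def by (simp only: lin carr) (intro alg lin carr)
  qed
  then show "synced_state n xt xh d" unfolding synced_state_def e_def .
  have "e k - \<epsilon> k = \<chi> k" for k unfolding \<epsilon>_def using e[of k] \<chi>(1)[of k] by (intro eq_vecI) auto
  then show "vec_null n \<chi>" using vec_null_minus[OF \<open>vec_null n e\<close> \<open>vec_null n \<epsilon>\<close>] by simp
qed

section \<open>Trees: root, parents and accumulated delays\<close>

lemma tree_graph_root:
  assumes "a \<in> tree_graphs N"
  shows "1 \<in> {1..N}" and "\<And>j. j \<in> {1..N} \<Longrightarrow> a 1 j = 0"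
    and "\<And>i. i \<in> {1..N} \<Longrightarrow> i \<noteq> 1 \<Longrightarrow> \<exists>!j. (j, i) \<in> edges N a"
proof -
  have w: "weighted_graph N a" and low: "\<And>i j. i \<in> {1..N} \<Longrightarrow> j \<in> {1..N} \<Longrightarrow> i < j \<Longrightarrow> a i j = 0"
    using assms by (force simp: tree_graphs_def laplacian_def)+
  from assms obtain r where r: "r \<in> {1..N}" "\<And>j. (j, r) \<notin> edges N a"
      "\<And>i. i \<in> {1..N} - {r} \<Longrightarrow> (\<exists>!j. (j, i) \<in> edges N a)"
    unfolding tree_graphs_def directed_spanning_tree_def by auto
  show one: "1 \<in> {1..N}" using r(1) by auto
  show a1: "a 1 j = 0" if "j \<in> {1..N}" for j
    using low[OF one that] w one that by (cases "j = 1") (auto simp: weighted_graph_def)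
  \<comment> \<open>The triangular numbering forbids edges from a larger to a smaller node, so node
    1 has no parent, while every node other than \<open>r\<close> has one.\<close>
  have "r = 1"
  proof (rule ccontr)
    assume "r \<noteq> 1"
    then obtain j where "(j, 1) \<in> edges N a" using r(3)[of 1] one by blast
    then show False using a1 by (auto simp: edges_def)
  qed
  then show "\<exists>!j. (j, i) \<in> edges N a" if "i \<in> {1..N}" "i \<noteq> 1" for i using r(3) that by blast
qed

text \<open>Triangularity places the parent before its child, so that induction on node numbers runs
  down the tree.\<close>

lemma tree_graph_parent:
  assumes "a \<in> tree_graphs N" and i: "i \<in> {1..N}" "i \<noteq> 1"
  obtains j where "j \<in> {1..N}" "j < i" "a i j > 0" "\<And>j'. j' \<in> {1..N} \<Longrightarrow> j' \<noteq> j \<Longrightarrow> a i j' = 0"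
    "(j, i) \<in> edges N a"
proof -
  have w: "weighted_graph N a" and low: "\<And>i j. i \<in> {1..N} \<Longrightarrow> j \<in> {1..N} \<Longrightarrow> i < j \<Longrightarrow> a i j = 0"
    using assms(1) by (force simp: tree_graphs_def laplacian_def)+
  from tree_graph_root(3)[OF assms] obtain j where j: "(j, i) \<in> edges N a"
    and u: "\<And>j'. (j', i) \<in> edges N a \<Longrightarrow> j' = j" by blast
  show thesis
  proof (rule that[of j])
    show "j \<in> {1..N}" "a i j > 0" "(j, i) \<in> edges N a" using j by (auto simp: edges_def)
    then show "j < i" using low[OF i(1), of j] w i(1)
      by (cases j i rule: linorder_cases) (auto simp: weighted_graph_def)
    fix j' assume "j' \<in> {1..N}" "j' \<noteq> j"
    then show "a i j' = 0" using u[of j'] w i(1) by (force simp: edges_def weighted_graph_def)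
  qed
qed

text \<open>Justifies the definite description in \<open>exo_delay\<close>: node 1 has no incoming
  edge and every other node exactly one, so a derivation of \<open>path_delay\<close> is determined
  by its end node.\<close>

lemma path_delay_fun:
  assumes a: "a \<in> tree_graphs N"
  shows "path_delay N a \<kappa> \<kappa>1 i d \<Longrightarrow> path_delay N a \<kappa> \<kappa>1 i d' \<Longrightarrow> d = d'"
proof (induction arbitrary: d' rule: path_delay.induct)
  case root
  from root show ?case
  proof cases
    case (edge j d)
    then show ?thesis using tree_graph_root(2)[OF a] by (auto simp: edges_def)
  qed auto
next
  case (edge j d i)
  have i: "i \<in> {1..N}" "i \<noteq> 1" using edge.hyps(2) tree_graph_root(2)[OF a] by (auto simp: edges_def)
  from edge.prems show ?case
  proof cases
    case root
    then show ?thesis using i by simp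
  next
    case e2: (edge j' d2)
    have "j' = j" using tree_graph_root(3)[OF a i] e2 edge.hyps(2) by blast
    then show ?thesis using edge.IH e2 by auto
  qed
qed

lemma exo_delay_eq:
  assumes "a \<in> tree_graphs N" "path_delay N a \<kappa> \<kappa>1 i d"
  shows "exo_delay N a \<kappa> \<kappa>1 i = d"
  unfolding exo_delay_def using assms path_delay_fun[OF assms(1)] by blast

lemma exo_delay_root: "a \<in> tree_graphs N \<Longrightarrow> exo_delay N a \<kappa> \<kappa>1 1 = \<kappa>1"
  by (rule exo_delay_eq[OF _ path_delay.root])

lemma path_delay_exists:
  assumes a: "a \<in> tree_graphs N"
  shows "i \<in> {1..N} \<Longrightarrow> path_delay N a \<kappa> \<kappa>1 i (exo_delay N a \<kappa> \<kappa>1 i)"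
proof (induction i rule: less_induct)
  case (less i)
  show ?case
  proof (cases "i = 1")
    case True
    then show ?thesis using exo_delay_root[OF a] path_delay.root by metis
  next
    case False
    from tree_graph_parent[OF a less.prems this] obtain j where
      "j \<in> {1..N}" "j < i" "(j, i) \<in> edges N a" by blast
    then have "path_delay N a \<kappa> \<kappa>1 i (exo_delay N a \<kappa> \<kappa>1 j + \<kappa> i j)"
      using less.IH path_delay.edge by blast
    then show ?thesis using exo_delay_eq[OF a] by metis
  qed
qed

lemma exo_delay_edge:
  assumes "a \<in> tree_graphs N" "(j, i) \<in> edges N a"
  shows "exo_delay N a \<kappa> \<kappa>1 i = exo_delay N a \<kappa> \<kappa>1 j + \<kappa> i j"
proof -
  have "j \<in> {1..N}" using assms(2) by (auto simp: edges_def)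
  then show ?thesis
    using exo_delay_eq[OF assms(1) path_delay.edge[OF path_delay_exists[OF assms(1)] assms(2)]] by blast
qed

section \<open>The gain \<open>g\<close> at the root and along an edge\<close>

lemma network_sum_root:
  assumes "a \<in> tree_graphs N"
  shows "1 / (2 + d_in N a 1) * (\<Sum>j = 1..N. expanded_laplacian N a 1 j * f j) = (1/2) * f 1"
proof -
  note one = tree_graph_root(1)[OF assms] and a1 = tree_graph_root(2)[OF assms]
  have "d_in N a 1 = 0" unfolding d_in_def using a1 by (intro sum.neutral) auto
  moreover have "expanded_laplacian N a 1 j = (if j = 1 then 1 else 0)" if "j \<in> {1..N}" for j
    using that a1 calculation by (auto simp: expanded_laplacian_def laplacian_def d_in_def)
  then have "(\<Sum>j = 1..N. expanded_laplacian N a 1 j * f j) = (\<Sum>j = 1..N. if j = 1 then f j else 0)"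
    by (intro sum.cong) auto
  ultimately show ?thesis using one by simp
qed

text \<open>With a single incoming edge the Laplacian row has just two nonzero entries, of equal
  size and opposite sign: that of the node and that of its parent. The normalization
  \<open>2 + a i j\<close> makes the gain smaller than 1.\<close>

lemma network_sum_edge:
  assumes "a \<in> tree_graphs N" "i \<in> {1..N}" "i \<noteq> 1" "j \<in> {1..N}" "j < i"
    and "\<And>j'. j' \<in> {1..N} \<Longrightarrow> j' \<noteq> j \<Longrightarrow> a i j' = 0"
  shows "1 / (2 + d_in N a i) * (\<Sum>j = 1..N. expanded_laplacian N a i j * f j)
    = a i j / (2 + a i j) * (f i - f j)"
proof -
  have "(\<Sum>k = 1..N. a i k) = (\<Sum>k = 1..N. if k = j then a i k else 0)"
    using assms(6) by (intro sum.cong) auto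
  then have d: "(\<Sum>k = 1..N. a i k) = a i j" using assms(4) by simp
  have "expanded_laplacian N a i k * f k
    = (if k = i then a i j * f i else 0) - (if k = j then a i j * f j else 0)" if "k \<in> {1..N}" for k
    using that assms d by (auto simp: expanded_laplacian_def laplacian_def)
  then have "(\<Sum>k = 1..N. expanded_laplacian N a i k * f k)
    = (\<Sum>k = 1..N. (if k = i then a i j * f i else 0) - (if k = j then a i j * f j else 0))"
    by (intro sum.cong) auto
  also have "\<dots> = a i j * (f i - f j)"
    using assms(2,4) by (simp add: sum_subtractf algebra_simps)
  finally show ?thesis using d by (simp add: d_in_def)
qed

lemma network_sync:
  fixes At Bt Ct K H :: "real mat"
  assumes c: "At \<in> carrier_mat n n" "Bt \<in> carrier_mat n p" "Ct \<in> carrier_mat p n"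
      "K \<in> carrier_mat p n" "H \<in> carrier_mat n p"
    and AK: "schur_stable (At - Bt * K)" and AH: "schur_stable (At - H * Ct)"
    and ev: "\<And>l. eigenvalue (map_mat complex_of_real At) l \<Longrightarrow> cmod l \<le> 1"
    and a: "a \<in> tree_graphs N" and \<kappa>: "comm_delays N \<kappa>" and \<kappa>h: "comm_delays N \<kappa>h"
    and xt: "\<And>k. xt k \<in> carrier_vec n" "\<And>k. xt (Suc k) = At *\<^sub>v xt k" "\<And>k. yr (int k) = Ct *\<^sub>v xt k"
    and xh: "\<And>i k. i \<in> {1..N} \<Longrightarrow> xh i k \<in> carrier_vec n"
      "\<And>i k. i \<in> {1..N} \<Longrightarrow> xh i (Suc k) = At *\<^sub>v xh i k + Bt *\<^sub>v (\<rho> i k - K *\<^sub>v \<chi> i (int k))"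
      "\<And>i k. i \<in> {1..N} \<Longrightarrow> y i (int k) = Ct *\<^sub>v xh i k"
    and \<rho>: "\<And>i. i \<in> {1..N} \<Longrightarrow> vec_null p (\<rho> i)"
    and xe: "\<And>i k. i \<in> {1..N} \<Longrightarrow> xe i k \<in> carrier_vec n"
      "\<And>i k. i \<in> {1..N} \<Longrightarrow> xe i (Suc k) = At *\<^sub>v xe i k
         - Bt *\<^sub>v (K *\<^sub>v zeta_hat n N a \<kappa>h \<chi> i k) + H *\<^sub>v (zeta_bar p N a \<kappa> \<kappa>1 y yr i k - Ct *\<^sub>v xe i k)"
    and \<chi>: "\<And>i k. i \<in> {1..N} \<Longrightarrow> \<chi> i (int k) \<in> carrier_vec n"
      "\<And>i k. i \<in> {1..N} \<Longrightarrow> \<chi> i (int (Suc k)) = (At - Bt * K) *\<^sub>v \<chi> i (int k)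
         + At *\<^sub>v xe i k - At *\<^sub>v zeta_hat n N a \<kappa>h \<chi> i k"
  shows "delayed_output_sync p N a \<kappa> \<kappa>1 y yr"
proof -
  let ?d = "exo_delay N a \<kappa> \<kappa>1"
  have Ce: "vec_null p (\<lambda>k. Ct *\<^sub>v (xh i k - xt (k - ?d i)))" if "synced_state n xt (xh i) (?d i)" for i
    using that vec_null_mult_mat[OF c(3)] by (auto simp: synced_state_def)
  have out: "y i (int k) $ t - yr (int k - int (?d i)) $ t = (Ct *\<^sub>v (xh i k - xt (k - ?d i))) $ t"
    if "i \<in> {1..N}" "k \<ge> ?d i" "t < p" for i k t
    using xh(3)[OF that(1), of k] xt(3)[of "k - ?d i"] that c xh(1)[OF that(1), of k] xt(1)
    by (subst mult_minus_distrib_mat_vec[of _ p n]) (auto simp: of_nat_diff)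
  \<comment> \<open>For early \<open>k\<close> the reference \<open>yr\<close> is read at negative
    times, where it is arbitrary; \<open>out\<close> therefore holds only eventually.\<close>
  have err: "(\<lambda>k. y i (int k) $ t - yr (int k - int (?d i)) $ t) \<longlonglongrightarrow> 0"
    if "i \<in> {1..N}" "synced_state n xt (xh i) (?d i)" "t < p" for i t
  proof (rule Lim_transform_eventually[OF vec_nullD(2)[OF Ce[OF that(2)] that(3)]])
    show "\<forall>\<^sub>F k in sequentially. (Ct *\<^sub>v (xh i k - xt (k - ?d i))) $ t
        = y i (int k) $ t - yr (int k - int (?d i)) $ t"
      using out[OF that(1) _ that(3)] by (auto simp: eventually_sequentially intro!: exI[of _ "?d i"])
  qed
  \<comment> \<open>The claim also carries \<chi>, because a child receives it through
    \<open>zeta_hat\<close>, with a delay \<open>\<kappa>h\<close> unrelated to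
    \<open>\<kappa>\<close>.\<close>
  have "synced_state n xt (xh i) (?d i) \<and> vec_null n (\<lambda>k. \<chi> i (int k))" if "i \<in> {1..N}" for i
    using that
  proof (induction i rule: less_induct)
    case (less i)
    have \<kappa>0: "\<kappa> i i = 0" "\<kappa>h i i = 0" using \<kappa> \<kappa>h less.prems by (auto simp: comm_delays_def)
    obtain g nb nh where g: "0 < g" "g < (1::real)"
      and nb: "vec_null p nb" "\<And>k t. t < p \<Longrightarrow> zeta_bar p N a \<kappa> \<kappa>1 y yr i k $ t
        = g * (y i (int k) $ t - yr (int k - int (?d i)) $ t) + nb k $ t"
      and nh: "vec_null n nh" "\<And>k t. t < n \<Longrightarrow> zeta_hat n N a \<kappa>h \<chi> i k $ t = g * \<chi> i (int k) $ t + nh k $ t"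
    proof (cases "i = 1")
      case True
      show ?thesis
        by (rule that[of "1/2" "\<lambda>k. 0\<^sub>v p" "\<lambda>k. 0\<^sub>v n"])
          (use True \<kappa>0 network_sum_root[OF a] in
            \<open>simp_all add: vec_null_def zeta_bar_def zeta_hat_def\<close>)
    next
      case False
      from tree_graph_parent[OF a less.prems False] obtain j where
        j: "j \<in> {1..N}" "j < i" "a i j > 0" "\<And>j'. j' \<in> {1..N} \<Longrightarrow> j' \<noteq> j \<Longrightarrow> a i j' = 0"
        "(j, i) \<in> edges N a" by blast
      define g where "g = a i j / (2 + a i j)"
      have g: "0 < g" "g < 1" using j(3) by (auto simp: g_def)
      have IH: "synced_state n xt (xh j) (?d j)" "vec_null n (\<lambda>k. \<chi> j (int k))"
        using less.IH[OF j(2,1)] by auto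
      define nb where "nb k = vec p (\<lambda>t. - g * (y j (int k - int (\<kappa> i j)) $ t
        - yr (int k - int (\<kappa> i j) - int (?d j)) $ t))" for k
      define nh where "nh k = vec n (\<lambda>t. - g * \<chi> j (int k - int (\<kappa>h i j)) $ t)" for k
      \<comment> \<open>Delays add along the edge, so the exosystem sample that agent
        \<open>i\<close> subtracts from the delayed output of its parent is the one the parent
        tracks. The parent term is thus the error of the parent, delayed by
        \<open>\<kappa> i j\<close>.\<close>
      have "int (?d i) = int (\<kappa> i j) + int (?d j)" using exo_delay_edge[OF a j(5)] by simp
      then have yrd: "yr (int k - int (?d i)) = yr (int k - int (\<kappa> i j) - int (?d j))" for k
        by (simp add: algebra_simps)
      note S = network_sum_edge[OF a less.prems False j(1,2,4), folded g_def]
      show ?thesis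
      proof (rule that[of g nb nh])
        show "vec_null p nb" unfolding vec_null_def
        proof (intro conjI allI impI)
          fix t assume t: "t < p"
          have "(\<lambda>k. - g * (y j (int k - int (\<kappa> i j)) $ t - yr (int k - int (\<kappa> i j) - int (?d j)) $ t))
              \<longlonglongrightarrow> 0"
            using int_delay_null[of "\<lambda>k. y j k $ t - yr (k - int (?d j)) $ t", OF err[OF j(1) IH(1) t]]
            by (rule tendsto_mult_right_zero)
          then show "(\<lambda>k. nb k $ t) \<longlonglongrightarrow> 0" using t by (simp add: nb_def)
        qed (simp add: nb_def)
        show "vec_null n nh" unfolding vec_null_def
        proof (intro conjI allI impI)
          fix t assume t: "t < n"
          have "(\<lambda>k. - g * \<chi> j (int k - int (\<kappa>h i j)) $ t) \<longlonglongrightarrow> 0"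
            using int_delay_null[of "\<lambda>k. \<chi> j k $ t", OF vec_nullD(2)[OF IH(2) t]]
            by (rule tendsto_mult_right_zero)
          then show "(\<lambda>k. nh k $ t) \<longlonglongrightarrow> 0" using t by (simp add: nh_def)
        qed (simp add: nh_def)
        show "zeta_bar p N a \<kappa> \<kappa>1 y yr i k $ t
          = g * (y i (int k) $ t - yr (int k - int (?d i)) $ t) + nb k $ t" if "t < p" for k t
          using that \<kappa>0 S[of "\<lambda>j. y j (int k - int (\<kappa> i j)) $ t - yr (int k - int (?d i)) $ t"]
          unfolding zeta_bar_def nb_def yrd by (simp add: ring_distribs)
        show "zeta_hat n N a \<kappa>h \<chi> i k $ t = g * \<chi> i (int k) $ t + nh k $ t" if "t < n" for k t
          using that \<kappa>0 S[of "\<lambda>j. \<chi> j (int k - int (\<kappa>h i j)) $ t"]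
          unfolding zeta_hat_def nh_def by (simp add: ring_distribs)
      qed (use g in auto)
    qed
    have zb: "zeta_bar p N a \<kappa> \<kappa>1 y yr i k = g \<cdot>\<^sub>v (Ct *\<^sub>v (xh i k - xt (k - ?d i))) + nb k"
      if "k \<ge> ?d i" for k
      using out[OF less.prems that] nb(2) vec_nullD(1)[OF nb(1), of k] c
      by (intro eq_vecI) (auto simp: zeta_bar_def)
    have zh: "zeta_hat n N a \<kappa>h \<chi> i k = g \<cdot>\<^sub>v \<chi> i (int k) + nh k" for k
      using nh(2) vec_nullD(1)[OF nh(1), of k] \<chi>(1)[OF less.prems, of k]
      by (intro eq_vecI) (auto simp: zeta_hat_def)
    note ag = agent_sync[where \<chi> = "\<lambda>k. \<chi> i (int k)" and xt = xt and xh = "xh i" and \<rho> = "\<rho> i"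
        and xe = "xe i" and zb = "zeta_bar p N a \<kappa> \<kappa>1 y yr i" and zh = "zeta_hat n N a \<kappa>h \<chi> i"
        and d = "?d i" and nb = nb and nh = nh,
        OF c AK AH ev g xt(1,2) xh(1,2)[OF less.prems] \<rho>[OF less.prems] xe[OF less.prems]
        \<chi>[OF less.prems] nb(1) zb nh(1) zh]
    show ?case using ag by blast
  qed
  then show ?thesis unfolding delayed_output_sync_def using err by blast
qed

section \<open>Polynomials in the shift operator\<close>

text \<open>The polynomial acts through forward shifts, so identities hold from time 0 without
  initial data. Future values occur only in the analysis or as entries of a chain state.\<close>

definition shift_poly :: "'a :: comm_ring_1 poly \<Rightarrow> (nat \<Rightarrow> 'a) \<Rightarrow> nat \<Rightarrow> 'a" where
  "shift_poly f s k = (\<Sum>j\<le>degree f. coeff f j * s (k + j))"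

lemma shift_poly_bound:
  assumes "degree f \<le> n"
  shows "shift_poly f s k = (\<Sum>j\<le>n. coeff f j * s (k + j))"
  unfolding shift_poly_def using assms
  by (intro sum.mono_neutral_left) (auto simp: coeff_eq_0)

lemma shift_poly_lessThan:
  assumes "degree f < n"
  shows "shift_poly f s k = (\<Sum>j<n. coeff f j * s (k + j))"
  using shift_poly_bound[of f "n - 1" s k] assms by (simp add: lessThan_Suc_atMost[symmetric])

lemma shift_poly_0 [simp]: "shift_poly 0 s k = 0"
  by (simp add: shift_poly_def)

lemma shift_poly_const [simp]: "shift_poly [:c:] s k = c * s k"
  by (simp add: shift_poly_def)

lemma shift_poly_1 [simp]: "shift_poly 1 s k = s k"
  by (simp add: shift_poly_def)

lemma shift_poly_add: "shift_poly (f + g) s k = shift_poly f s k + shift_poly g s k"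
proof -
  let ?n = "max (degree f) (degree g)"
  have "degree (f + g) \<le> ?n" by (rule degree_add_le_max)
  then show ?thesis
    by (simp add: shift_poly_bound[of _ ?n] sum.distrib algebra_simps)
qed

lemma shift_poly_sum: "shift_poly (\<Sum>i\<in>I. f i) s k = (\<Sum>i\<in>I. shift_poly (f i) s k)"
  by (induction I rule: infinite_finite_induct) (simp_all add: shift_poly_add)

lemma shift_poly_smult: "shift_poly (Polynomial.smult c f) s k = c * shift_poly f s k"
  by (subst shift_poly_bound[of "Polynomial.smult c f" "degree f"])
    (simp_all add: shift_poly_def sum_distrib_left mult.assoc degree_smult_le)

lemma shift_poly_pCons: "shift_poly (pCons c f) s k = c * s k + shift_poly f s (Suc k)"
proof -
  have "shift_poly (pCons c f) s k = (\<Sum>j\<le>Suc (degree f). coeff (pCons c f) j * s (k + j))"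
    by (rule shift_poly_bound) (rule degree_pCons_le)
  also have "\<dots> = c * s k + shift_poly f s (Suc k)"
    by (subst sum.atMost_Suc_shift) (simp add: shift_poly_def)
  finally show ?thesis .
qed

lemma shift_poly_mult: "shift_poly (f * g) s k = shift_poly f (shift_poly g s) k"
proof (induction f arbitrary: k)
  case (pCons c f)
  then show ?case
    by (simp add: mult_pCons_left shift_poly_add shift_poly_smult shift_poly_pCons)
qed simp

lemma shift_poly_seq_sum: "shift_poly f (\<lambda>k. \<Sum>i\<in>I. s i k) k = (\<Sum>i\<in>I. shift_poly f (s i) k)"
  unfolding shift_poly_def sum_distrib_left by (rule sum.swap)

lemma shift_poly_seq_add: "shift_poly f (\<lambda>k. s k + r k) k = shift_poly f s k + shift_poly f r k"
  by (simp add: shift_poly_def sum.distrib algebra_simps)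

lemma shift_poly_seq_smult: "shift_poly f (\<lambda>k. c * s k) k = c * shift_poly f s k"
  by (simp add: shift_poly_def sum_distrib_left algebra_simps)

lemma shift_poly_null:
  fixes s :: "nat \<Rightarrow> 'a :: real_normed_field"
  assumes "s \<longlonglongrightarrow> 0"
  shows "shift_poly f s \<longlonglongrightarrow> 0"
  unfolding shift_poly_def[abs_def]
  by (intro tendsto_null_sum tendsto_mult_right_zero LIMSEQ_ignore_initial_segment assms)

definition shift_mat :: "'a :: comm_ring_1 poly mat \<Rightarrow> (nat \<Rightarrow> 'a vec) \<Rightarrow> nat \<Rightarrow> 'a vec" where
  "shift_mat P x k = vec (dim_row P) (\<lambda>i. \<Sum>j<dim_col P. shift_poly (P $$ (i, j)) (\<lambda>k. x k $ j) k)"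

lemma shift_mat_carrier: "P \<in> carrier_mat m n \<Longrightarrow> shift_mat P x k \<in> carrier_vec m"
  by (simp add: shift_mat_def)

text \<open>The bridge by which an identity between polynomial matrices, such as that between a
  matrix and its adjugate, becomes an identity between trajectories.\<close>

lemma shift_mat_mult:
  assumes "P \<in> carrier_mat m n" "Q \<in> carrier_mat n l"
  shows "shift_mat (P * Q) x = shift_mat P (shift_mat Q x)"
proof (rule ext, rule eq_vecI)
  fix k i assume "i < dim_vec (shift_mat P (shift_mat Q x) k)"
  then have i: "i < m" using assms by (simp add: shift_mat_def)
  have "shift_mat (P * Q) x k $ i
    = (\<Sum>j<l. \<Sum>r<n. shift_poly (P $$ (i, r)) (shift_poly (Q $$ (r, j)) (\<lambda>k. x k $ j)) k)"
    using assms index_mult_mat_sum[OF assms i] i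
    by (simp add: shift_mat_def shift_poly_sum shift_poly_mult del: index_mult_mat(1))
  also have "\<dots> = (\<Sum>r<n. \<Sum>j<l. shift_poly (P $$ (i, r)) (shift_poly (Q $$ (r, j)) (\<lambda>k. x k $ j)) k)"
    by (rule sum.swap)
  also have "\<dots> = (\<Sum>r<n. shift_poly (P $$ (i, r)) (\<lambda>k. shift_mat Q x k $ r) k)"
    using assms by (intro sum.cong) (auto simp: shift_mat_def shift_poly_seq_sum)
  also have "\<dots> = shift_mat P (shift_mat Q x) k $ i" using assms i by (simp add: shift_mat_def)
  finally show "shift_mat (P * Q) x k $ i = shift_mat P (shift_mat Q x) k $ i" .
qed (use assms in \<open>simp add: shift_mat_def\<close>)

lemma shift_mat_const:
  assumes "A \<in> carrier_mat m n" "\<And>k. x k \<in> carrier_vec n"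
  shows "shift_mat (map_mat (\<lambda>c. [:c:]) A) x k = A *\<^sub>v x k"
  using assms(1) index_mult_mat_vec_sum[OF assms]
  by (intro eq_vecI) (auto simp: shift_mat_def simp del: index_mult_mat_vec)

lemma shift_mat_char_poly_matrix:
  assumes A: "A \<in> carrier_mat n n" and x: "\<And>k. x k \<in> carrier_vec n"
  shows "shift_mat (char_poly_matrix A) x k = x (Suc k) - A *\<^sub>v x k"
proof (rule eq_vecI)
  fix i assume "i < dim_vec (x (Suc k) - A *\<^sub>v x k)"
  then have i: "i < n" using A by simp
  have "shift_mat (char_poly_matrix A) x k $ i
      = (\<Sum>j<n. (if j = i then x (Suc k) $ j else 0) - A $$ (i, j) * x k $ j)"
    using A i unfolding shift_mat_def char_poly_matrix_def
    by (auto simp: shift_poly_add shift_poly_pCons intro!: sum.cong)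
  also have "\<dots> = (x (Suc k) - A *\<^sub>v x k) $ i"
    using i A index_mult_mat_vec_sum[OF A x i, of k] by (simp add: sum_subtractf)
  finally show "shift_mat (char_poly_matrix A) x k $ i = (x (Suc k) - A *\<^sub>v x k) $ i" .
qed (use A in \<open>simp add: shift_mat_def char_poly_matrix_def\<close>)

lemma shift_mat_scalar:
  assumes "i < n"
  shows "shift_mat (f \<cdot>\<^sub>m 1\<^sub>m n) x k $ i = shift_poly f (\<lambda>k. x k $ i) k"
proof -
  have "shift_mat (f \<cdot>\<^sub>m 1\<^sub>m n) x k $ i
      = (\<Sum>j<n. shift_poly ((f \<cdot>\<^sub>m 1\<^sub>m n) $$ (i, j)) (\<lambda>k. x k $ j) k)"
    using assms by (simp add: shift_mat_def)
  also have "\<dots> = (\<Sum>j<n. if j = i then shift_poly f (\<lambda>k. x k $ i) k else 0)"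
    using assms by (intro sum.cong) auto
  finally show ?thesis using assms by simp
qed

text \<open>The Cayley-Hamilton theorem for trajectories: \<open>zI - A\<close> annihilates a free
  trajectory, and multiplication by the adjugate turns it into \<open>det(zI - A)\<close> times the
  identity.\<close>

lemma char_poly_annihilates:
  assumes A: "A \<in> carrier_mat n n" and x: "\<And>k. x k \<in> carrier_vec n" "\<And>k. x (Suc k) = A *\<^sub>v x k"
    and i: "i < n"
  shows "shift_poly (char_poly A) (\<lambda>k. x k $ i) k = 0"
proof -
  note cp = char_poly_matrix_closed[OF A]
  have "shift_mat (char_poly_matrix A) x = (\<lambda>k. 0\<^sub>v n)"
    using shift_mat_char_poly_matrix[of A n x] A x by auto
  moreover have "shift_mat (char_poly A \<cdot>\<^sub>m 1\<^sub>m n) x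
      = shift_mat (adj_mat (char_poly_matrix A)) (shift_mat (char_poly_matrix A) x)"
    using adj_mat[OF cp] by (simp add: char_poly_def flip: shift_mat_mult[OF adj_mat(1)[OF cp] cp])
  moreover have "shift_poly f (\<lambda>k. 0) k = 0" for f :: "'a poly" and k
    by (simp add: shift_poly_def)
  ultimately have "shift_mat (char_poly A \<cdot>\<^sub>m 1\<^sub>m n) x k $ i = 0"
    using adj_mat(1)[OF cp] i by (simp add: shift_mat_def)
  then show ?thesis unfolding shift_mat_scalar[OF i] .
qed

section \<open>Block companion matrices\<close>

text \<open>A vector of length \<open>n p\<close> stacks \<open>n\<close> blocks of length \<open>p\<close>; entry \<open>j p + t\<close> is component \<open>t\<close> of
  block \<open>j\<close>. Up to this ordering the following triple consists of \<open>p\<close> copies of the scalar system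
  \<open>f(z) y = v\<close>.\<close>

definition companion :: "nat \<Rightarrow> 'a :: comm_ring_1 poly \<Rightarrow> 'a mat" where
  "companion p f = mat (degree f * p) (degree f * p) (\<lambda>(i, j).
     if i + p < degree f * p then (if j = i + p then 1 else 0)
     else if j mod p = i mod p then - coeff f (j div p) else 0)"

definition companion_in :: "nat \<Rightarrow> nat \<Rightarrow> 'a :: comm_ring_1 mat" where
  "companion_in p n = mat (n * p) p (\<lambda>(i, t). if i + p < n * p then 0 else if t = i mod p then 1 else 0)"

definition companion_out :: "nat \<Rightarrow> nat \<Rightarrow> 'a :: comm_ring_1 mat" where
  "companion_out p n = mat p (n * p) (\<lambda>(t, j). if j = t then 1 else 0)"

lemma companion_carrier [simp]:
  "companion p f \<in> carrier_mat (degree f * p) (degree f * p)"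
  "companion_in p n \<in> carrier_mat (n * p) p"
  "companion_out p n \<in> carrier_mat p (n * p)"
  by (auto simp: companion_def companion_in_def companion_out_def)

lemma companion_dims [simp]:
  "dim_row (companion p f) = degree f * p" "dim_col (companion p f) = degree f * p"
  "dim_row (companion_in p n) = n * p" "dim_col (companion_in p n) = p"
  "dim_row (companion_out p n) = p" "dim_col (companion_out p n) = n * p"
  by (auto simp: companion_def companion_in_def companion_out_def)

lemma sum_block_channel:
  fixes G :: "nat \<Rightarrow> 'a :: comm_monoid_add"
  assumes "t < p"
  shows "(\<Sum>j<n * p. if j mod p = t then G j else 0) = (\<Sum>j<n. G (j * p + t))"
proof -
  have "(\<Sum>i = m * p..<m * p + p. if i mod p = t then G i else 0) = G (m * p + t)" for m
  proof -
    have "(\<Sum>i = m * p..<m * p + p. if i mod p = t then G i else 0)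
        = (\<Sum>i = m * p..<m * p + p. if i = m * p + t then G i else 0)"
    proof (rule sum.cong)
      fix i assume "i \<in> {m * p..<m * p + p}"
      then obtain r where "i = m * p + r" "r < p" by (auto simp: le_iff_add)
      then show "(if i mod p = t then G i else 0) = (if i = m * p + t then G i else 0)" by auto
    qed simp
    then show ?thesis using assms by simp
  qed
  then show ?thesis by (simp flip: sum.nat_group)
qed

lemma block_index:
  assumes "i < n * p"
  shows "i mod p < p" "i div p < n" "i mod p < n * p" "i div p * p + i mod p = (i :: nat)"
proof -
  have p: "0 < p" using assms by (cases p) auto
  then show "i mod p < p" by simp
  show "i div p < n" using assms by (simp add: less_mult_imp_div_less)
  show "i mod p < n * p" using assms by (meson le_less_trans mod_less_eq_dividend)
qed simp

lemma block_index_less: "j < n \<Longrightarrow> t < p \<Longrightarrow> j * p + t < n * (p :: nat)"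
proof -
  assume "j < n" "t < p"
  then have "j * p + t < Suc j * p" "Suc j * p \<le> n * p" by (simp_all only: mult_le_mono1 Suc_leI) auto
  then show ?thesis by linarith
qed

lemma companion_mult_vec:
  assumes x: "x \<in> carrier_vec (degree f * p)" and i: "i < degree f * p"
  shows "(companion p f *\<^sub>v x) $ i = (if i + p < degree f * p then x $ (i + p)
    else - (\<Sum>j<degree f. coeff f j * x $ (j * p + i mod p)))"
proof (cases "i + p < degree f * p")
  case True
  have "(companion p f *\<^sub>v x) $ i = (\<Sum>j<degree f * p. if j = i + p then x $ j else 0)"
    unfolding index_mult_mat_vec_sum[OF companion_carrier(1) x i]
    using i True by (intro sum.cong) (auto simp: companion_def)
  then show ?thesis using True by simp
next
  case False
  have "(companion p f *\<^sub>v x) $ i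
      = (\<Sum>j<degree f * p. if j mod p = i mod p then - coeff f (j div p) * x $ j else 0)"
    unfolding index_mult_mat_vec_sum[OF companion_carrier(1) x i]
    using i False by (intro sum.cong) (auto simp: companion_def)
  also have "\<dots> = (\<Sum>j<degree f. - coeff f ((j * p + i mod p) div p) * x $ (j * p + i mod p))"
    by (rule sum_block_channel[OF block_index(1)[OF i]])
  also have "\<dots> = - (\<Sum>j<degree f. coeff f j * x $ (j * p + i mod p))"
    using block_index(1)[OF i] by (simp add: sum_negf)
  finally show ?thesis using False by simp
qed

lemma companion_in_mult_vec:
  assumes v: "v \<in> carrier_vec p" and i: "i < n * p"
  shows "(companion_in p n *\<^sub>v v) $ i = (if i + p < n * p then 0 else v $ (i mod p))"
proof -
  have "(companion_in p n *\<^sub>v v) $ i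
      = (\<Sum>t<p. if t = i mod p then (if i + p < n * p then 0 else v $ t) else 0)"
    unfolding index_mult_mat_vec_sum[OF companion_carrier(2) v i]
    using i by (intro sum.cong) (auto simp: companion_in_def)
  then show ?thesis using block_index(1)[OF i] by simp
qed

lemma companion_out_mult_vec:
  assumes x: "x \<in> carrier_vec (n * p)" and t: "t < p" and n: "0 < n"
  shows "(companion_out p n *\<^sub>v x) $ t = x $ t"
proof -
  have "t < n * p" using block_index_less[OF n t] by simp
  have "(companion_out p n *\<^sub>v x) $ t = (\<Sum>j<n * p. if j = t then x $ j else 0)"
    unfolding index_mult_mat_vec_sum[OF companion_carrier(3) x t]
    using t by (intro sum.cong) (auto simp: companion_out_def)
  then show ?thesis using \<open>t < n * p\<close> by simp
qed

lemma shift_poly_monic: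
  assumes "lead_coeff f = 1"
  shows "shift_poly f s k = (\<Sum>j<degree f. coeff f j * s (k + j)) + s (k + degree f)"
  using assms by (simp add: shift_poly_def lessThan_Suc_atMost[symmetric])

text \<open>All block rows but the last are pure shifts, so the state is a chain of successive
  values of block 0; the last block row then is the difference equation of each channel.\<close>

lemma companion_run_chain:
  assumes f: "lead_coeff f = 1" and X: "\<And>k. X k \<in> carrier_vec (degree f * p)"
    and v: "\<And>k. v k \<in> carrier_vec p"
    and rec: "\<And>k. X (Suc k) = companion p f *\<^sub>v X k + companion_in p (degree f) *\<^sub>v v k"
    and t: "t < p" and n: "0 < degree f"
  shows "j < degree f \<Longrightarrow> X k $ (j * p + t) = X (k + j) $ t"
    and "shift_poly f (\<lambda>k. X k $ t) k = v k $ t"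
proof -
  have step: "X (Suc k) $ i = (if i + p < degree f * p then X k $ (i + p)
      else v k $ (i mod p) - (\<Sum>j<degree f. coeff f j * X k $ (j * p + i mod p)))"
    if "i < degree f * p" for i k
    unfolding rec using that companion_mult_vec[OF X that, of k] companion_in_mult_vec[OF v that, of k]
    by (subst index_add_vec) (simp_all del: index_mult_mat_vec)
  show chain: "X k $ (j * p + t) = X (k + j) $ t" if "j < degree f" for j k
    using that
  proof (induction j arbitrary: k)
    case (Suc j)
    have "Suc j * p + t < degree f * p" "j * p + t < degree f * p"
      using Suc.prems t by (auto intro!: block_index_less simp del: mult_Suc)
    then have "X (Suc k) $ (j * p + t) = X k $ (Suc j * p + t)"
      using step[of "j * p + t" k] by (simp add: add_ac)
    then show ?case using Suc.IH[of "Suc k"] Suc.prems by simp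
  qed simp
  obtain m where m: "degree f = Suc m" using n by (cases "degree f") auto
  have last: "m * p + t < degree f * p" "\<not> m * p + t + p < degree f * p"
    using block_index_less[of m "degree f" t p] t m by auto
  have "X (k + degree f) $ t = X (Suc k) $ (m * p + t)"
    using chain[of m "Suc k"] m by simp
  also have "\<dots> = v k $ t - (\<Sum>j<degree f. coeff f j * X (k + j) $ t)"
    using step[OF last(1), of k] last(2) chain[of _ k] t by simp
  finally show "shift_poly f (\<lambda>k. X k $ t) k = v k $ t" unfolding shift_poly_monic[OF f] by simp
qed

definition stack :: "nat \<Rightarrow> nat \<Rightarrow> (nat \<Rightarrow> 'a vec) \<Rightarrow> nat \<Rightarrow> 'a vec" where
  "stack p n y k = vec (n * p) (\<lambda>i. y (k + i div p) $ (i mod p))"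

lemma stack_carrier [simp]: "stack p n y k \<in> carrier_vec (n * p)"
  by (simp add: stack_def)

text \<open>Converse of the chain property: a solution of the difference equation yields a state by
  stacking its next values. Future outputs in the state are harmless, since it serves only to
  describe \<open>y\<close>.\<close>

lemma companion_run_stack:
  assumes f: "lead_coeff f = 1" and n: "0 < degree f" and v: "\<And>k. v k \<in> carrier_vec p"
    and y: "\<And>k. y k \<in> carrier_vec p"
    and rec: "\<And>k t. t < p \<Longrightarrow> shift_poly f (\<lambda>k. y k $ t) k = v k $ t"
  shows "stack p (degree f) y (Suc k)
      = companion p f *\<^sub>v stack p (degree f) y k + companion_in p (degree f) *\<^sub>v v k" (is ?A)
    and "companion_out p (degree f) *\<^sub>v stack p (degree f) y k = y k" (is ?B)
proof -
  let ?n = "degree f"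
  show ?A
  proof (rule eq_vecI)
    fix i assume "i < dim_vec (companion p f *\<^sub>v stack p ?n y k + companion_in p ?n *\<^sub>v v k)"
    then have i: "i < ?n * p" by (simp add: companion_in_def)
    note b = block_index[OF i]
    have p: "0 < p" using b(1) by simp
    have "(companion p f *\<^sub>v stack p ?n y k + companion_in p ?n *\<^sub>v v k) $ i
      = (if i + p < ?n * p then stack p ?n y k $ (i + p)
         else v k $ (i mod p) - (\<Sum>j<?n. coeff f j * stack p ?n y k $ (j * p + i mod p)))"
      using companion_mult_vec[OF stack_carrier i, of y k] companion_in_mult_vec[OF v i, of k] i
      by (subst index_add_vec) (simp_all del: index_mult_mat_vec)
    also have "\<dots> = y (Suc k + i div p) $ (i mod p)"
    proof (cases "i + p < ?n * p")
      case True
      then show ?thesis using p by (simp add: stack_def)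
    next
      case False
      have "\<not> Suc (i div p) < ?n"
      proof
        assume "Suc (i div p) < ?n"
        then have "Suc (i div p) * p + i mod p < ?n * p" using b(1) by (rule block_index_less)
        then show False using False b(4) by (simp add: add_ac)
      qed
      then have *: "?n = Suc (i div p)" using b(2) by simp
      have "stack p ?n y k $ (j * p + i mod p) = y (k + j) $ (i mod p)" if "j < ?n" for j
        using block_index_less[OF that b(1)] b(1) by (simp add: stack_def)
      then show ?thesis
        using False rec[OF b(1), of k] unfolding shift_poly_monic[OF f]
        by (simp add: algebra_simps) (simp add: *)
    qed
    finally show "stack p ?n y (Suc k) $ i
      = (companion p f *\<^sub>v stack p ?n y k + companion_in p ?n *\<^sub>v v k) $ i"
      using i by (simp add: stack_def)
  qed (simp add: stack_def companion_in_def)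
  show ?B
  proof (rule eq_vecI)
    fix t assume "t < dim_vec (y k)"
    then have t: "t < p" using y[of k] by simp
    then show "(companion_out p ?n *\<^sub>v stack p ?n y k) $ t = y k $ t"
      using companion_out_mult_vec[OF stack_carrier t n, of y k] block_index_less[OF n t]
      by (simp add: stack_def)
  qed (use y[of k] in \<open>simp add: companion_out_def\<close>)
qed

section \<open>Output injection and deadbeat gains\<close>

definition injected_companion :: "nat \<Rightarrow> 'a :: comm_ring_1 poly \<Rightarrow> (nat \<Rightarrow> 'a) \<Rightarrow> 'a mat" where
  "injected_companion p f h = mat (degree f * p) (degree f * p)
     (\<lambda>(i, j). companion p f $$ (i, j) - (if j = i mod p then h (i div p) else 0))"

lemma injected_companion_mult_vec:
  assumes x: "x \<in> carrier_vec (degree f * p)" and i: "i < degree f * p"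
  shows "(injected_companion p f h *\<^sub>v x) $ i = (companion p f *\<^sub>v x) $ i - h (i div p) * x $ (i mod p)"
proof -
  have c: "injected_companion p f h \<in> carrier_mat (degree f * p) (degree f * p)"
    by (simp add: injected_companion_def)
  have "(injected_companion p f h *\<^sub>v x) $ i = (\<Sum>j<degree f * p. companion p f $$ (i, j) * x $ j
      - (if j = i mod p then h (i div p) * x $ j else 0))"
    unfolding index_mult_mat_vec_sum[OF c x i] using i
    by (intro sum.cong) (auto simp: injected_companion_def algebra_simps)
  also have "\<dots> = (companion p f *\<^sub>v x) $ i - h (i div p) * x $ (i mod p)"
    using block_index(3)[OF i] unfolding index_mult_mat_vec_sum[OF companion_carrier(1) x i]
    by (simp add: sum_subtractf)
  finally show ?thesis .
qed

text \<open>In an eigenvector for \<open>l\<close>, block \<open>j\<close> is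
  \<open>horner_seq h l j\<close> times block 0. For \<open>h = 0\<close> these factors are the
  powers of \<open>l\<close>.\<close>

primrec horner_seq :: "(nat \<Rightarrow> 'a :: comm_ring_1) \<Rightarrow> 'a \<Rightarrow> nat \<Rightarrow> 'a" where
  "horner_seq h l 0 = 1"
| "horner_seq h l (Suc j) = l * horner_seq h l j + h j"

text \<open>The eigenvector equation is solved block by block starting from block 0, which cannot
  vanish; the last block row then leaves this scalar equation. The matrix is
  \<open>companion\<close> minus an output injection whose block \<open>j\<close> is
  \<open>h j\<close> times the identity, and \<open>h = 0\<close> gives \<open>companion\<close>
  itself.\<close>

lemma injected_companion_eigenvalue:
  fixes f :: "'a :: field poly"
  assumes f: "lead_coeff f = 1" and n: "0 < degree f"
    and ev: "eigenvalue (injected_companion p f h) l"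
  shows "(\<Sum>j\<le>degree f. coeff f j * horner_seq h l j) = 0"
proof -
  let ?n = "degree f" and ?r = "horner_seq h l"
  from ev obtain x where x: "x \<in> carrier_vec (?n * p)" "x \<noteq> 0\<^sub>v (?n * p)"
    and eq: "injected_companion p f h *\<^sub>v x = l \<cdot>\<^sub>v x"
    unfolding eigenvalue_def eigenvector_def by (auto simp: injected_companion_def)
  have row: "l * x $ i = (if i + p < ?n * p then x $ (i + p)
    else - (\<Sum>j<?n. coeff f j * x $ (j * p + i mod p))) - h (i div p) * x $ (i mod p)"
    if "i < ?n * p" for i
  proof -
    have "(injected_companion p f h *\<^sub>v x) $ i = l * x $ i" using eq x(1) that by simp
    then show ?thesis
      unfolding injected_companion_mult_vec[OF x(1) that] companion_mult_vec[OF x(1) that] by simp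
  qed
  have chain: "x $ (j * p + t) = ?r j * x $ t" if "j < ?n" "t < p" for j t
    using that
  proof (induction j)
    case (Suc j)
    have *: "Suc j * p + t < ?n * p" "j * p + t < ?n * p"
      using Suc.prems by (auto intro!: block_index_less simp del: mult_Suc)
    have "x $ (Suc j * p + t) = l * x $ (j * p + t) + h j * x $ t"
      using row[OF *(2)] * Suc.prems(2) by (simp add: add_ac)
    then show ?case using Suc by (simp add: algebra_simps)
  qed simp
  obtain m where m: "?n = Suc m" using n by (cases ?n) auto
  have "\<exists>t<p. x $ t \<noteq> 0"
  proof (rule ccontr)
    assume "\<not> ?thesis"
    then have "x $ i = 0" if "i < ?n * p" for i
      using chain[OF block_index(2,1)[OF that]] block_index(1,4)[OF that] by simp
    then show False using x by (auto intro!: eq_vecI)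
  qed
  then obtain t where t: "t < p" "x $ t \<noteq> 0" by blast
  have last: "m * p + t < ?n * p" "\<not> m * p + t + p < ?n * p"
    using block_index_less[of m "degree f" t p] t m by auto
  define S where "S = (\<Sum>j<?n. coeff f j * ?r j)"
  have "(\<Sum>j<?n. coeff f j * x $ (j * p + t)) = S * x $ t"
    unfolding S_def sum_distrib_right using chain t(1) by (intro sum.cong) (auto simp: mult.assoc)
  then have "l * (?r m * x $ t) = - (S * x $ t) - h m * x $ t"
    using row[OF last(1)] last(2) t(1) chain[of m t] m by simp
  moreover have "?r ?n = l * ?r m + h m" by (simp add: m)
  ultimately have "(S + ?r ?n) * x $ t = 0" by (simp add: algebra_simps)
  then have "((\<Sum>j<?n. coeff f j * ?r j) + ?r ?n) * x $ t = 0" by (simp add: S_def)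
  then show ?thesis using t(2) f by (simp add: lessThan_Suc_atMost[symmetric])
qed

lemma horner_seq_0: "horner_seq (\<lambda>_. 0) l j = l ^ j"
  by (induction j) auto

lemma companion_eigenvalue:
  fixes f :: "'a :: field poly"
  assumes "lead_coeff f = 1" "0 < degree f" "eigenvalue (companion p f) l"
  shows "poly f l = 0"
proof -
  have "injected_companion p f (\<lambda>_. 0) = companion p f"
    by (rule eq_matI) (auto simp: injected_companion_def companion_def)
  then show ?thesis
    using injected_companion_eigenvalue[of f p "\<lambda>_. 0" l] assms
    by (simp add: horner_seq_0 poly_altdef)
qed

text \<open>The output injection gains are the coefficients of the power series
  \<open>1 / (z\<^sup>n f(1/z))\<close>; this makes the closed loop characteristic polynomial \<open>z\<^sup>n\<close>.\<close>

definition deadbeat_gain :: "'a :: field poly \<Rightarrow> nat \<Rightarrow> 'a" where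
  "deadbeat_gain f i = fps_nth (inverse (fps_of_poly (reflect_poly f))) (Suc i)"

text \<open>The assumption \<open>conv\<close> says that the series \<open>c\<close> inverts the
  reversed polynomial up to the order \<open>degree f\<close>. Since \<open>horner_seq h l j\<close>
  is the sum of the \<open>c i * l ^ (j - i)\<close>, collecting equal powers of \<open>l\<close>
  produces this convolution, and only its term for \<open>m = 0\<close> survives.\<close>

lemma horner_seq_convolution:
  fixes f :: "'a :: field poly"
  assumes f: "lead_coeff f = 1" and h: "\<And>i. h i = c (Suc i)"
    and conv: "\<And>m. m \<le> degree f \<Longrightarrow>
      (\<Sum>i\<le>m. c i * coeff f (degree f - (m - i))) = (if m = 0 then 1 else 0)"
  shows "(\<Sum>j\<le>degree f. coeff f j * horner_seq h l j) = l ^ degree f"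
proof -
  let ?n = "degree f"
  have c0: "c 0 = 1" using conv[of 0] f by simp
  have r: "horner_seq h l j = (\<Sum>i\<le>j. c i * l ^ (j - i))" for j
  proof (induction j)
    case (Suc j)
    have "(\<Sum>i\<le>j. c i * l ^ (Suc j - i)) = l * (\<Sum>i\<le>j. c i * l ^ (j - i))"
      unfolding sum_distrib_left by (intro sum.cong) (auto simp: Suc_diff_le)
    then show ?case using Suc by (simp add: h)
  qed (simp add: c0)
  have "(\<Sum>j\<le>?n. coeff f j * horner_seq h l j)
      = (\<Sum>j\<le>?n. \<Sum>i\<le>j. coeff f j * c i * l ^ (j - i))"
    by (simp add: r sum_distrib_left mult.assoc)
  also have "\<dots> = (\<Sum>j\<in>{..?n}. \<Sum>i\<in>{i \<in> {..?n}. i \<le> j}. coeff f j * c i * l ^ (j - i))"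
    by (intro sum.cong) auto
  also have "\<dots> = (\<Sum>i\<in>{..?n}. \<Sum>j\<in>{j \<in> {..?n}. i \<le> j}. coeff f j * c i * l ^ (j - i))"
    by (rule sum.swap_restrict) auto
  also have "\<dots> = (\<Sum>i\<in>{..?n}. \<Sum>m\<in>{m \<in> {..?n}. i \<le> m}. c i * coeff f (?n - (m - i)) * l ^ (?n - m))"
  proof (rule sum.cong[OF refl])
    fix i assume "i \<in> {..?n}"
    then show "(\<Sum>j\<in>{j \<in> {..?n}. i \<le> j}. coeff f j * c i * l ^ (j - i))
      = (\<Sum>m\<in>{m \<in> {..?n}. i \<le> m}. c i * coeff f (?n - (m - i)) * l ^ (?n - m))"
      \<comment> \<open>The substitution \<open>m = ?n + i - j\<close> turns the exponent
        \<open>j - i\<close> into \<open>?n - m\<close>, which is independent of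
        \<open>i\<close>.\<close>
      by (intro sum.reindex_bij_witness[of _ "\<lambda>m. ?n + i - m" "\<lambda>j. ?n + i - j"])
        (auto simp: mult_ac)
  qed
  also have "\<dots> = (\<Sum>m\<in>{..?n}. \<Sum>i\<in>{i \<in> {..?n}. i \<le> m}. c i * coeff f (?n - (m - i)) * l ^ (?n - m))"
    by (rule sum.swap_restrict) auto
  also have "\<dots> = (\<Sum>m\<le>?n. (\<Sum>i\<le>m. c i * coeff f (?n - (m - i))) * l ^ (?n - m))"
    unfolding sum_distrib_right by (intro sum.cong) auto
  also have "\<dots> = (\<Sum>m\<le>?n. if m = 0 then l ^ ?n else 0)"
    using conv by (intro sum.cong) auto
  finally show ?thesis by simp
qed

text \<open>Reversing \<open>f\<close> moves its leading coefficient 1 into the constant term, so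
  the series is invertible and the sum is a coefficient of \<open>inverse F * F = 1\<close>.\<close>

lemma deadbeat_gain_convolution:
  fixes f :: "'a :: field poly"
  assumes f: "lead_coeff f = 1" and m: "m \<le> degree f"
  shows "(\<Sum>i\<le>m. fps_nth (inverse (fps_of_poly (reflect_poly f))) i * coeff f (degree f - (m - i)))
    = (if m = 0 then 1 else 0)"
proof -
  define F where "F = fps_of_poly (reflect_poly f)"
  have "fps_nth F 0 = 1" using f by (simp add: F_def)
  then have "inverse F * F = 1" by (intro inverse_mult_eq_1) auto
  then have "(\<Sum>i=0..m. fps_nth (inverse F) i * fps_nth F (m - i)) = (if m = 0 then 1 else 0)"
    unfolding fps_mult_nth[symmetric] by simp
  moreover have "fps_nth F (m - i) = coeff f (degree f - (m - i))" if "i \<le> m" for i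
    using that m by (simp add: F_def coeff_reflect_poly)
  ultimately show ?thesis by (simp add: atLeast0AtMost F_def)
qed

text \<open>Chosen to cancel the last block row: the closed loop is the companion matrix of
  \<open>z\<close> to the power \<open>degree f\<close>, for which 0 is the only possible
  eigenvalue.\<close>

definition companion_feedback :: "nat \<Rightarrow> 'a :: comm_ring_1 poly \<Rightarrow> 'a mat" where
  "companion_feedback p f = mat p (degree f * p)
     (\<lambda>(t, j). if j mod p = t then - coeff f (j div p) else 0)"

definition companion_injection :: "nat \<Rightarrow> 'a :: field poly \<Rightarrow> 'a mat" where
  "companion_injection p f = mat (degree f * p) p
     (\<lambda>(i, t). if t = i mod p then deadbeat_gain f (i div p) else 0)"

lemma companion_gain_carrier [simp]:
  "companion_feedback p f \<in> carrier_mat p (degree f * p)"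
  "companion_injection p f \<in> carrier_mat (degree f * p) p"
  by (auto simp: companion_feedback_def companion_injection_def)

lemma companion_gain_dims [simp]:
  "dim_row (companion_feedback p f) = p" "dim_col (companion_feedback p f) = degree f * p"
  "dim_row (companion_injection p f) = degree f * p" "dim_col (companion_injection p f) = p"
  by (auto simp: companion_feedback_def companion_injection_def)

lemma map_mat_companion:
  fixes f :: "real poly"
  shows "map_mat complex_of_real (companion p f) = companion p (map_poly complex_of_real f)"
    and "map_mat complex_of_real (injected_companion p f h)
      = injected_companion p (map_poly complex_of_real f) (\<lambda>i. complex_of_real (h i))"
  by (intro eq_matI; force simp: companion_def injected_companion_def coeff_map_poly)+

lemma schur_stable_companion_feedback:
  assumes f: "lead_coeff f = 1" and n: "0 < degree f"
  shows "schur_stable (companion p f - companion_in p (degree f) * companion_feedback p f)"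
proof -
  let ?n = "degree f"
  have deg: "degree (monom (1 :: real) ?n) = ?n" by (simp add: degree_monom_eq)
  have "companion p f - companion_in p ?n * companion_feedback p f = companion p (monom 1 ?n)"
  proof (rule eq_matI)
    fix i j assume "i < dim_row (companion p (monom (1 :: real) ?n))"
      "j < dim_col (companion p (monom (1 :: real) ?n))"
    then have ij: "i < ?n * p" "j < ?n * p" by (simp_all add: companion_def deg)
    note b = block_index[OF ij(1)] and bj = block_index[OF ij(2)]
    have "(companion_in p ?n * companion_feedback p f) $$ (i, j)
      = (\<Sum>t<p. if t = i mod p then (if i + p < ?n * p then 0 else
          if j mod p = t then - coeff f (j div p) else 0) else 0)"
      unfolding index_mult_mat_sum[OF companion_carrier(2) companion_gain_carrier(1) ij]
      using ij by (intro sum.cong) (auto simp: companion_in_def companion_feedback_def)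
    also have "\<dots> = (if i + p < ?n * p then 0 else if j mod p = i mod p then - coeff f (j div p) else 0)"
      using b(1) by simp
    finally show "(companion p f - companion_in p ?n * companion_feedback p f) $$ (i, j)
        = companion p (monom 1 ?n) $$ (i, j)"
      using ij bj(2) by (subst index_minus_mat(1)) (simp_all add: companion_def deg del: index_mult_mat(1))
  qed (auto simp: companion_def deg companion_in_def companion_feedback_def)
  moreover have "schur_stable (companion p (monom (1 :: real) ?n))"
    unfolding schur_stable_def map_mat_companion
  proof (intro conjI allI impI)
    fix l assume l: "eigenvalue (companion p (map_poly complex_of_real (monom 1 ?n))) l"
    have "map_poly complex_of_real (monom 1 ?n) = monom 1 ?n"
      by (simp add: map_poly_monom)
    with companion_eigenvalue[OF _ _ l] n show "cmod l < 1"
      by (simp add: degree_monom_eq poly_monom)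
  qed (simp add: companion_def)
  ultimately show ?thesis by simp
qed

lemma schur_stable_companion_injection:
  fixes f :: "real poly"
  assumes f: "lead_coeff f = 1" and n: "0 < degree f"
  shows "schur_stable (companion p f - companion_injection p f * companion_out p (degree f))"
proof -
  let ?n = "degree f" and ?f = "map_poly complex_of_real f"
  have "companion p f - companion_injection p f * companion_out p ?n
      = injected_companion p f (deadbeat_gain f)"
  proof (rule eq_matI)
    fix i j assume "i < dim_row (injected_companion p f (deadbeat_gain f))"
      "j < dim_col (injected_companion p f (deadbeat_gain f))"
    then have ij: "i < ?n * p" "j < ?n * p" by (simp_all add: injected_companion_def)
    note b = block_index[OF ij(1)]
    have "(companion_injection p f * companion_out p ?n) $$ (i, j)
      = (\<Sum>t<p. if t = i mod p then (if j = t then deadbeat_gain f (i div p) else 0) else 0)"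
      unfolding index_mult_mat_sum[OF companion_gain_carrier(2) companion_carrier(3) ij]
      using ij by (intro sum.cong) (auto simp: companion_injection_def companion_out_def)
    also have "\<dots> = (if j = i mod p then deadbeat_gain f (i div p) else 0)"
      using b(1) by simp
    finally show "(companion p f - companion_injection p f * companion_out p ?n) $$ (i, j)
        = injected_companion p f (deadbeat_gain f) $$ (i, j)"
      using ij by (subst index_minus_mat(1)) (simp_all add: injected_companion_def del: index_mult_mat(1))
  qed (auto simp: injected_companion_def companion_injection_def companion_out_def)
  moreover have "schur_stable (injected_companion p f (deadbeat_gain f))"
    unfolding schur_stable_def map_mat_companion
  proof (intro conjI allI impI)
    fix l assume l: "eigenvalue (injected_companion p ?f (\<lambda>i. complex_of_real (deadbeat_gain f i))) l"
    have deg: "degree ?f = ?n" and lc: "lead_coeff ?f = 1" using f by (simp_all add: coeff_map_poly)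
    \<comment> \<open>The gains are real while \<open>l\<close> is complex; the convolution identity
      is transported through \<open>of_real\<close> instead of being rederived for
      \<open>?f\<close>.\<close>
    define c where "c i = complex_of_real (fps_nth (inverse (fps_of_poly (reflect_poly f))) i)" for i
    have "(\<Sum>i\<le>m. c i * coeff ?f (degree ?f - (m - i))) = (if m = 0 then 1 else 0)"
      if "m \<le> degree ?f" for m
    proof -
      have "(\<Sum>i\<le>m. c i * coeff ?f (degree ?f - (m - i)))
        = complex_of_real (if m = 0 then 1 else 0)"
        using deadbeat_gain_convolution[OF f, of m, symmetric] that
        by (simp only: deg) (simp add: c_def coeff_map_poly)
      then show ?thesis by simp
    qed
    from horner_seq_convolution[OF lc _ this] have
      "(\<Sum>j\<le>degree ?f. coeff ?f j * horner_seq (\<lambda>i. complex_of_real (deadbeat_gain f i)) l j)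
        = l ^ degree ?f"
      by (simp add: deadbeat_gain_def c_def)
    then have "l ^ degree ?f = 0" using injected_companion_eigenvalue[OF lc _ l] n deg by simp
    then show "cmod l < 1" by simp
  qed (simp add: injected_companion_def)
  ultimately show ?thesis by simp
qed

section \<open>Right inverses over the polynomials\<close>

lemma common_denominator:
  fixes S :: "'a :: idom fract set"
  assumes "finite S"
  shows "\<exists>g. g \<noteq> 0 \<and> (\<forall>x\<in>S. \<exists>q. Fraction_Field.Fract g 1 * x = Fraction_Field.Fract q 1)"
  using assms
proof (induction S)
  case empty
  show ?case by (intro exI[of _ 1]) auto
next
  case (insert x S)
  then obtain g where g: "g \<noteq> 0" "\<And>x. x \<in> S \<Longrightarrow> \<exists>q. Fraction_Field.Fract g 1 * x = Fraction_Field.Fract q 1"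
    by blast
  obtain a b where ab: "x = Fraction_Field.Fract a b" "b \<noteq> 0" by (cases x) auto
  have "\<exists>q. Fraction_Field.Fract (b * g) 1 * s = Fraction_Field.Fract q 1" if "s \<in> insert x S" for s
  proof (cases "s = x")
    case True
    have "Fraction_Field.Fract (b * g) 1 * x = Fraction_Field.Fract (g * a) 1"
      using ab by (simp add: eq_fract)
    then show ?thesis using True by blast
  next
    case False
    then obtain q where q: "Fraction_Field.Fract g 1 * s = Fraction_Field.Fract q 1" using g(2) \<open>s \<in> insert x S\<close> by blast
    have "Fraction_Field.Fract (b * g) 1 * s = Fraction_Field.Fract b 1 * (Fraction_Field.Fract g 1 * s)"
      by (simp flip: mult.assoc)
    then show ?thesis unfolding q by auto
  qed
  then show ?case using g(1) ab(2) by (intro exI[of _ "b * g"]) auto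
qed

lemma fract_mat_mult:
  assumes "P \<in> carrier_mat m n" "Q \<in> carrier_mat n l"
  shows "fract_mat (P * Q) = fract_mat P * fract_mat Q"
proof -
  interpret comm_ring_hom "\<lambda>q :: real poly. Fraction_Field.Fract q 1"
    by unfold_locales (auto simp: One_fract_def Zero_fract_def)
  show ?thesis by (rule mat_hom_mult[OF assms])
qed

text \<open>The right inverse of the transfer function is rational. Multiplication by a common
  denominator makes it polynomial and produces \<open>g\<close>; the factor
  \<open>char_poly A\<close> is the denominator of the transfer function itself.\<close>

lemma right_invertible_polynomial:
  fixes A B C :: "real mat"
  assumes A: "A \<in> carrier_mat n n" and B: "B \<in> carrier_mat n m" and C: "C \<in> carrier_mat p n"
    and ri: "right_invertible C A B"
  obtains N g where "N \<in> carrier_mat m p" "lead_coeff g = 1"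
    "const_mat C * (adj_mat (char_poly_matrix A) * (const_mat B * N)) = (char_poly A * g) \<cdot>\<^sub>m 1\<^sub>m p"
proof -
  let ?\<phi> = "char_poly A"
  define T where "T = const_mat C * adj_mat (char_poly_matrix A) * const_mat B"
  note adj = adj_mat(1)[OF char_poly_matrix_closed[OF A]]
  have cB: "const_mat B \<in> carrier_mat n m" and cC: "const_mat C \<in> carrier_mat p n" using B C by auto
  have T: "T \<in> carrier_mat p m" unfolding T_def using adj cB cC by auto
  have "dim_col B = m" "dim_row C = p" using B C by auto
  from ri[unfolded right_invertible_def transfer_function_def this, folded T_def]
  obtain R where R: "R \<in> carrier_mat m p"
    and TR: "(Fraction_Field.Fract 1 ?\<phi> \<cdot>\<^sub>m fract_mat T) * R = 1\<^sub>m p" by blast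
  have \<phi>0: "?\<phi> \<noteq> 0" using degree_monic_char_poly[OF A] by auto
  have "finite ((\<lambda>ij. R $$ ij) ` ({..<m} \<times> {..<p}))" by auto
  from common_denominator[OF this] obtain g0 where g0: "g0 \<noteq> 0"
    and "\<forall>x\<in>(\<lambda>ij. R $$ ij) ` ({..<m} \<times> {..<p}). \<exists>q. Fraction_Field.Fract g0 1 * x = Fraction_Field.Fract q 1" by blast
  then have "\<forall>ij\<in>{..<m} \<times> {..<p}. \<exists>q. Fraction_Field.Fract g0 1 * R $$ ij = Fraction_Field.Fract q 1" by blast
  from bchoice[OF this] obtain q where q: "\<And>i j. i < m \<Longrightarrow> j < p \<Longrightarrow>
      Fraction_Field.Fract g0 1 * R $$ (i, j) = Fraction_Field.Fract (q (i, j)) 1"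
    by auto
  define N0 where "N0 = mat m p q"
  have N0: "N0 \<in> carrier_mat m p" by (simp add: N0_def)
  have fN0: "fract_mat N0 = Fraction_Field.Fract g0 1 \<cdot>\<^sub>m R"
    using R q by (intro eq_matI) (auto simp: N0_def)
  have fT: "fract_mat T \<in> carrier_mat p m" using T by simp
  have "fract_mat T * R = Fraction_Field.Fract ?\<phi> 1 \<cdot>\<^sub>m ((Fraction_Field.Fract 1 ?\<phi> \<cdot>\<^sub>m fract_mat T) * R)"
  proof -
    have "Fraction_Field.Fract ?\<phi> 1 * Fraction_Field.Fract 1 ?\<phi> = 1" using \<phi>0 by (simp add: One_fract_def eq_fract)
    then have "Fraction_Field.Fract ?\<phi> 1 \<cdot>\<^sub>m (Fraction_Field.Fract 1 ?\<phi> \<cdot>\<^sub>m (fract_mat T * R)) = fract_mat T * R"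
      by (intro eq_matI) (auto simp flip: mult.assoc)
    then show ?thesis using mult_smult_assoc_mat[OF fT R] by simp
  qed
  then have TR': "fract_mat T * R = Fraction_Field.Fract ?\<phi> 1 \<cdot>\<^sub>m 1\<^sub>m p" unfolding TR .
  have "fract_mat (T * N0) = Fraction_Field.Fract g0 1 \<cdot>\<^sub>m (fract_mat T * R)"
    unfolding fract_mat_mult[OF T N0] fN0 by (rule mult_smult_distrib[OF fT R])
  then have *: "fract_mat (T * N0) = Fraction_Field.Fract g0 1 \<cdot>\<^sub>m (Fraction_Field.Fract ?\<phi> 1 \<cdot>\<^sub>m 1\<^sub>m p)"
    unfolding TR' .
  have TN0: "T * N0 = (?\<phi> * g0) \<cdot>\<^sub>m 1\<^sub>m p"
  proof (rule eq_matI)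
    fix i j assume "i < dim_row ((?\<phi> * g0) \<cdot>\<^sub>m 1\<^sub>m p)" "j < dim_col ((?\<phi> * g0) \<cdot>\<^sub>m 1\<^sub>m p)"
    then have ij: "i < p" "j < p" by auto
    have "fract_mat (T * N0) $$ (i, j) = Fraction_Field.Fract ((T * N0) $$ (i, j)) 1"
      using ij T N0 by (subst index_map_mat) auto
    then have "Fraction_Field.Fract ((T * N0) $$ (i, j)) 1 = Fraction_Field.Fract (((?\<phi> * g0) \<cdot>\<^sub>m 1\<^sub>m p) $$ (i, j)) 1"
      using ij unfolding * by (cases "i = j") (simp_all add: mult.commute eq_fract Zero_fract_def)
    then show "(T * N0) $$ (i, j) = ((?\<phi> * g0) \<cdot>\<^sub>m 1\<^sub>m p) $$ (i, j)" by (simp add: eq_fract)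
  qed (use T N0 in auto)
  \<comment> \<open>Rescaling makes \<open>g\<close> monic, so that
    \<open>\<psi> * (char_poly A * g)\<close> is monic and can be realized by a block companion
    matrix.\<close>
  define c where "c = inverse (lead_coeff g0)"
  define N where "N = [:c:] \<cdot>\<^sub>m N0"
  have N: "N \<in> carrier_mat m p" using N0 by (simp add: N_def)
  have "T * N = ([:c:] * (?\<phi> * g0)) \<cdot>\<^sub>m 1\<^sub>m p"
    unfolding N_def mult_smult_distrib[OF T N0] TN0 by (intro eq_matI) auto
  moreover have "T * N = const_mat C * (adj_mat (char_poly_matrix A) * (const_mat B * N))"
    unfolding T_def assoc_mult_mat[OF mult_carrier_mat[OF cC adj] cB N]
    by (rule assoc_mult_mat[OF cC adj mult_carrier_mat[OF cB N]])
  ultimately show ?thesis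
    using that[of N "Polynomial.smult c g0"] N g0 by (simp add: c_def)
qed

section \<open>Pre-compensators\<close>

text \<open>Compared with \<open>precompensator\<close>, the disturbance only has to tend to zero,
  and \<open>xh\<close> and \<open>\<rho>\<close> may depend on the input. Convergence concerns one
  fixed run, so this is enough, and it covers both given and constructed compensators.\<close>

definition asymptotic_precompensator ::
  "nat \<Rightarrow> real mat \<Rightarrow> real mat \<Rightarrow> real mat \<Rightarrow> agent \<Rightarrow> precomp \<Rightarrow> bool" where
  "asymptotic_precompensator p Ct At Bt ag h \<longleftrightarrow> precomp_dims p ag h \<and>
     (\<forall>v x pc u z y. (\<forall>k. v k \<in> carrier_vec p) \<longrightarrow> agent_run ag x u z y \<longrightarrow> precomp_run h pc z v u \<longrightarrow>
        (\<exists>xh \<rho>. (\<forall>k. xh k \<in> carrier_vec (dim_row At)) \<and> vec_null p \<rho> \<and>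
           (\<forall>k. xh (Suc k) = At *\<^sub>v xh k + Bt *\<^sub>v (v k + \<rho> k)) \<and>
           (\<forall>k. y (int k) = Ct *\<^sub>v xh k)))"

lemma precompensator_asymptotic:
  assumes pre: "precompensator p Ct At Bt ag h"
    and Bt: "Bt \<in> carrier_mat (dim_row At) p"
  shows "asymptotic_precompensator p Ct At Bt ag h"
  unfolding asymptotic_precompensator_def
proof (intro conjI allI impI)
  from pre show "precomp_dims p ag h" by (simp add: precompensator_def)
  \<comment> \<open>\<open>G\<close> hides the innermost quantifiers, so that the initial data are
    obtained before a run is instantiated.\<close>
  define G where "G As Cs x0 pc0 xh0 \<omega>0 \<longleftrightarrow>
          (\<forall>v x pc u z y. (\<forall>k. v k \<in> carrier_vec p) \<longrightarrow> x 0 = x0 \<longrightarrow> pc 0 = pc0 \<longrightarrow>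
            agent_run ag x u z y \<longrightarrow> precomp_run h pc z v u \<longrightarrow>
            (\<exists>xh \<omega> :: nat \<Rightarrow> real vec. xh 0 = xh0 \<and> \<omega> 0 = \<omega>0 \<and>
               (\<forall>k. \<omega> (Suc k) = As *\<^sub>v \<omega> k) \<and>
               (\<forall>k. xh (Suc k) = At *\<^sub>v xh k + Bt *\<^sub>v (v k + Cs *\<^sub>v \<omega> k)) \<and>
               (\<forall>k. y (int k) = Ct *\<^sub>v xh k)))" for As Cs x0 pc0 xh0 \<omega>0
  from pre obtain As Cs where As: "schur_stable As" "Cs \<in> carrier_mat p (dim_row As)"
    and run: "\<forall>x0 \<in> carrier_vec (dim_row (Aa ag)). \<forall>pc0 \<in> carrier_vec (dim_row (Ah h)).
        \<exists>xh0 \<in> carrier_vec (dim_row At). \<exists>\<omega>0 \<in> carrier_vec (dim_row As). G As Cs x0 pc0 xh0 \<omega>0"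
    unfolding precompensator_def by (elim conjE exE) (rule that, assumption+, unfold G_def, assumption)
  fix v pc z :: "nat \<Rightarrow> real vec" and x u y
  assume v: "\<forall>k. v k \<in> carrier_vec p" and ar: "agent_run ag x u z y" and pr: "precomp_run h pc z v u"
  have x0: "x 0 \<in> carrier_vec (dim_row (Aa ag))" and pc0: "pc 0 \<in> carrier_vec (dim_row (Ah h))"
    using ar pr by (auto simp: agent_run_def precomp_run_def)
  from bspec[OF bspec[OF run x0] pc0] obtain xh0 \<omega>0 where xh0: "xh0 \<in> carrier_vec (dim_row At)"
    and \<omega>0: "\<omega>0 \<in> carrier_vec (dim_row As)" and G: "G As Cs (x 0) (pc 0) xh0 \<omega>0" by blast
  from G[unfolded G_def, THEN spec[of _ v], THEN spec[of _ x], THEN spec[of _ pc], THEN spec[of _ u],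
      THEN spec[of _ z], THEN spec[of _ y], THEN mp, OF v, THEN mp, OF refl, THEN mp, OF refl,
      THEN mp, OF ar, THEN mp, OF pr]
  obtain xh \<omega> where init: "xh 0 = xh0" "\<omega> 0 = \<omega>0" and \<omega>: "\<forall>k. \<omega> (Suc k) = As *\<^sub>v \<omega> k"
    and xh: "\<forall>k. xh (Suc k) = At *\<^sub>v xh k + Bt *\<^sub>v (v k + Cs *\<^sub>v \<omega> k)"
    and y: "\<forall>k. y (int k) = Ct *\<^sub>v xh k" by (elim exE conjE) (rule that; assumption)
  note \<omega> = \<omega>[rule_format] and xh = xh[rule_format] and y = y[rule_format]
  obtain ns where ns: "dim_row As = ns" by blast
  have Asq: "As \<in> carrier_mat ns ns" using As(1) ns by (auto simp: schur_stable_def)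
  have \<omega>c: "\<omega> k \<in> carrier_vec ns" for k
    using \<omega>0 Asq unfolding init(2)[symmetric] ns by (cases k) (auto simp: \<omega> intro!: carrier_vecI)
  have "vec_null ns \<omega>"
    by (rule schur_recurrence_null[OF Asq As(1) \<omega>c vec_null_zero, of 0]) (use \<omega> \<omega>c Asq in auto)
  then have "vec_null p (\<lambda>k. Cs *\<^sub>v \<omega> k)" by (rule vec_null_mult_mat[OF As(2)[unfolded ns]])
  moreover have "xh k \<in> carrier_vec (dim_row At)" for k
    using xh0 Bt unfolding init(1)[symmetric] by (cases k) (auto simp: xh intro!: carrier_vecI)
  ultimately show "\<exists>xh \<rho>. (\<forall>k. xh k \<in> carrier_vec (dim_row At)) \<and> vec_null p \<rho> \<and>
           (\<forall>k. xh (Suc k) = At *\<^sub>v xh k + Bt *\<^sub>v (v k + \<rho> k)) \<and>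
           (\<forall>k. y (int k) = Ct *\<^sub>v xh k)"
    using xh y by (intro exI[of _ xh] exI[of _ "\<lambda>k. Cs *\<^sub>v \<omega> k"]) auto
qed

section \<open>Static readouts of stacked signals\<close>

definition append_cols :: "'a mat \<Rightarrow> 'a mat \<Rightarrow> 'a mat" where
  "append_cols A B = mat (dim_row A) (dim_col A + dim_col B)
     (\<lambda>(i, j). if j < dim_col A then A $$ (i, j) else B $$ (i, j - dim_col A))"

lemma append_cols_carrier:
  "A \<in> carrier_mat m n \<Longrightarrow> B \<in> carrier_mat m l \<Longrightarrow> append_cols A B \<in> carrier_mat m (n + l)"
  by (auto simp: append_cols_def)

lemma append_cols_mult_vec:
  fixes A B :: "'a :: comm_ring_1 mat"
  assumes A: "A \<in> carrier_mat m n" and B: "B \<in> carrier_mat m l"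
    and x: "x \<in> carrier_vec n" and y: "y \<in> carrier_vec l"
  shows "append_cols A B *\<^sub>v (x @\<^sub>v y) = A *\<^sub>v x + B *\<^sub>v y"
proof (rule eq_vecI)
  fix i assume "i < dim_vec (A *\<^sub>v x + B *\<^sub>v y)"
  then have i: "i < m" using B by simp
  have "row (append_cols A B) i = row A i @\<^sub>v row B i"
    using A B i by (intro eq_vecI) (auto simp: append_cols_def)
  then show "(append_cols A B *\<^sub>v (x @\<^sub>v y)) $ i = (A *\<^sub>v x + B *\<^sub>v y) $ i"
    using A B x y i scalar_prod_append[of "row A i" n "row B i" l x y]
    by (simp add: append_cols_def)
qed (use A B in \<open>simp add: append_cols_def\<close>)

lemma sum_blocks:
  fixes G :: "nat \<Rightarrow> 'a :: comm_monoid_add"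
  shows "(\<Sum>i<n * p. G i) = (\<Sum>t<p. \<Sum>j<n. G (j * p + t))"
proof -
  have "(\<Sum>i<n * p. G i) = (\<Sum>i<n * p. \<Sum>t<p. if i mod p = t then G i else 0)"
  proof (rule sum.cong[OF refl])
    fix i assume "i \<in> {..<n * p}"
    then have "i mod p < p" by (auto intro: block_index(1))
    then show "G i = (\<Sum>t<p. if i mod p = t then G i else 0)" by simp
  qed
  also have "\<dots> = (\<Sum>t<p. \<Sum>i<n * p. if i mod p = t then G i else 0)" by (rule sum.swap)
  also have "\<dots> = (\<Sum>t<p. \<Sum>j<n. G (j * p + t))"
    by (rule sum.cong[OF refl]) (simp add: sum_block_channel)
  finally show ?thesis .
qed

text \<open>Column block \<open>j\<close> holds the coefficients of \<open>z\<close> to the power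
  \<open>j\<close>. Applied to a chain of \<open>n\<close> successive values the matrix evaluates
  the polynomial operator, provided that all entries have degree below \<open>n\<close>.\<close>

definition coeff_mat :: "nat \<Rightarrow> 'a :: comm_ring_1 poly mat \<Rightarrow> 'a mat" where
  "coeff_mat n P = mat (dim_row P) (n * dim_col P)
     (\<lambda>(a, i). coeff (P $$ (a, i mod dim_col P)) (i div dim_col P))"

lemma coeff_mat_chain:
  assumes P: "P \<in> carrier_mat m p" and deg: "\<And>a t. a < m \<Longrightarrow> t < p \<Longrightarrow> degree (P $$ (a, t)) < n"
    and X: "X \<in> carrier_vec (n * p)" "\<And>j t. j < n \<Longrightarrow> t < p \<Longrightarrow> X $ (j * p + t) = q (k + j) $ t"
  shows "coeff_mat n P *\<^sub>v X = shift_mat P q k"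
proof (rule eq_vecI)
  fix a assume "a < dim_vec (shift_mat P q k)"
  then have a: "a < m" using P by (simp add: shift_mat_def)
  have c: "coeff_mat n P \<in> carrier_mat m (n * p)" using P by (simp add: coeff_mat_def)
  have "(coeff_mat n P *\<^sub>v X) $ a = (\<Sum>i<n * p. coeff (P $$ (a, i mod p)) (i div p) * X $ i)"
    unfolding index_mult_mat_vec_sum[OF c X(1) a]
    using P a by (intro sum.cong) (auto simp: coeff_mat_def)
  also have "\<dots> = (\<Sum>t<p. \<Sum>j<n. coeff (P $$ (a, t)) j * q (k + j) $ t)"
    unfolding sum_blocks using X(2) by (intro sum.cong) auto
  also have "\<dots> = (\<Sum>t<p. shift_poly (P $$ (a, t)) (\<lambda>k. q k $ t) k)"
    using deg[OF a] by (intro sum.cong refl shift_poly_lessThan[symmetric]) auto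
  also have "\<dots> = shift_mat P q k $ a" using P a by (simp add: shift_mat_def)
  finally show "(coeff_mat n P *\<^sub>v X) $ a = shift_mat P q k $ a" .
qed (use P in \<open>simp add: coeff_mat_def shift_mat_def\<close>)

lemma shift_mat_add:
  assumes "P \<in> carrier_mat m n" "Q \<in> carrier_mat m n"
  shows "shift_mat (P + Q) x k = shift_mat P x k + shift_mat Q x k"
  using assms by (intro eq_vecI) (auto simp: shift_mat_def shift_poly_add sum.distrib)

text \<open>The compensator consists of an observer \<open>ob\<close> of the agent state and of a chain storing
  \<open>q(k), q(k+1), \<dots>\<close>, where \<open>q\<close> solves \<open>\<psi> \<phi> g q = v\<close> with \<open>\<phi>\<close> the characteristic polynomial.
  The polynomial right inverse turns \<open>q\<close> into a state and input trajectory of the agent with output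
  \<open>\<phi> g q\<close>; the static stabilizing feedback is applied to the distance from this trajectory.
  Zeros of the agent outside the unit disc do no harm since only the output has to be controlled.\<close>

lemma asymptotic_precompensator_exists:
  assumes adm: "admissible_agent p ag"
  shows "\<exists>d. \<forall>\<psi>. lead_coeff \<psi> = 1 \<longrightarrow> d < degree \<psi> \<longrightarrow> (\<exists>h. asymptotic_precompensator p
    (companion_out p (degree \<psi>)) (companion p \<psi>) (companion_in p (degree \<psi>)) ag h)"
proof -
  define A B C Cz where "A = Aa ag" and "B = Ba ag" and "C = Ca ag" and "Cz = Cm ag"
  define n m r where "n = dim_row A" and "m = dim_col B" and "r = dim_row Cz"
  note defs = A_def B_def C_def Cz_def n_def m_def r_def
  have A: "A \<in> carrier_mat n n" and B: "B \<in> carrier_mat n m" and C: "C \<in> carrier_mat p n"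
    and Cz: "Cz \<in> carrier_mat r n"
    using adm by (auto simp: admissible_agent_def agent_dims_def defs)
  from adm obtain F L where F: "F \<in> carrier_mat m n" "schur_stable (A + B * F)"
    and L: "L \<in> carrier_mat n r" "schur_stable (A + L * Cz)"
    unfolding admissible_agent_def stabilizable_def detectable_def defs by blast
  have "right_invertible C A B" using adm by (simp add: admissible_agent_def defs)
  from right_invertible_polynomial[OF A B C this] obtain N g where N: "N \<in> carrier_mat m p"
    and g: "lead_coeff g = 1"
    and inv: "const_mat C * (adj_mat (char_poly_matrix A) * (const_mat B * N)) = (char_poly A * g) \<cdot>\<^sub>m 1\<^sub>m p"
    by blast
  let ?\<phi> = "char_poly A"
  note cpm = char_poly_matrix_closed[OF A] and adj = adj_mat[OF char_poly_matrix_closed[OF A]]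
  have cc: "const_mat B \<in> carrier_mat n m" "const_mat C \<in> carrier_mat p n"
    "const_mat (- F) \<in> carrier_mat m n"
    using B C F by auto
  \<comment> \<open>Applied to \<open>q\<close>, these give a state and an input of the agent:
    \<open>(zI - A) X = B U\<close>, because \<open>zI - A\<close> times its adjugate is
    \<open>?\<phi>\<close> times the identity.\<close>
  define X where "X = adj_mat (char_poly_matrix A) * (const_mat B * N)"
  define U where "U = ?\<phi> \<cdot>\<^sub>m N"
  have X: "X \<in> carrier_mat n p" and U: "U \<in> carrier_mat m p"
    unfolding X_def U_def using adj(1) cc N by auto
  \<comment> \<open>The feedforward part of the control law: \<open>u = us + F (ob - xs)\<close> is
    split into \<open>F ob\<close> and \<open>W\<close> applied to \<open>q\<close>.\<close>
  define W where "W = U + const_mat (- F) * X"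
  have W: "W \<in> carrier_mat m p" unfolding W_def using U X cc by auto
  have BU: "char_poly_matrix A * X = const_mat B * U"
  proof -
    have BN: "const_mat B * N \<in> carrier_mat n p" using cc(1) N by auto
    have "char_poly_matrix A * X = (?\<phi> \<cdot>\<^sub>m 1\<^sub>m n) * (const_mat B * N)"
      unfolding X_def assoc_mult_mat[OF cpm adj(1) BN, symmetric] adj(2) char_poly_def ..
    also have "\<dots> = ?\<phi> \<cdot>\<^sub>m (const_mat B * N)"
      by (simp add: mult_smult_assoc_mat[OF one_carrier_mat BN] left_mult_one_mat[OF BN])
    also have "\<dots> = const_mat B * U" unfolding U_def using mult_smult_distrib[OF cc(1) N] by simp
    finally show ?thesis .
  qed
  \<comment> \<open>The degree of \<open>W\<close> decides how many successive values of
    \<open>q\<close> the chain must hold. The bound is independent of \<psi>, so several agents can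
    later agree on one \<psi>.\<close>
  define d where "d = Max (insert 0 ((\<lambda>ij. degree (W $$ ij)) ` ({..<m} \<times> {..<p})))"
  have deg: "degree (W $$ (a, t)) \<le> d" if "a < m" "t < p" for a t
    unfolding d_def using that by (intro Max_ge) auto
  show ?thesis
  proof (intro exI[of _ d] allI impI)
    fix \<psi> :: "real poly" assume \<psi>: "lead_coeff \<psi> = 1" "d < degree \<psi>"
    define f where "f = \<psi> * (?\<phi> * g)"
    define l where "l = degree f"
    have f: "lead_coeff f = 1" using \<psi>(1) g degree_monic_char_poly[OF A] by (simp add: f_def lead_coeff_mult)
    then have "\<psi> \<noteq> 0" "?\<phi> * g \<noteq> 0" by (auto simp: f_def)
    then have "degree \<psi> \<le> l" by (simp add: l_def f_def degree_mult_eq)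
    then have dl: "d < l" "0 < l" using \<psi>(2) by auto
    let ?W = "coeff_mat l W"
    have W': "?W \<in> carrier_mat m (l * p)" using W by (simp add: coeff_mat_def)
    have comp: "companion p f \<in> carrier_mat (l * p) (l * p)" "companion_in p l \<in> carrier_mat (l * p) p"
      by (auto simp: l_def)
    \<comment> \<open>Inserting \<open>u = F ob + ?W Q\<close> into the observer
      \<open>ob(k+1) = A ob + B u + L (Cz ob - z)\<close> gives the first block row; the second is
      the chain driven by \<open>v\<close>.\<close>
    define h where "h = \<lparr> Ah = four_block_mat (A + B * F + L * Cz) (B * ?W) (0\<^sub>m (l * p) n) (companion p f),
      Bh = (- L) @\<^sub>r 0\<^sub>m (l * p) r, Ch = append_cols F ?W, Dh = 0\<^sub>m m p,
      Eh = 0\<^sub>m n p @\<^sub>r companion_in p l \<rparr>"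
    have ABL: "A + B * F + L * Cz \<in> carrier_mat n n" "B * ?W \<in> carrier_mat n (l * p)"
      using A B F L Cz W' by auto
    have Ah: "Ah h \<in> carrier_mat (n + l * p) (n + l * p)"
      using four_block_carrier_mat[OF ABL(1) comp(1)] by (simp add: h_def)
    have dims: "precomp_dims p ag h"
      using Ah L F W' comp unfolding precomp_dims_def Let_def
      by (auto simp: h_def defs[symmetric] l_def[symmetric] intro!: carrier_append_rows append_cols_carrier)
    show "\<exists>h. asymptotic_precompensator p (companion_out p (degree \<psi>)) (companion p \<psi>)
        (companion_in p (degree \<psi>)) ag h"
      unfolding asymptotic_precompensator_def
    proof (intro exI[of _ h] conjI allI impI dims)
      fix v pc z :: "nat \<Rightarrow> real vec" and x u y
      assume v: "\<forall>k. v k \<in> carrier_vec p" and ar: "agent_run ag x u z y" and pr: "precomp_run h pc z v u"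
      have x: "x (Suc k) = A *\<^sub>v x k + B *\<^sub>v u k" "z k = Cz *\<^sub>v x k" "y (int k) = C *\<^sub>v x k" for k
        using ar by (auto simp: agent_run_def defs)
      have xc: "x k \<in> carrier_vec n" for k
        using ar B by (cases k) (auto simp: agent_run_def x(1) defs intro!: carrier_vecI)
      define ob where "ob k = vec_first (pc k) n" for k
      define Q where "Q k = vec_last (pc k) (l * p)" for k
      have pc: "pc k \<in> carrier_vec (n + l * p)" for k
      proof (cases k)
        case 0
        then show ?thesis using pr Ah by (auto simp: precomp_run_def)
      next
        case (Suc k')
        have "Eh h \<in> carrier_mat (n + l * p) p" using comp by (auto simp: h_def)
        then show ?thesis using pr unfolding Suc precomp_run_def by (auto intro!: carrier_vecI)
      qed
      have obc: "ob k \<in> carrier_vec n" and Qc: "Q k \<in> carrier_vec (l * p)" for k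
        by (auto simp: ob_def Q_def)
      have split: "pc k = ob k @\<^sub>v Q k" for k using pc[of k] by (simp add: ob_def Q_def)
      have zc: "z k \<in> carrier_vec r" for k using x(2) Cz by (auto intro!: carrier_vecI)
      have vc: "v k \<in> carrier_vec p" for k using v by simp
      have step: "ob (Suc k) = (A + B * F + L * Cz) *\<^sub>v ob k + (B * ?W) *\<^sub>v Q k + - L *\<^sub>v z k"
        "Q (Suc k) = companion p f *\<^sub>v Q k + companion_in p l *\<^sub>v v k"
        "u k = F *\<^sub>v ob k + ?W *\<^sub>v Q k" for k
      proof -
        have alg: "(a @\<^sub>v (0\<^sub>v (l * p) + c)) + (b @\<^sub>v 0\<^sub>v (l * p)) + (0\<^sub>v n @\<^sub>v e) = (a + b) @\<^sub>v (c + e)"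
          if "a \<in> carrier_vec n" "b \<in> carrier_vec n" "c \<in> carrier_vec (l * p)" "e \<in> carrier_vec (l * p)"
          for a b c e :: "real vec" using that by (intro eq_vecI) auto
        have "Ah h *\<^sub>v pc k = ((A + B * F + L * Cz) *\<^sub>v ob k + (B * ?W) *\<^sub>v Q k) @\<^sub>v
            (0\<^sub>m (l * p) n *\<^sub>v ob k + companion p f *\<^sub>v Q k)"
          unfolding h_def precomp.simps split
          by (rule four_block_mat_mult_vec[OF ABL _ comp(1) obc Qc]) simp
        moreover have "Bh h *\<^sub>v z k = (- L *\<^sub>v z k) @\<^sub>v (0\<^sub>m (l * p) r *\<^sub>v z k)"
          unfolding h_def precomp.simps by (rule mat_mult_append[OF _ _ zc]) (use L in auto)
        moreover have "Eh h *\<^sub>v v k = (0\<^sub>m n p *\<^sub>v v k) @\<^sub>v (companion_in p l *\<^sub>v v k)"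
          unfolding h_def precomp.simps by (rule mat_mult_append[OF _ _ vc]) (use comp in auto)
        moreover have "pc (Suc k) = Ah h *\<^sub>v pc k + Bh h *\<^sub>v z k + Eh h *\<^sub>v v k"
          using pr by (simp add: precomp_run_def)
        ultimately have "ob (Suc k) @\<^sub>v Q (Suc k)
          = ((A + B * F + L * Cz) *\<^sub>v ob k + (B * ?W) *\<^sub>v Q k + - L *\<^sub>v z k) @\<^sub>v
            (companion p f *\<^sub>v Q k + companion_in p l *\<^sub>v v k)"
          unfolding split
          by (simp only: zero_mat_mult_vec obc Qc zc vc) (intro alg obc Qc zc vc add_carrier_vec mult_mat_vec_carrier[OF ABL(1)]
              mult_mat_vec_carrier[OF ABL(2)] mult_mat_vec_carrier[OF comp(1)]
              mult_mat_vec_carrier[OF comp(2)] mult_mat_vec_carrier[OF uminus_carrier_mat[OF L(1)]])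
        then show "ob (Suc k) = (A + B * F + L * Cz) *\<^sub>v ob k + (B * ?W) *\<^sub>v Q k + - L *\<^sub>v z k"
          "Q (Suc k) = companion p f *\<^sub>v Q k + companion_in p l *\<^sub>v v k"
          using obc[of "Suc k"] L by (subst (asm) append_vec_eq[of _ n]; auto intro!: carrier_vecI)+
        have "Ch h *\<^sub>v pc k = F *\<^sub>v ob k + ?W *\<^sub>v Q k"
          unfolding h_def precomp.simps split by (rule append_cols_mult_vec[OF F(1) W' obc Qc])
        moreover have "u k = Ch h *\<^sub>v pc k + Dh h *\<^sub>v v k" using pr by (simp add: precomp_run_def)
        ultimately show "u k = F *\<^sub>v ob k + ?W *\<^sub>v Q k"
          using F W' obc[of k] Qc[of k] by (simp add: h_def zero_mat_mult_vec[OF vc])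
      qed
      define q where "q k = vec p (\<lambda>t. Q k $ t)" for k
      have qc: "q k \<in> carrier_vec p" for k by (simp add: q_def)
      have Q_chain: "Q k $ (j * p + t) = q (k + j) $ t" if "j < l" "t < p" for j t k
        using companion_run_chain(1)[OF f, of Q p v t j k] Qc vc step(2) that dl(2)
        by (simp add: q_def l_def)
      have q_v: "shift_poly f (\<lambda>k. q k $ t) k = v k $ t" if "t < p" for t k
        using companion_run_chain(2)[OF f, of Q p v t k] Qc vc step(2) that dl(2)
        by (simp add: q_def l_def)
      define xs where "xs = shift_mat X q"
      define us where "us = shift_mat U q"
      have xsc: "xs k \<in> carrier_vec n" and usc: "us k \<in> carrier_vec m" for k
        unfolding xs_def us_def using X U by (auto intro: shift_mat_carrier)
      have WQ: "?W *\<^sub>v Q k = us k + - F *\<^sub>v xs k" for k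
      proof -
        have "?W *\<^sub>v Q k = shift_mat W q k"
          by (rule coeff_mat_chain[OF W _ Qc Q_chain]) (use deg dl(1) in fastforce)+
        also have "\<dots> = us k + shift_mat (const_mat (- F) * X) q k"
          unfolding W_def us_def using U X cc(3) by (intro shift_mat_add) auto
        also have "shift_mat (const_mat (- F) * X) q k = - F *\<^sub>v xs k"
          unfolding shift_mat_mult[OF cc(3) X] xs_def[symmetric]
          by (rule shift_mat_const[OF _ xsc]) (use F in auto)
        finally show ?thesis .
      qed
      have xs: "xs (Suc k) = A *\<^sub>v xs k + B *\<^sub>v us k" for k
      proof -
        have "xs (Suc k) - A *\<^sub>v xs k = shift_mat (char_poly_matrix A) xs k"
          using shift_mat_char_poly_matrix[OF A xsc] by simp
        also have "\<dots> = shift_mat (const_mat B * U) q k"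
          unfolding xs_def shift_mat_mult[OF cpm X, symmetric] BU ..
        also have "\<dots> = B *\<^sub>v us k"
          unfolding shift_mat_mult[OF cc(1) U] us_def[symmetric] by (rule shift_mat_const[OF B usc])
        finally have e: "xs (Suc k) - A *\<^sub>v xs k = B *\<^sub>v us k" .
        have "xs (Suc k) = A *\<^sub>v xs k + (xs (Suc k) - A *\<^sub>v xs k)"
          using xsc[of k] xsc[of "Suc k"] A by (intro eq_vecI) auto
        then show ?thesis unfolding e .
      qed
      have Cxs: "(C *\<^sub>v xs k) $ t = shift_poly (?\<phi> * g) (\<lambda>k. q k $ t) k" if "t < p" for t k
      proof -
        have "C *\<^sub>v xs k = shift_mat (const_mat C * X) q k"
          unfolding shift_mat_mult[OF cc(2) X] xs_def[symmetric] by (rule shift_mat_const[OF C xsc, symmetric])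
        then show ?thesis unfolding X_def inv using shift_mat_scalar[OF that, of "?\<phi> * g" q k] by simp
      qed
      \<comment> \<open>The observer error \<eta> evolves with \<open>A + L Cz\<close>; the distance
        \<delta> from the planned trajectory evolves with \<open>A + B F\<close> and is driven by
        \<eta>. Detectability through the local measurement and stabilizability enter here.\<close>
      define \<eta> where "\<eta> k = x k - ob k" for k
      define \<delta> where "\<delta> k = x k - xs k" for k
      have \<eta>c: "\<eta> k \<in> carrier_vec n" and \<delta>c: "\<delta> k \<in> carrier_vec n" for k
        using xc obc xsc by (auto simp: \<eta>_def \<delta>_def)
      have sq: "B * F \<in> carrier_mat n n" "L * Cz \<in> carrier_mat n n" "A + B * F \<in> carrier_mat n n"
        "A + L * Cz \<in> carrier_mat n n" "- L \<in> carrier_mat n r" "- F \<in> carrier_mat m n"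
        "B * - F \<in> carrier_mat n n" "- (B * F) \<in> carrier_mat n n"
        using A B F L Cz by auto
      have negm: "- M *\<^sub>v w = - (M *\<^sub>v w)" if "M \<in> carrier_mat i j" "w \<in> carrier_vec j" for M :: "real mat" and w i j
        using that by simp
      note cs = A[THEN mult_mat_vec_carrier] B[THEN mult_mat_vec_carrier] F(1)[THEN mult_mat_vec_carrier]
        L(1)[THEN mult_mat_vec_carrier] Cz[THEN mult_mat_vec_carrier] W'[THEN mult_mat_vec_carrier]
        C[THEN mult_mat_vec_carrier]
      note lin = A[THEN mult_minus_distrib_mat_vec] B[THEN mult_minus_distrib_mat_vec]
        F(1)[THEN mult_minus_distrib_mat_vec] L(1)[THEN mult_minus_distrib_mat_vec]
        Cz[THEN mult_minus_distrib_mat_vec] C[THEN mult_minus_distrib_mat_vec]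
        A[THEN mult_add_distrib_mat_vec] B[THEN mult_add_distrib_mat_vec]
        add_mult_distrib_mat_vec[OF sq(3,2)] add_mult_distrib_mat_vec[OF A sq(1)]
        add_mult_distrib_mat_vec[OF A sq(2)]
        assoc_mult_mat_vec[OF B F(1)] assoc_mult_mat_vec[OF L(1) Cz] assoc_mult_mat_vec[OF B W']
        negm[OF L(1)] negm[OF F(1)] negm[OF B] negm[OF sq(1)]
        add_carrier_vec minus_carrier_vec cs
      note carr = xc obc Qc xsc usc
      have "vec_null n \<eta>"
      proof (rule schur_recurrence_null[OF sq(4) L(2) \<eta>c vec_null_zero, of 0])
        fix k
        have alg: "a + b - (ao + bo + lo + bw + - lz) = a - ao + (lz - lo) + 0\<^sub>v n"
          if "b = bo + bw" "a \<in> carrier_vec n" "ao \<in> carrier_vec n" "bo \<in> carrier_vec n" "lo \<in> carrier_vec n"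
            "bw \<in> carrier_vec n" "lz \<in> carrier_vec n" for a b ao bo lo bw lz :: "real vec"
          using that by (intro eq_vecI) auto
        show "\<eta> (Suc k) = (A + L * Cz) *\<^sub>v \<eta> k + 0\<^sub>v n"
          unfolding \<eta>_def x(1,2) step(1,3)
          by (simp only: lin carr) (intro alg refl lin carr)
      qed
      have "vec_null n \<delta>"
      proof (rule schur_recurrence_null[OF sq(3) F(2) \<delta>c, of "\<lambda>k. - (B * F) *\<^sub>v \<eta> k" 0])
        show "vec_null n (\<lambda>k. - (B * F) *\<^sub>v \<eta> k)" by (rule vec_null_mult_mat[OF sq(8) \<open>vec_null n \<eta>\<close>])
        fix k
        have alg: "F *\<^sub>v ob k + (us k + - (F *\<^sub>v xs k)) = us k + (F *\<^sub>v ob k - F *\<^sub>v xs k)"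
          using cs(3)[OF xsc[of k]] cs(3)[OF obc[of k]] usc[of k] by (intro eq_vecI) auto
        have alg2: "a + (b + (bo - bs)) - (s + b) = a - s + (bx - bs) + - (bx - bo)"
          if "a \<in> carrier_vec n" "b \<in> carrier_vec n" "bo \<in> carrier_vec n" "bs \<in> carrier_vec n"
            "bx \<in> carrier_vec n" "s \<in> carrier_vec n" for a b s bo bs bx :: "real vec"
          using that by (intro eq_vecI) auto
        show "\<delta> (Suc k) = (A + B * F) *\<^sub>v \<delta> k + - (B * F) *\<^sub>v \<eta> k"
          unfolding \<delta>_def \<eta>_def x(1) xs step(3) WQ negm[OF F(1) xsc] alg
          by (simp only: lin carr) (intro alg2 lin carr)
      qed
      then have C\<delta>: "vec_null p (\<lambda>k. C *\<^sub>v \<delta> k)" by (rule vec_null_mult_mat[OF C])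
      \<comment> \<open>A finite combination of shifts of a null sequence is null; here it is the
        amount by which \<open>\<psi> y\<close> differs from \<open>v\<close>.\<close>
      define \<rho> where "\<rho> k = vec p (\<lambda>t. shift_poly \<psi> (\<lambda>k. (C *\<^sub>v \<delta> k) $ t) k)" for k
      have \<rho>: "vec_null p \<rho>"
        unfolding vec_null_def \<rho>_def using shift_poly_null[OF vec_nullD(2)[OF C\<delta>]] by auto
      have \<rho>c: "v k + \<rho> k \<in> carrier_vec p" for k using vc by (simp add: \<rho>_def)
      have yc: "y (int k) \<in> carrier_vec p" for k unfolding x(3) using C by (auto intro!: carrier_vecI)
      have "shift_poly \<psi> (\<lambda>k. y (int k) $ t) k = (v k + \<rho> k) $ t" if t: "t < p" for t k
      proof -
        have "y (int k) $ t = shift_poly (?\<phi> * g) (\<lambda>k. q k $ t) k + (C *\<^sub>v \<delta> k) $ t" for k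
          unfolding x(3) Cxs[OF t, symmetric] \<delta>_def lin(6)[OF xc xsc]
          using C t by (subst index_minus_vec(1)) (simp_all del: index_mult_mat_vec)
        then have "shift_poly \<psi> (\<lambda>k. y (int k) $ t) k
          = shift_poly \<psi> (shift_poly (?\<phi> * g) (\<lambda>k. q k $ t)) k + \<rho> k $ t"
          using t by (simp add: shift_poly_seq_add \<rho>_def)
        also have "\<dots> = v k $ t + \<rho> k $ t"
          using q_v[OF t, of k] by (simp add: f_def flip: shift_poly_mult)
        finally show ?thesis using t by (simp add: \<rho>_def)
      qed
      note run = companion_run_stack[OF \<psi>(1) _ \<rho>c yc this]
      have "0 < degree \<psi>" using \<psi>(2) by simp
      from run[OF this] \<rho>
      show "\<exists>xh \<rho>. (\<forall>k. xh k \<in> carrier_vec (dim_row (companion p \<psi>))) \<and> vec_null p \<rho> \<and>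
           (\<forall>k. xh (Suc k) = companion p \<psi> *\<^sub>v xh k + companion_in p (degree \<psi>) *\<^sub>v (v k + \<rho> k)) \<and>
           (\<forall>k. y (int k) = companion_out p (degree \<psi>) *\<^sub>v xh k)"
        by (intro exI[of _ "stack p (degree \<psi>) (\<lambda>k. y (int k))"] exI[of _ \<rho>]) simp
    qed
  qed
qed

section \<open>The protocol\<close>

text \<open>The state of the protocol is the vector \<open>pc @ (xe @ \<chi>)\<close>.\<close>

definition design_protocol ::
  "nat \<Rightarrow> real mat \<Rightarrow> real mat \<Rightarrow> real mat \<Rightarrow> real mat \<Rightarrow> real mat \<Rightarrow> agent \<Rightarrow> precomp \<Rightarrow> protocol" where
  "design_protocol p Ct At Bt K H ag h =
     (let s = dim_row (Ah h); n = dim_row At; m = dim_col (Ba ag); q = dim_row (Cm ag) in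
      \<lparr> Ac = four_block_mat (Ah h) (append_cols (0\<^sub>m s n) (- (Eh h * K))) (0\<^sub>m (n + n) s)
               (four_block_mat (At - H * Ct) (0\<^sub>m n n) At (At - Bt * K)),
        Bc = 0\<^sub>m s p @\<^sub>r (H @\<^sub>r 0\<^sub>m n p),
        Cc = 0\<^sub>m s n @\<^sub>r (- (Bt * K) @\<^sub>r - At),
        Dc = Bh h @\<^sub>r 0\<^sub>m (n + n) q,
        Ec = append_cols (Ch h) (append_cols (0\<^sub>m m n) (- (Dh h * K))),
        Fc = 0\<^sub>m m p, Gc = 0\<^sub>m m n, Hc = 0\<^sub>m m q,
        Xc = append_cols (0\<^sub>m n s) (append_cols (0\<^sub>m n n) (1\<^sub>m n)) \<rparr>)"

lemma design_protocol_dims: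
  assumes c: "At \<in> carrier_mat n n" "Bt \<in> carrier_mat n p" "Ct \<in> carrier_mat p n"
      "K \<in> carrier_mat p n" "H \<in> carrier_mat n p"
    and h: "precomp_dims p ag h"
  shows "protocol_dims p n ag (design_protocol p Ct At Bt K H ag h)"
proof -
  define s m q where "s = dim_row (Ah h)" and "m = dim_col (Ba ag)" and "q = dim_row (Cm ag)"
  note smq = this
  have h': "Ah h \<in> carrier_mat s s" "Bh h \<in> carrier_mat s q" "Eh h \<in> carrier_mat s p"
    "Ch h \<in> carrier_mat m s" "Dh h \<in> carrier_mat m p"
    using h by (auto simp: precomp_dims_def Let_def smq)
  have n: "dim_row At = n" using c by auto
  show ?thesis unfolding protocol_dims_def design_protocol_def Let_def n protocol.simps smq[symmetric]
    using c h' by (auto intro!: carrier_append_rows append_cols_carrier four_block_carrier_mat)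
qed

lemma append_vec_carrier: "v \<in> carrier_vec m \<Longrightarrow> w \<in> carrier_vec n \<Longrightarrow> v @\<^sub>v w \<in> carrier_vec (m + n)"
  by (auto intro!: carrier_vecI)

text \<open>At nonnegative times \<xi> is the third component of the protocol state and before that
  it is arbitrary initial data, just what \<open>design_run\<close> asks of \<chi>; hence \<xi>
  itself takes the place of \<chi>.\<close>

lemma design_protocol_run:
  assumes c: "At \<in> carrier_mat n n" "Bt \<in> carrier_mat n p" "Ct \<in> carrier_mat p n"
      "K \<in> carrier_mat p n" "H \<in> carrier_mat n p"
    and h: "precomp_dims p ag h"
    and zb: "\<And>k. zb k \<in> carrier_vec p" and zh: "\<And>k. zh k \<in> carrier_vec n"
    and z: "\<And>k. z k \<in> carrier_vec (dim_row (Cm ag))"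
    and run: "protocol_run (design_protocol p Ct At Bt K H ag h) xc zb zh z u \<xi>"
  shows "\<exists>pc xe. design_run Ct At Bt K H h pc xe \<xi> zb zh z u"
proof -
  define s m q where "s = dim_row (Ah h)" and "m = dim_col (Ba ag)" and "q = dim_row (Cm ag)"
  let ?P = "design_protocol p Ct At Bt K H ag h"
  have h': "Ah h \<in> carrier_mat s s" "Bh h \<in> carrier_mat s q" "Eh h \<in> carrier_mat s p"
    "Ch h \<in> carrier_mat m s" "Dh h \<in> carrier_mat m p"
    using h by (auto simp: precomp_dims_def Let_def s_def m_def q_def)
  have n: "dim_row At = n" using c by auto
  note z = z[folded q_def]
  define A2 where "A2 = four_block_mat (At - H * Ct) (0\<^sub>m n n) At (At - Bt * K)"
  have P: "Ac ?P = four_block_mat (Ah h) (append_cols (0\<^sub>m s n) (- (Eh h * K))) (0\<^sub>m (n + n) s) A2"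
    "Bc ?P = 0\<^sub>m s p @\<^sub>r (H @\<^sub>r 0\<^sub>m n p)"
    "Cc ?P = 0\<^sub>m s n @\<^sub>r (- (Bt * K) @\<^sub>r - At)"
    "Dc ?P = Bh h @\<^sub>r 0\<^sub>m (n + n) q"
    "Ec ?P = append_cols (Ch h) (append_cols (0\<^sub>m m n) (- (Dh h * K)))"
    "Fc ?P = 0\<^sub>m m p" "Gc ?P = 0\<^sub>m m n" "Hc ?P = 0\<^sub>m m q"
    "Xc ?P = append_cols (0\<^sub>m n s) (append_cols (0\<^sub>m n n) (1\<^sub>m n))"
    by (simp_all add: design_protocol_def Let_def s_def m_def q_def n A2_def)
  have sq: "Eh h * K \<in> carrier_mat s n" "Dh h * K \<in> carrier_mat m n" "Bt * K \<in> carrier_mat n n"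
    "H * Ct \<in> carrier_mat n n" "At - H * Ct \<in> carrier_mat n n" "At - Bt * K \<in> carrier_mat n n"
    "- (Eh h * K) \<in> carrier_mat s n" "- (Dh h * K) \<in> carrier_mat m n" "- (Bt * K) \<in> carrier_mat n n"
    "- At \<in> carrier_mat n n"
    using c h' by auto
  have A2: "A2 \<in> carrier_mat (n + n) (n + n)" unfolding A2_def using sq by auto
  have XK: "append_cols (0\<^sub>m s n) (- (Eh h * K)) \<in> carrier_mat s (n + n)"
    "append_cols (0\<^sub>m m n) (- (Dh h * K)) \<in> carrier_mat m (n + n)"
    "append_cols (0\<^sub>m n n) (1\<^sub>m n :: real mat) \<in> carrier_mat n (n + n)"
    "(H @\<^sub>r 0\<^sub>m n p) \<in> carrier_mat (n + n) p" "(- (Bt * K) @\<^sub>r - At) \<in> carrier_mat (n + n) n"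
    using sq c by (auto intro!: append_cols_carrier carrier_append_rows)
  have Pc: "Ac ?P \<in> carrier_mat (s + (n + n)) (s + (n + n))" "Bc ?P \<in> carrier_mat (s + (n + n)) p"
    "Cc ?P \<in> carrier_mat (s + (n + n)) n" "Dc ?P \<in> carrier_mat (s + (n + n)) q"
    "Xc ?P \<in> carrier_mat n (s + (n + n))"
    unfolding P using h' A2 XK by (auto intro!: append_cols_carrier carrier_append_rows four_block_carrier_mat)
  from run have xc0: "xc 0 \<in> carrier_vec (s + (n + n))"
    and xc: "\<And>k. xc (Suc k) = Ac ?P *\<^sub>v xc k + Bc ?P *\<^sub>v zb k + Cc ?P *\<^sub>v zh k + Dc ?P *\<^sub>v z k"
    and u: "\<And>k. u k = Ec ?P *\<^sub>v xc k + Fc ?P *\<^sub>v zb k + Gc ?P *\<^sub>v zh k + Hc ?P *\<^sub>v z k"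
    and \<xi>: "\<And>k. \<xi> (int k) = Xc ?P *\<^sub>v xc k" and \<xi>c: "\<And>k. \<xi> k \<in> carrier_vec n"
    using Pc unfolding protocol_run_def by (auto simp only: carrier_matD)
  have xcc: "xc k \<in> carrier_vec (s + (n + n))" for k
    by (cases k) (use xc0 xc Pc(4) in \<open>auto intro!: carrier_vecI\<close>)
  define pc where "pc k = vec_first (xc k) s" for k
  define xe where "xe k = vec_first (vec_last (xc k) (n + n)) n" for k
  define \<chi> where "\<chi> k = vec_last (vec_last (xc k) (n + n)) n" for k
  have pcc: "pc k \<in> carrier_vec s" and xec: "xe k \<in> carrier_vec n" and \<chi>c: "\<chi> k \<in> carrier_vec n" for k
    by (auto simp: pc_def xe_def \<chi>_def)
  have split: "xc k = pc k @\<^sub>v (xe k @\<^sub>v \<chi> k)" for k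
    using xcc[of k] by (simp add: pc_def xe_def \<chi>_def)
  have x\<chi>c: "xe k @\<^sub>v \<chi> k \<in> carrier_vec (n + n)" for k by (rule append_vec_carrier[OF xec \<chi>c])
  have zero: "0\<^sub>m i j *\<^sub>v w = 0\<^sub>v i" if "w \<in> carrier_vec j" for i j and w :: "real vec" using that by (rule zero_mat_mult_vec)
  have \<xi>\<chi>: "\<xi> (int k) = \<chi> k" for k
  proof -
    have "\<xi> (int k) = 0\<^sub>m n s *\<^sub>v pc k + append_cols (0\<^sub>m n n) (1\<^sub>m n) *\<^sub>v (xe k @\<^sub>v \<chi> k)"
      unfolding \<xi> P split by (rule append_cols_mult_vec[OF _ XK(3) pcc x\<chi>c]) simp
    also have "append_cols (0\<^sub>m n n) (1\<^sub>m n) *\<^sub>v (xe k @\<^sub>v \<chi> k) = 0\<^sub>m n n *\<^sub>v xe k + 1\<^sub>m n *\<^sub>v \<chi> k"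
      by (rule append_cols_mult_vec[OF _ _ xec \<chi>c]) auto
    finally show ?thesis using \<chi>c[of k] by (simp add: zero_mat_mult_vec[OF pcc] zero_mat_mult_vec[OF xec])
  qed
  have neg: "- M *\<^sub>v w = - (M *\<^sub>v w)" if "M \<in> carrier_mat i j" "w \<in> carrier_vec j" for M :: "real mat" and w i j
    using that by simp
  have EK: "append_cols (0\<^sub>m i n) (- (E * K)) *\<^sub>v (xe k @\<^sub>v \<chi> k) = - (E *\<^sub>v (K *\<^sub>v \<chi> k))"
    if "E \<in> carrier_mat i p" for E i k
  proof -
    have "append_cols (0\<^sub>m i n) (- (E * K)) *\<^sub>v (xe k @\<^sub>v \<chi> k) = 0\<^sub>m i n *\<^sub>v xe k + - (E * K) *\<^sub>v \<chi> k"
      by (rule append_cols_mult_vec[OF _ _ xec \<chi>c]) (use that c in auto)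
    also have "- (E * K) *\<^sub>v \<chi> k = - (E *\<^sub>v (K *\<^sub>v \<chi> k))"
      using neg[OF mult_carrier_mat[OF that c(4)] \<chi>c] assoc_mult_mat_vec[OF that c(4) \<chi>c] by simp
    also have "0\<^sub>m i n *\<^sub>v xe k + - (E *\<^sub>v (K *\<^sub>v \<chi> k)) = - (E *\<^sub>v (K *\<^sub>v \<chi> k))"
      unfolding zero[OF xec] by (rule left_zero_vec) (use that in \<open>auto intro!: carrier_vecI\<close>)
    finally show ?thesis .
  qed
  have u': "u k = Ch h *\<^sub>v pc k - Dh h *\<^sub>v (K *\<^sub>v \<chi> k)" for k
  proof -
    have "Ec ?P *\<^sub>v xc k = Ch h *\<^sub>v pc k + - (Dh h *\<^sub>v (K *\<^sub>v \<chi> k))"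
      unfolding P split append_cols_mult_vec[OF h'(4) XK(2) pcc x\<chi>c] EK[OF h'(5)] ..
    then show ?thesis unfolding u P zero[OF zb] zero[OF zh] zero[OF z]
      using h' by (intro eq_vecI) (auto simp del: index_mult_mat_vec)
  qed
  define A2x where "A2x k = (At - H * Ct) *\<^sub>v xe k" for k
  have A2x: "A2x k = At *\<^sub>v xe k - H *\<^sub>v (Ct *\<^sub>v xe k)" for k
    unfolding A2x_def minus_mult_distrib_mat_vec[OF c(1) sq(4) xec] assoc_mult_mat_vec[OF c(5,3) xec] ..
  \<comment> \<open>The component equations are computed as one stacked equation first;
    \<open>append_vec_eq\<close> then separates them.\<close>
  have parts: "pc (Suc k) @\<^sub>v (xe (Suc k) @\<^sub>v \<chi> (Suc k))
    = (Ah h *\<^sub>v pc k - Eh h *\<^sub>v (K *\<^sub>v \<chi> k) + Bh h *\<^sub>v z k) @\<^sub>v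
      ((A2x k + H *\<^sub>v zb k - Bt *\<^sub>v (K *\<^sub>v zh k)) @\<^sub>v
       (At *\<^sub>v xe k + (At - Bt * K) *\<^sub>v \<chi> k - At *\<^sub>v zh k))" for k
  proof -
    have 1: "Ac ?P *\<^sub>v xc k = (Ah h *\<^sub>v pc k + - (Eh h *\<^sub>v (K *\<^sub>v \<chi> k))) @\<^sub>v
       (0\<^sub>v (n + n) + ((A2x k + 0\<^sub>v n) @\<^sub>v (At *\<^sub>v xe k + (At - Bt * K) *\<^sub>v \<chi> k)))"
      unfolding P split A2x_def
      by (subst four_block_mat_mult_vec[OF h'(1) XK(1) _ A2 pcc x\<chi>c], simp)
        (simp only: EK[OF h'(3)] zero[OF pcc] A2_def
          four_block_mat_mult_vec[OF sq(5) zero_carrier_mat c(1) sq(6) xec \<chi>c] zero[OF \<chi>c])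
    have 2: "Bc ?P *\<^sub>v zb k = 0\<^sub>v s @\<^sub>v (H *\<^sub>v zb k @\<^sub>v 0\<^sub>v n)"
      unfolding P mat_mult_append[OF zero_carrier_mat XK(4) zb]
        mat_mult_append[OF c(5) zero_carrier_mat zb] zero[OF zb] ..
    have 3: "Cc ?P *\<^sub>v zh k = 0\<^sub>v s @\<^sub>v (- (Bt *\<^sub>v (K *\<^sub>v zh k)) @\<^sub>v - (At *\<^sub>v zh k))"
      unfolding P mat_mult_append[OF zero_carrier_mat XK(5) zh] mat_mult_append[OF sq(9,10) zh]
        zero[OF zh] neg[OF sq(3) zh] neg[OF c(1) zh] assoc_mult_mat_vec[OF c(2,4) zh] ..
    have 4: "Dc ?P *\<^sub>v z k = Bh h *\<^sub>v z k @\<^sub>v (0\<^sub>v n @\<^sub>v 0\<^sub>v n)"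
      unfolding P mat_mult_append[OF h'(2) zero_carrier_mat z] zero[OF z] by (auto intro!: eq_vecI)
    have dims: "dim_vec (pc k) = s" "dim_vec (xe k) = n" "dim_vec (\<chi> k) = n" for k
      using pcc xec \<chi>c by (auto dest: carrier_vecD)
    have dm: "dim_row (Ah h) = s" "dim_row (Eh h) = s" "dim_row (Bh h) = s" "dim_row H = n" "dim_row Bt = n"
      "dim_row K = p" "dim_row At = n"
      using c h' by auto
    have dm2: "dim_vec (A2x k) = n" "dim_vec ((At - Bt * K) *\<^sub>v \<chi> k) = n" using sq c by (auto simp: A2x_def)
    have alg: "((a + - e) @\<^sub>v (0\<^sub>v (n + n) + ((a2 + 0\<^sub>v n) @\<^sub>v (f + b)))) + (0\<^sub>v s @\<^sub>v (hz @\<^sub>v 0\<^sub>v n))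
        + (0\<^sub>v s @\<^sub>v (- bz @\<^sub>v - az)) + (bh @\<^sub>v (0\<^sub>v n @\<^sub>v 0\<^sub>v n))
      = (a - e + bh) @\<^sub>v ((a2 + hz - bz) @\<^sub>v (f + b - az))"
      if "a \<in> carrier_vec s" "e \<in> carrier_vec s" "bh \<in> carrier_vec s" "a2 \<in> carrier_vec n"
        "f \<in> carrier_vec n" "b \<in> carrier_vec n" "hz \<in> carrier_vec n" "bz \<in> carrier_vec n" "az \<in> carrier_vec n"
      for a e bh a2 f b hz bz az :: "real vec"
      using that by (intro eq_vecI) auto
    show ?thesis
      unfolding split[symmetric] xc 1 2 3 4
      by (rule alg) (auto simp: dm dm2 intro!: carrier_vecI)
  qed
  have step: "pc (Suc k) = Ah h *\<^sub>v pc k - Eh h *\<^sub>v (K *\<^sub>v \<chi> k) + Bh h *\<^sub>v z k"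
    "xe (Suc k) = A2x k + H *\<^sub>v zb k - Bt *\<^sub>v (K *\<^sub>v zh k)"
    "\<chi> (Suc k) = At *\<^sub>v xe k + (At - Bt * K) *\<^sub>v \<chi> k - At *\<^sub>v zh k" for k
  proof -
    have "pc (Suc k) = Ah h *\<^sub>v pc k - Eh h *\<^sub>v (K *\<^sub>v \<chi> k) + Bh h *\<^sub>v z k \<and>
      xe (Suc k) @\<^sub>v \<chi> (Suc k) = (A2x k + H *\<^sub>v zb k - Bt *\<^sub>v (K *\<^sub>v zh k)) @\<^sub>v
       (At *\<^sub>v xe k + (At - Bt * K) *\<^sub>v \<chi> k - At *\<^sub>v zh k)"
      by (subst append_vec_eq[OF pcc, symmetric]) (use parts h' in \<open>auto intro!: carrier_vecI\<close>)
    moreover have "xe (Suc k) = A2x k + H *\<^sub>v zb k - Bt *\<^sub>v (K *\<^sub>v zh k) \<and>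
       \<chi> (Suc k) = At *\<^sub>v xe k + (At - Bt * K) *\<^sub>v \<chi> k - At *\<^sub>v zh k"
      if "xe (Suc k) @\<^sub>v \<chi> (Suc k) = (A2x k + H *\<^sub>v zb k - Bt *\<^sub>v (K *\<^sub>v zh k)) @\<^sub>v
       (At *\<^sub>v xe k + (At - Bt * K) *\<^sub>v \<chi> k - At *\<^sub>v zh k)"
      by (subst append_vec_eq[OF xec, symmetric]) (use that c in \<open>auto intro!: carrier_vecI\<close>)
    ultimately show "pc (Suc k) = Ah h *\<^sub>v pc k - Eh h *\<^sub>v (K *\<^sub>v \<chi> k) + Bh h *\<^sub>v z k"
    "xe (Suc k) = A2x k + H *\<^sub>v zb k - Bt *\<^sub>v (K *\<^sub>v zh k)"
    "\<chi> (Suc k) = At *\<^sub>v xe k + (At - Bt * K) *\<^sub>v \<chi> k - At *\<^sub>v zh k" by blast+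
  qed
  have mv: "M *\<^sub>v w \<in> carrier_vec i" if "M \<in> carrier_mat i j" for M :: "real mat" and w i j
    using that by (auto intro!: carrier_vecI)
  note mvs = mv[OF c(1)] mv[OF c(2)] mv[OF c(3)] mv[OF c(4)] mv[OF c(5)] mv[OF h'(1)] mv[OF h'(2)]
    mv[OF h'(3)] mv[OF sq(6)]
  have alg1: "a - e + b = a + b - e" if "a \<in> carrier_vec s" "e \<in> carrier_vec s" "b \<in> carrier_vec s"
    for a e b :: "real vec" using that by (intro eq_vecI) auto
  have alg2: "a - hc + hz - bz = a - bz + (hz - hc)"
    if "a \<in> carrier_vec n" "hc \<in> carrier_vec n" "hz \<in> carrier_vec n" "bz \<in> carrier_vec n"
    for a hc hz bz :: "real vec" using that by (intro eq_vecI) auto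
  have alg3: "a + b - e = b + a - e" if "a \<in> carrier_vec n" "b \<in> carrier_vec n" "e \<in> carrier_vec n"
    for a b e :: "real vec" using that by (intro eq_vecI) auto
  have "design_run Ct At Bt K H h pc xe \<xi> zb zh z u"
    unfolding design_run_def \<xi>\<chi> n s_def[symmetric]
  proof (intro conjI allI)
    fix k
    show "pc (Suc k) = Ah h *\<^sub>v pc k + Bh h *\<^sub>v z k - Eh h *\<^sub>v (K *\<^sub>v \<chi> k)"
      unfolding step(1) by (intro alg1 mvs)
    show "xe (Suc k) = At *\<^sub>v xe k - Bt *\<^sub>v (K *\<^sub>v zh k) + H *\<^sub>v (zb k - Ct *\<^sub>v xe k)"
      unfolding step(2) A2x mult_minus_distrib_mat_vec[OF c(5) zb mvs(3)] by (intro alg2 mvs)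
    show "\<chi> (Suc k) = (At - Bt * K) *\<^sub>v \<chi> k + At *\<^sub>v xe k - At *\<^sub>v zh k"
      unfolding step(3) by (intro alg3 mvs)
  qed (use pcc xec \<xi>c u' in auto)
  then show ?thesis by blast
qed

lemma zeta_carrier:
  "zeta_bar p N a \<kappa> \<kappa>1 y yr i k \<in> carrier_vec p" "zeta_hat n N a \<kappa>h \<xi> i k \<in> carrier_vec n"
  by (simp_all add: zeta_bar_def zeta_hat_def)

text \<open>The common core of both claims, applied once to a given target model and once to the
  block companion triple. Each agent is replaced by its representation under the input
  \<open>v = - K \<chi>\<close>, which is the setting of \<open>network_sync\<close>.\<close>

lemma design_sync:
  fixes At Bt Ct K H :: "real mat"
  assumes c: "At \<in> carrier_mat n n" "Bt \<in> carrier_mat n p" "Ct \<in> carrier_mat p n"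
      "K \<in> carrier_mat p n" "H \<in> carrier_mat n p"
    and AK: "schur_stable (At - Bt * K)" and AH: "schur_stable (At - H * Ct)"
    and ev: "\<And>l. eigenvalue (map_mat complex_of_real At) l \<Longrightarrow> cmod l \<le> 1"
    and exo: "\<exists>xt. (\<forall>k. xt k \<in> carrier_vec n) \<and> (\<forall>k. xt (Suc k) = At *\<^sub>v xt k) \<and>
      (\<forall>k. yr (int k) = Ct *\<^sub>v xt k)"
    and pre: "\<And>i. i \<in> M \<Longrightarrow> asymptotic_precompensator p Ct At Bt (ag i) (h i)"
    and a: "a \<in> tree_graphs N" and \<sigma>: "\<sigma> \<in> {1..N} \<rightarrow> M"
    and \<kappa>: "comm_delays N \<kappa>" "comm_delays N \<kappa>h"
    and run: "\<And>i. i \<in> {1..N} \<Longrightarrow> agent_run (ag (\<sigma> i)) (x i) (u i) (z i) (y i)"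
      "\<And>i. i \<in> {1..N} \<Longrightarrow> design_run Ct At Bt K H (h (\<sigma> i)) (pc i) (xe i) (\<chi> i)
         (zeta_bar p N a \<kappa> \<kappa>1 y yr i) (zeta_hat n N a \<kappa>h \<chi> i) (z i) (u i)"
  shows "delayed_output_sync p N a \<kappa> \<kappa>1 y yr"
proof -
  have n: "dim_row At = n" using c by auto
  have "\<exists>xh \<rho>. (\<forall>k. xh k \<in> carrier_vec n) \<and> vec_null p \<rho> \<and>
       (\<forall>k. xh (Suc k) = At *\<^sub>v xh k + Bt *\<^sub>v (\<rho> k - K *\<^sub>v \<chi> i (int k))) \<and>
       (\<forall>k. y i (int k) = Ct *\<^sub>v xh k)" if i: "i \<in> {1..N}" for i
  proof -
    have M: "\<sigma> i \<in> M" using \<sigma> i by auto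
    define v where "v k = - (K *\<^sub>v \<chi> i (int k))" for k
    have vc: "v k \<in> carrier_vec p" for k using c unfolding v_def by (auto intro!: carrier_vecI)
    have dims: "precomp_dims p (ag (\<sigma> i)) (h (\<sigma> i))"
      using pre[OF M] by (simp add: asymptotic_precompensator_def)
    have neg: "X *\<^sub>v v k = - (X *\<^sub>v (K *\<^sub>v \<chi> i (int k)))" if "X \<in> carrier_mat j p" for X j k
      using that c unfolding v_def by (intro eq_vecI) (auto intro!: carrier_vecI)
    have add: "b + - w = b - w" if "dim_vec b = dim_vec w" for b w :: "real vec"
      using that by (intro eq_vecI) auto
    have "precomp_run (h (\<sigma> i)) (pc i) (z i) v (u i)"
      unfolding precomp_run_def
    proof (intro conjI allI)
      from dims have d: "Eh (h (\<sigma> i)) \<in> carrier_mat (dim_row (Ah (h (\<sigma> i)))) p"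
        "Dh (h (\<sigma> i)) \<in> carrier_mat (dim_col (Ba (ag (\<sigma> i)))) p"
        and b: "Bh (h (\<sigma> i)) \<in> carrier_mat (dim_row (Ah (h (\<sigma> i)))) (dim_row (Cm (ag (\<sigma> i))))"
        "Ch (h (\<sigma> i)) \<in> carrier_mat (dim_col (Ba (ag (\<sigma> i)))) (dim_row (Ah (h (\<sigma> i))))"
        unfolding precomp_dims_def Let_def by blast+
      have d3: "dim_row (Bh (h (\<sigma> i))) = dim_row (Eh (h (\<sigma> i)))"
        by (simp only: carrier_matD(1)[OF d(1)] carrier_matD(1)[OF b(1)])
      have d4: "dim_row (Ch (h (\<sigma> i))) = dim_row (Dh (h (\<sigma> i)))"
        by (simp only: carrier_matD(1)[OF d(2)] carrier_matD(1)[OF b(2)])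
      from run(2)[OF i] show "pc i 0 \<in> carrier_vec (dim_row (Ah (h (\<sigma> i))))"
        unfolding design_run_def by blast
      fix k
      from run(2)[OF i] have "pc i (Suc k) = Ah (h (\<sigma> i)) *\<^sub>v pc i k + Bh (h (\<sigma> i)) *\<^sub>v z i k
          - Eh (h (\<sigma> i)) *\<^sub>v (K *\<^sub>v \<chi> i (int k))" unfolding design_run_def by blast
      then show "pc i (Suc k) = Ah (h (\<sigma> i)) *\<^sub>v pc i k + Bh (h (\<sigma> i)) *\<^sub>v z i k + Eh (h (\<sigma> i)) *\<^sub>v v k"
        unfolding neg[OF d(1)] by (subst add) (simp_all only: index_add_vec dim_mult_mat_vec d3)
      from run(2)[OF i] have "u i k = Ch (h (\<sigma> i)) *\<^sub>v pc i k - Dh (h (\<sigma> i)) *\<^sub>v (K *\<^sub>v \<chi> i (int k))"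
        unfolding design_run_def by blast
      then show "u i k = Ch (h (\<sigma> i)) *\<^sub>v pc i k + Dh (h (\<sigma> i)) *\<^sub>v v k"
        unfolding neg[OF d(2)] by (subst add) (simp_all only: dim_mult_mat_vec d4)
    qed
    then obtain xh \<rho> where xh: "\<And>k. xh k \<in> carrier_vec n" "vec_null p \<rho>"
      "\<And>k. xh (Suc k) = At *\<^sub>v xh k + Bt *\<^sub>v (v k + \<rho> k)" "\<And>k. y i (int k) = Ct *\<^sub>v xh k"
      using pre[OF M] vc run(1)[OF i] unfolding asymptotic_precompensator_def n by blast
    have "v k + \<rho> k = \<rho> k - K *\<^sub>v \<chi> i (int k)" for k
      using vec_nullD(1)[OF xh(2), of k] c unfolding v_def by (intro eq_vecI) auto
    then show ?thesis using xh by (intro exI[of _ xh] exI[of _ \<rho>]) auto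
  qed
  then obtain xh \<rho> where xh: "\<And>i k. i \<in> {1..N} \<Longrightarrow> xh i k \<in> carrier_vec n"
      "\<And>i k. i \<in> {1..N} \<Longrightarrow> xh i (Suc k) = At *\<^sub>v xh i k + Bt *\<^sub>v (\<rho> i k - K *\<^sub>v \<chi> i (int k))"
      "\<And>i k. i \<in> {1..N} \<Longrightarrow> y i (int k) = Ct *\<^sub>v xh i k"
    and \<rho>: "\<And>i. i \<in> {1..N} \<Longrightarrow> vec_null p (\<rho> i)" by metis
  from exo obtain xt where xt: "\<And>k. xt k \<in> carrier_vec n" "\<And>k. xt (Suc k) = At *\<^sub>v xt k"
    "\<And>k. yr (int k) = Ct *\<^sub>v xt k" by blast
  have xec: "xe i k \<in> carrier_vec n" if "i \<in> {1..N}" for i k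
    using run(2)[OF that] c by (cases k) (auto simp: design_run_def intro!: carrier_vecI)
  show ?thesis
    by (rule network_sync[OF c AK AH ev a \<kappa> xt xh \<rho> xec])
      (use run(2) n in \<open>auto simp: design_run_def\<close>)
qed

section \<open>Synchronization for a given target model\<close>

lemma target_model_sync:
  assumes exo: "admissible_exosystem p Ar Cr" and tm: "target_model p Ar Cr M ag nq Ct At Bt"
    and pre: "\<forall>i \<in> M. precompensator p Ct At Bt (ag i) (h i)"
    and KH: "K \<in> carrier_mat p (dim_row At)" "H \<in> carrier_mat (dim_row At) p"
    and st: "schur_stable (At - Bt * K)" "schur_stable (At - H * Ct)"
    and a: "a \<in> tree_graphs N" "\<sigma> \<in> {1..N} \<rightarrow> M" "comm_delays N \<kappa>" "comm_delays N \<kappa>h"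
    and yr: "exo_run p Ar Cr yr"
    and run: "\<forall>i \<in> {1..N}. agent_run (ag (\<sigma> i)) (x i) (u i) (z i) (y i) \<and>
             design_run Ct At Bt K H (h (\<sigma> i)) (pc i) (xe i) (\<chi> i)
               (zeta_bar p N a \<kappa> \<kappa>1 y yr i) (zeta_hat (dim_row At) N a \<kappa>h \<chi> i) (z i) (u i)"
  shows "delayed_output_sync p N a \<kappa> \<kappa>1 y yr"
proof -
  define nr nt where "nr = dim_row Ar" and "nt = dim_row At"
  have At: "At \<in> carrier_mat nt nt" and Bt: "Bt \<in> carrier_mat nt p" and Ct: "Ct \<in> carrier_mat p nt"
    and gen: "\<And>xr0. xr0 \<in> carrier_vec nr \<Longrightarrow> \<exists>xt0 \<in> carrier_vec nt.
        \<forall>k. Ct *\<^sub>v ((At ^\<^sub>m k) *\<^sub>v xt0) = Cr *\<^sub>v ((Ar ^\<^sub>m k) *\<^sub>v xr0)"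
    and ev: "{l. eigenvalue (map_mat complex_of_real At) l}
      \<subseteq> {l. eigenvalue (map_mat complex_of_real Ar) l} \<union> {0}"
    using tm unfolding target_model_def nr_def nt_def by (auto simp: square_mat.simps)
  \<comment> \<open>The eigenvalues inherited from \<open>Ar\<close> lie on the unit circle and any
    further one is 0, so all of them lie in the closed unit disc.\<close>
  have ev1: "cmod l \<le> 1" if "eigenvalue (map_mat complex_of_real At) l" for l
  proof -
    from ev that have "eigenvalue (map_mat complex_of_real Ar) l \<or> l = 0" by blast
    then show ?thesis using exo unfolding admissible_exosystem_def by (metis norm_zero order.refl zero_le_one)
  qed
  have Ar: "Ar \<in> carrier_mat nr nr"
    using exo by (auto simp: admissible_exosystem_def nr_def)
  from yr obtain xr where xr0: "xr 0 \<in> carrier_vec nr" and xr: "\<And>k. xr (Suc k) = Ar *\<^sub>v xr k"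
    "\<And>k. yr (int k) = Cr *\<^sub>v xr k" unfolding exo_run_def nr_def by blast
  \<comment> \<open>Matrix powers recurse by multiplication from the right; generalizing over
    \<open>w\<close> moves the factor to the left.\<close>
  have pow_step: "(A ^\<^sub>m Suc k) *\<^sub>v w = A *\<^sub>v ((A ^\<^sub>m k) *\<^sub>v w)"
    if A: "A \<in> carrier_mat j j" and w: "w \<in> carrier_vec j" for A :: "real mat" and w j k
    using w
  proof (induction k arbitrary: w)
    case (Suc k)
    note Aw = mult_mat_vec_carrier[OF A Suc.prems]
    have *: "(A ^\<^sub>m Suc k) *\<^sub>v w = (A ^\<^sub>m k) *\<^sub>v (A *\<^sub>v w)" for k
      using assoc_mult_mat_vec[OF pow_carrier_mat[OF A] A Suc.prems, of k] by simp
    show ?case unfolding *[of "Suc k"] Suc.IH[OF Aw] *[of k] ..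
  qed (use A in simp)
  have xr_pow: "xr k = (Ar ^\<^sub>m k) *\<^sub>v xr 0" for k
    by (induction k) (use xr0 Ar xr(1) pow_step[OF Ar xr0] in \<open>simp_all del: pow_mat.simps(2)\<close>)
  from gen[OF xr0] obtain xt0 where xt0: "xt0 \<in> carrier_vec nt"
    "\<And>k. Ct *\<^sub>v ((At ^\<^sub>m k) *\<^sub>v xt0) = Cr *\<^sub>v ((Ar ^\<^sub>m k) *\<^sub>v xr 0)" by blast
  have ex: "\<exists>xt. (\<forall>k. xt k \<in> carrier_vec nt) \<and> (\<forall>k. xt (Suc k) = At *\<^sub>v xt k) \<and>
      (\<forall>k. yr (int k) = Ct *\<^sub>v xt k)"
  proof (intro exI[of _ "\<lambda>k. (At ^\<^sub>m k) *\<^sub>v xt0"] conjI allI)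
    fix k
    show "(At ^\<^sub>m k) *\<^sub>v xt0 \<in> carrier_vec nt"
      by (rule mult_mat_vec_carrier[OF pow_carrier_mat[OF At] xt0(1)])
    show "(At ^\<^sub>m Suc k) *\<^sub>v xt0 = At *\<^sub>v ((At ^\<^sub>m k) *\<^sub>v xt0)" by (rule pow_step[OF At xt0(1)])
    show "yr (int k) = Ct *\<^sub>v ((At ^\<^sub>m k) *\<^sub>v xt0)"
      unfolding xr(2) xt0(2) by (rule arg_cong[OF xr_pow])
  qed
  show ?thesis
    by (rule design_sync[OF At Bt Ct KH[folded nt_def] st ev1 ex, of M ag h a N \<sigma> \<kappa> \<kappa>h x u z y pc xe \<chi> \<kappa>1])
      (use precompensator_asymptotic[OF _ Bt[unfolded nt_def]] pre a run[folded nt_def] in auto)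
qed

section \<open>The block companion target model and the constructed protocol\<close>

lemma target_eigenvalue:
  assumes Ar: "Ar \<in> carrier_mat n n"
    and ev: "\<And>l. eigenvalue (map_mat complex_of_real Ar) l \<Longrightarrow> cmod l = 1"
    and \<psi>: "\<psi> = monom 1 d * char_poly Ar" "0 < degree \<psi>"
    and l: "eigenvalue (map_mat complex_of_real (companion p \<psi>)) l"
  shows "cmod l \<le> 1"
proof -
  have monic: "lead_coeff \<psi> = 1"
    using degree_monic_char_poly[OF Ar] by (simp add: \<psi>(1) lead_coeff_mult degree_monom_eq)
  have "poly (map_poly complex_of_real \<psi>) l = 0"
    using companion_eigenvalue[OF _ _ l[unfolded map_mat_companion]] monic \<psi>(2)
    by (simp add: coeff_map_poly)
  moreover interpret mp: map_poly_comm_ring_hom complex_of_real ..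
  have "map_poly complex_of_real \<psi> = map_poly complex_of_real (monom 1 d) * map_poly complex_of_real (char_poly Ar)"
    unfolding \<psi>(1) by (rule mp.hom_mult)
  ultimately have "l ^ d * poly (char_poly (map_mat complex_of_real Ar)) l = 0"
    unfolding of_real_hom.char_poly_hom[OF Ar] by (simp add: poly_monom)
  then have "l = 0 \<or> eigenvalue (map_mat complex_of_real Ar) l"
    using Ar by (auto simp: eigenvalue_root_char_poly[of _ n])
  then show ?thesis using ev by auto
qed

text \<open>As a multiple of the characteristic polynomial of \<open>Ar\<close>, \<psi> annihilates
  every component of the exosystem output; stacking successive outputs therefore gives a run of the
  companion matrix with zero input.\<close>

lemma exo_run_companion:
  assumes exo: "admissible_exosystem p Ar Cr" and run: "exo_run p Ar Cr yr"
    and \<psi>: "\<psi> = monom 1 d * char_poly Ar" "0 < degree \<psi>"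
  shows "\<exists>xt. (\<forall>k. xt k \<in> carrier_vec (degree \<psi> * p)) \<and> (\<forall>k. xt (Suc k) = companion p \<psi> *\<^sub>v xt k) \<and>
      (\<forall>k. yr (int k) = companion_out p (degree \<psi>) *\<^sub>v xt k)"
proof -
  define n where "n = dim_row Ar"
  have Ar: "Ar \<in> carrier_mat n n" and Cr: "Cr \<in> carrier_mat p n"
    using exo by (auto simp: admissible_exosystem_def n_def)
  from run obtain xr where yrc: "\<And>k. yr k \<in> carrier_vec p" and xr0: "xr 0 \<in> carrier_vec n"
    and xr: "\<And>k. xr (Suc k) = Ar *\<^sub>v xr k" and yr: "\<And>k. yr (int k) = Cr *\<^sub>v xr k"
    unfolding exo_run_def n_def by blast
  have xrc: "xr k \<in> carrier_vec n" for k
    by (cases k) (use xr0 xr Ar in \<open>auto intro!: carrier_vecI\<close>)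
  have monic: "lead_coeff \<psi> = 1"
    using degree_monic_char_poly[OF Ar] by (simp add: \<psi>(1) lead_coeff_mult degree_monom_eq)
  have "shift_poly \<psi> (\<lambda>k. yr (int k) $ t) k = 0\<^sub>v p $ t" if t: "t < p" for t k
  proof -
    have "shift_poly (char_poly Ar) (\<lambda>k. xr k $ j) = (\<lambda>k. 0)" if "j < n" for j
      using char_poly_annihilates[of Ar n xr, OF Ar xrc xr that] by auto
    then have z: "shift_poly \<psi> (\<lambda>k. xr k $ j) k = 0" if "j < n" for j
      using that unfolding \<psi>(1) shift_poly_mult by (simp add: shift_poly_def)
    have "(\<lambda>k. yr (int k) $ t) = (\<lambda>k. \<Sum>j<n. Cr $$ (t, j) * xr k $ j)"
      unfolding yr using index_mult_mat_vec_sum[OF Cr xrc t] by auto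
    then show ?thesis using z t by (simp add: shift_poly_seq_sum shift_poly_seq_smult)
  qed
  note st = companion_run_stack[where y = "\<lambda>k. yr (int k)" and v = "\<lambda>k. 0\<^sub>v p", OF monic \<psi>(2) zero_carrier_vec yrc this]
  have "stack p (degree \<psi>) (\<lambda>k. yr (int k)) (Suc k)
      = companion p \<psi> *\<^sub>v stack p (degree \<psi>) (\<lambda>k. yr (int k)) k" for k
  proof -
    have "stack p (degree \<psi>) (\<lambda>k. yr (int k)) (Suc k)
        = companion p \<psi> *\<^sub>v stack p (degree \<psi>) (\<lambda>k. yr (int k)) k
          + companion_in p (degree \<psi>) *\<^sub>v 0\<^sub>v p"
      by (rule st(1))
    also have "companion_in p (degree \<psi>) *\<^sub>v 0\<^sub>v p = (0\<^sub>v (degree \<psi> * p) :: real vec)"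
      by (intro eq_vecI) (auto simp: scalar_prod_def)
    also have "companion p \<psi> *\<^sub>v stack p (degree \<psi>) (\<lambda>k. yr (int k)) k + 0\<^sub>v (degree \<psi> * p)
        = companion p \<psi> *\<^sub>v stack p (degree \<psi>) (\<lambda>k. yr (int k)) k"
      by (rule right_zero_vec[OF mult_mat_vec_carrier[OF companion_carrier(1) stack_carrier]])
    finally show ?thesis .
  qed
  then show ?thesis
    using st(2) by (intro exI[of _ "stack p (degree \<psi>) (\<lambda>k. yr (int k))"]) simp
qed

lemma scalable_sync_solvable_admissible:
  fixes M :: "'m set"
  assumes fin: "finite M" and adm: "\<And>i. i \<in> M \<Longrightarrow> admissible_agent p (ag i)"
    and exo: "admissible_exosystem p Ar Cr"
  shows "scalable_sync_solvable p Ar Cr M ag"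
proof -
  define nr where "nr = dim_row Ar"
  have Ar: "Ar \<in> carrier_mat nr nr"
    and ev: "\<And>l. eigenvalue (map_mat complex_of_real Ar) l \<Longrightarrow> cmod l = 1"
    using exo by (auto simp: admissible_exosystem_def nr_def)
  have "\<forall>i\<in>M. \<exists>d. \<forall>\<psi>. lead_coeff \<psi> = 1 \<longrightarrow> d < degree \<psi> \<longrightarrow> (\<exists>h. asymptotic_precompensator p
    (companion_out p (degree \<psi>)) (companion p \<psi>) (companion_in p (degree \<psi>)) (ag i) h)"
    using asymptotic_precompensator_exists[OF adm] by blast
  from bchoice[OF this] obtain d where d: "\<And>i \<psi>. i \<in> M \<Longrightarrow> lead_coeff \<psi> = 1 \<Longrightarrow> d i < degree \<psi> \<Longrightarrow>
    \<exists>h. asymptotic_precompensator p (companion_out p (degree \<psi>)) (companion p \<psi>)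
      (companion_in p (degree \<psi>)) (ag i) h" by blast
  \<comment> \<open>One degree above the bounds of all agents, available since \<open>M\<close> is
    finite. \<open>insert 0\<close> covers empty \<open>M\<close>, and \<open>Suc\<close> keeps the
    degree of \<psi> positive even if \<open>Ar\<close> has dimension 0.\<close>
  define e where "e = Suc (Max (insert 0 (d ` M)))"
  have de: "d i < e" if "i \<in> M" for i
    using fin that by (auto simp: e_def less_Suc_eq_le intro: Max_ge)
  define \<psi> where "\<psi> = monom 1 e * char_poly Ar"
  have monic: "lead_coeff \<psi> = 1"
    using degree_monic_char_poly[OF Ar] by (simp add: \<psi>_def lead_coeff_mult degree_monom_eq)
  have "char_poly Ar \<noteq> 0" using degree_monic_char_poly[OF Ar] by auto
  then have "degree \<psi> = e + degree (char_poly Ar)"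
    by (simp add: \<psi>_def degree_mult_eq degree_monom_eq monom_eq_0_iff)
  then have deg: "e \<le> degree \<psi>" "0 < degree \<psi>" by (auto simp: e_def)
  \<comment> \<open>The dimension of the target state, and hence of the exchanged variable.\<close>
  define n where "n = degree \<psi> * p"
  define At Bt Ct K H :: "real mat" where "At = companion p \<psi>" and "Bt = companion_in p (degree \<psi>)"
    and "Ct = companion_out p (degree \<psi>)" and "K = companion_feedback p \<psi>"
    and "H = companion_injection p \<psi>"
  note tdefs = At_def Bt_def Ct_def K_def H_def
  have c: "At \<in> carrier_mat n n" "Bt \<in> carrier_mat n p" "Ct \<in> carrier_mat p n"
      "K \<in> carrier_mat p n" "H \<in> carrier_mat n p"
    by (simp_all add: tdefs n_def)
  have "\<forall>i\<in>M. \<exists>h. asymptotic_precompensator p Ct At Bt (ag i) h"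
    using d[OF _ monic] de deg(1) unfolding tdefs by (meson less_le_trans)
  from bchoice[OF this] obtain h where h: "\<And>i. i \<in> M \<Longrightarrow> asymptotic_precompensator p Ct At Bt (ag i) (h i)"
    by blast
  have hd: "precomp_dims p (ag i) (h i)" if "i \<in> M" for i
    using h[OF that] by (simp add: asymptotic_precompensator_def)
  have AK: "schur_stable (At - Bt * K)" and AH: "schur_stable (At - H * Ct)"
    unfolding tdefs using schur_stable_companion_feedback[OF monic deg(2)]
      schur_stable_companion_injection[OF monic deg(2)] by auto
  have ev1: "cmod l \<le> 1" if "eigenvalue (map_mat complex_of_real At) l" for l
    using target_eigenvalue[OF Ar ev \<psi>_def deg(2)] that unfolding tdefs by blast
  define P where "P i = design_protocol p Ct At Bt K H (ag i) (h i)" for i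
  show ?thesis
    unfolding scalable_sync_solvable_def
  proof (intro exI[of _ n] exI[of _ P] conjI ballI allI impI)
    show "protocol_dims p n (ag i) (P i)" if "i \<in> M" for i
      unfolding P_def by (rule design_protocol_dims[OF c hd[OF that]])
    fix N a \<sigma> \<kappa> \<kappa>h \<kappa>1 and x xc u z :: "nat \<Rightarrow> nat \<Rightarrow> real vec" and y \<xi> yr
    assume a: "a \<in> tree_graphs N" and \<sigma>: "\<sigma> \<in> {1..N} \<rightarrow> M" and \<kappa>: "comm_delays N \<kappa>" "comm_delays N \<kappa>h"
      and yr: "exo_run p Ar Cr yr"
      and run: "\<forall>i \<in> {1..N}. agent_run (ag (\<sigma> i)) (x i) (u i) (z i) (y i) \<and>
             protocol_run (P (\<sigma> i)) (xc i) (zeta_bar p N a \<kappa> \<kappa>1 y yr i)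
               (zeta_hat n N a \<kappa>h \<xi> i) (z i) (u i) (\<xi> i)"
    have "\<forall>i\<in>{1..N}. \<exists>pc xe. design_run Ct At Bt K H (h (\<sigma> i)) pc xe (\<xi> i)
       (zeta_bar p N a \<kappa> \<kappa>1 y yr i) (zeta_hat n N a \<kappa>h \<xi> i) (z i) (u i)"
    proof
      fix i assume i: "i \<in> {1..N}"
      then have M: "\<sigma> i \<in> M" using \<sigma> by auto
      have zc: "z i k \<in> carrier_vec (dim_row (Cm (ag (\<sigma> i))))" for k
        using run i by (auto simp: agent_run_def intro!: carrier_vecI)
      show "\<exists>pc xe. design_run Ct At Bt K H (h (\<sigma> i)) pc xe (\<xi> i)
         (zeta_bar p N a \<kappa> \<kappa>1 y yr i) (zeta_hat n N a \<kappa>h \<xi> i) (z i) (u i)"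
        using run i unfolding P_def
        by (intro design_protocol_run[OF c hd[OF M], of _ _ "z i" "xc i"]) (auto simp: zeta_carrier zc)
    qed
    from bchoice[OF this] obtain pc where "\<forall>i\<in>{1..N}. \<exists>xe. design_run Ct At Bt K H (h (\<sigma> i)) (pc i) xe (\<xi> i)
       (zeta_bar p N a \<kappa> \<kappa>1 y yr i) (zeta_hat n N a \<kappa>h \<xi> i) (z i) (u i)" by blast
    from bchoice[OF this] obtain xe where dr: "\<And>i. i \<in> {1..N} \<Longrightarrow> design_run Ct At Bt K H (h (\<sigma> i)) (pc i) (xe i) (\<xi> i)
       (zeta_bar p N a \<kappa> \<kappa>1 y yr i) (zeta_hat n N a \<kappa>h \<xi> i) (z i) (u i)" by blast
    have ex: "\<exists>xt. (\<forall>k. xt k \<in> carrier_vec n) \<and> (\<forall>k. xt (Suc k) = At *\<^sub>v xt k) \<and>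
      (\<forall>k. yr (int k) = Ct *\<^sub>v xt k)"
      using exo_run_companion[OF exo yr \<psi>_def deg(2)] unfolding tdefs n_def .
    show "delayed_output_sync p N a \<kappa> \<kappa>1 y yr"
      by (rule design_sync[OF c AK AH ev1 ex h a \<sigma> \<kappa> _ dr]) (use run in auto)
  qed
qed

theorem theorem3:
  fixes p :: nat
    and Ar Cr :: "real mat"
    and M :: "'m set"
    and ag :: "'m \<Rightarrow> agent"
  assumes "finite M"
    and "\<And>i. i \<in> M \<Longrightarrow> admissible_agent p (ag i)"
    and "admissible_exosystem p Ar Cr"
  shows "scalable_sync_solvable p Ar Cr M ag \<and>
    (\<forall>nq Ct At Bt (h :: 'm \<Rightarrow> precomp) K H.
       target_model p Ar Cr M ag nq Ct At Bt \<longrightarrow>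
       (\<forall>i \<in> M. precompensator p Ct At Bt (ag i) (h i)) \<longrightarrow>
       K \<in> carrier_mat p (dim_row At) \<longrightarrow> H \<in> carrier_mat (dim_row At) p \<longrightarrow>
       schur_stable (At - Bt * K) \<longrightarrow> schur_stable (At - H * Ct) \<longrightarrow>
       (\<forall>N a \<sigma> \<kappa> \<kappa>h \<kappa>1 x pc xe \<chi> u z y yr.
          a \<in> tree_graphs N \<longrightarrow> \<sigma> \<in> {1..N} \<rightarrow> M \<longrightarrow>
          comm_delays N \<kappa> \<longrightarrow> comm_delays N \<kappa>h \<longrightarrow>
          exo_run p Ar Cr yr \<longrightarrow>
          (\<forall>i \<in> {1..N}. agent_run (ag (\<sigma> i)) (x i) (u i) (z i) (y i) \<and>
             design_run Ct At Bt K H (h (\<sigma> i)) (pc i) (xe i) (\<chi> i)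
               (zeta_bar p N a \<kappa> \<kappa>1 y yr i) (zeta_hat (dim_row At) N a \<kappa>h \<chi> i) (z i) (u i)) \<longrightarrow>
          delayed_output_sync p N a \<kappa> \<kappa>1 y yr))"
proof (intro conjI allI impI)
  show "scalable_sync_solvable p Ar Cr M ag"
    by (rule scalable_sync_solvable_admissible) (fact assms)+
qed (rule target_model_sync[OF assms(3)])

end
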